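(* For $(\lambda,s)\in(1,\infty)\times[0,1)$ define $$q_{\lambda,s}(t)=\kappa_\lambda^{-1}\bigl(1+s\sin(2\pi t)\bigr),\qquad g_{\lambda,s}=q_{\lambda,s}(t)^2\,dt^2+h_\lambda(t)$$ on $\mathbb{T}^3=\mathbb{T}^2\times S^1$. Then every $g_{\lambda,s}$ is nonflat and has the Euclidean codimension-one stable norm, $$\|r_{a,b,c}\|_{\mathrm{st},g_{\lambda,s}}=\sqrt{a^2+b^2+c^2}\qquad\text{for all }(a,b,c)\in\mathbb{R}^3 .$$ For each fixed $\lambda>1$, the metrics $g_{\lambda,s}$, $s\in[0,1)$, have the same volume $\kappa_\lambda^{-1}$ and are pairwise non-isometric. For each fixed $s\in[0,1)$, as $\lambda\downarrow1$ the metrics $g_{\lambda,s}$ converge, after pullback by diffeomorphisms of $\mathbb{T}^3$ isotopic to the identity, to the unit Euclidean flat metric $dx^2+dy^2+dt^2$ in the $C^\infty$ topology.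
   Context: $\mathbb{T}^3=\mathbb{R}^3/\mathbb{Z}^3=\mathbb{T}^2_{(x,y)}\times S^1_t$ with $S^1=\mathbb{R}/\mathbb{Z}$, oriented by $dx\wedge dy\wedge dt$. For $(a,b,c)\in\mathbb{R}^3$, $r_{a,b,c}\in H_2(\mathbb{T}^3,\mathbb{R})$ is the class whose Poincar\'e dual is $a[dx]+b[dy]+c[dt]$. For $\lambda>0$ let $D_\lambda=\operatorname{diag}(\lambda^2,\lambda^{-2})$, let $R_\theta$ be the $2\times2$ rotation matrix by angle $\theta$, and let $$h_\lambda(t)=R_{2\pi t}^T D_\lambda R_{2\pi t},$$ regarded, for each $t$, as the constant-coefficient metric on $\mathbb{T}^2$ with this matrix in the coordinates $(x,y)$. Set $$\kappa_\lambda=\int_0^1\sqrt{\lambda^{-2}\cos^2(2\pi t)+\lambda^2\sin^2(2\pi t)}\,dt .$$ Stable norm: for $r\in H_2(\mathbb{T}^3,\mathbb{R})$, $\|r\|_{\mathrm{st},g}:=\inf\{\mathbf{M}_g(T): T \text{ a closed real } 2\text{-current with } [T]=r\}$, where $\mathbf{M}_g$ is mass (equivalently, one may use real Lipschitz cycles). *)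

theory Defs
  imports "HOL-Analysis.Analysis"
begin

(* Objects on the torus R^3/Z^3 are represented by their lifts to R^3, with coordinates
   x = p$1, y = p$2, t = p$3 and orientation dx dy dt.  Functions, tensor fields and forms
   on the torus are Z^3-periodic coefficient functions in the global coordinate frame. *)

definition ddir :: "'a::real_normed_vector \<Rightarrow> ('a \<Rightarrow> 'b::real_normed_vector) \<Rightarrow> 'a \<Rightarrow> 'b"
  where "ddir v f = (\<lambda>x. frechet_derivative f (at x) v)"

definition dirs :: "'a::real_normed_vector list \<Rightarrow> ('a \<Rightarrow> 'b::real_normed_vector) \<Rightarrow> 'a \<Rightarrow> 'b"
  where "dirs vs f = foldr ddir vs f"

(* C^infinity on the whole space: every iterated partial derivative is Frechet differentiable. *)
definition smooth :: "('a::euclidean_space \<Rightarrow> 'b::real_normed_vector) \<Rightarrow> bool"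
  where "smooth f \<longleftrightarrow> (\<forall>vs. set vs \<subseteq> Basis \<longrightarrow> (\<forall>x. dirs vs f differentiable (at x)))"

abbreviation pd :: "3 \<Rightarrow> (real^3 \<Rightarrow> 'b::real_normed_vector) \<Rightarrow> real^3 \<Rightarrow> 'b"
  where "pd i \<equiv> ddir (axis i 1)"

definition lattice3 :: "(real^3) set"
  where "lattice3 = {v. \<forall>i. v $ i \<in> \<int>}"

definition periodic :: "(real^3 \<Rightarrow> 'b) \<Rightarrow> bool"
  where "periodic f \<longleftrightarrow> (\<forall>x. \<forall>v\<in>lattice3. f (x + v) = f x)"

(* F is a lift of a smooth self-map of the torus.  Since R^3 is simply connected, every smooth
   self-map of the torus has such a lift, unique up to translation by lattice vectors. *)
definition torus_map :: "(real^3 \<Rightarrow> real^3) \<Rightarrow> bool"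
  where "torus_map F \<longleftrightarrow> smooth F \<and> (\<forall>x. \<forall>v\<in>lattice3. F (x + v) - F x \<in> lattice3)"

(* Equality of maps of the torus is equality of lifts modulo the lattice. *)
definition torus_diffeo :: "(real^3 \<Rightarrow> real^3) \<Rightarrow> bool"
  where "torus_diffeo F \<longleftrightarrow> torus_map F \<and>
    (\<exists>G. torus_map G \<and> (\<forall>x. G (F x) - x \<in> lattice3) \<and> (\<forall>x. F (G x) - x \<in> lattice3))"

(* Smoothness of the isotopy on the closed interval [0,1] is expressed, as usual, by a smooth
   extension H to all times; nothing is required of H outside [0,1] but smoothness. *)
definition isotopic_to_id :: "(real^3 \<Rightarrow> real^3) \<Rightarrow> bool"
  where "isotopic_to_id F \<longleftrightarrow> (\<exists>H :: real \<times> (real^3) \<Rightarrow> real^3. smooth H \<and>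
    (\<forall>u\<in>{0..1}. torus_diffeo (\<lambda>x. H (u, x))) \<and>
    (\<forall>x. H (0, x) - x \<in> lattice3) \<and> (\<forall>x. H (1, x) - F x \<in> lattice3))"

definition riemannian_metric :: "(real^3 \<Rightarrow> real^3^3) \<Rightarrow> bool"
  where "riemannian_metric g \<longleftrightarrow> smooth g \<and> periodic g \<and>
    (\<forall>x. transpose (g x) = g x) \<and> (\<forall>x v. v \<noteq> 0 \<longrightarrow> v \<bullet> (g x *v v) > 0)"

definition pullback_metric :: "(real^3 \<Rightarrow> real^3) \<Rightarrow> (real^3 \<Rightarrow> real^3^3) \<Rightarrow> real^3 \<Rightarrow> real^3^3"
  where "pullback_metric F g = (\<lambda>x. let J = matrix (frechet_derivative F (at x))
    in transpose J ** g (F x) ** J)"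

definition isometric_metrics :: "(real^3 \<Rightarrow> real^3^3) \<Rightarrow> (real^3 \<Rightarrow> real^3^3) \<Rightarrow> bool"
  where "isometric_metrics g g' \<longleftrightarrow> (\<exists>F. torus_diffeo F \<and> pullback_metric F g' = g)"

definition torus_volume :: "(real^3 \<Rightarrow> real^3^3) \<Rightarrow> real"
  where "torus_volume g = integral (cbox 0 1) (\<lambda>x. sqrt (det (g x)))"

(* christoffel g k i j is the symbol with upper index k and lower indices i, j. *)
definition christoffel :: "(real^3 \<Rightarrow> real^3^3) \<Rightarrow> 3 \<Rightarrow> 3 \<Rightarrow> 3 \<Rightarrow> real^3 \<Rightarrow> real"
  where "christoffel g k i j = (\<lambda>x. (\<Sum>l\<in>UNIV. matrix_inv (g x) $ k $ l *
    (pd i (\<lambda>y. g y $ j $ l) x + pd j (\<lambda>y. g y $ i $ l) x - pd l (\<lambda>y. g y $ i $ j) x)) / 2)"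

(* riemann g l k i j is the l-th component of R(d_i, d_j) d_k. *)
definition riemann :: "(real^3 \<Rightarrow> real^3^3) \<Rightarrow> 3 \<Rightarrow> 3 \<Rightarrow> 3 \<Rightarrow> 3 \<Rightarrow> real^3 \<Rightarrow> real"
  where "riemann g l k i j = (\<lambda>x.
    pd i (christoffel g l j k) x - pd j (christoffel g l i k) x +
    (\<Sum>m\<in>UNIV. christoffel g l i m x * christoffel g m j k x
             - christoffel g l j m x * christoffel g m i k x))"

definition flat_metric :: "(real^3 \<Rightarrow> real^3^3) \<Rightarrow> bool"
  where "flat_metric g \<longleftrightarrow> (\<forall>l k i j x. riemann g l k i j x = 0)"

definition Cinf_tendsto ::
    "('p \<Rightarrow> real^3 \<Rightarrow> 'b::real_normed_vector) \<Rightarrow> (real^3 \<Rightarrow> 'b) \<Rightarrow> 'p filter \<Rightarrow> bool"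
  where "Cinf_tendsto f f0 Fl \<longleftrightarrow> smooth f0 \<and>
    (\<forall>\<^sub>F p in Fl. smooth (f p)) \<and>
    (\<forall>vs. set vs \<subseteq> Basis \<longrightarrow> uniform_limit UNIV (\<lambda>p. dirs vs (f p)) (dirs vs f0) Fl)"

(* A 1-form is the vector of its coefficients; a 2-form omega is the skew-symmetric matrix
   omega(d_i, d_j); a 3-form is its coefficient with respect to dx dy dt. *)

definition forms1 :: "(real^3 \<Rightarrow> real^3) set"
  where "forms1 = {\<alpha>. smooth \<alpha> \<and> periodic \<alpha>}"

definition forms2 :: "(real^3 \<Rightarrow> real^3^3) set"
  where "forms2 = {\<omega>. smooth \<omega> \<and> periodic \<omega> \<and> (\<forall>x. transpose (\<omega> x) = - \<omega> x)}"

definition forms3 :: "(real^3 \<Rightarrow> real) set"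
  where "forms3 = {\<rho>. smooth \<rho> \<and> periodic \<rho>}"

definition ext_d1 :: "(real^3 \<Rightarrow> real^3) \<Rightarrow> real^3 \<Rightarrow> real^3^3"
  where "ext_d1 \<alpha> = (\<lambda>x. \<chi> i j. pd i (\<lambda>y. \<alpha> y $ j) x - pd j (\<lambda>y. \<alpha> y $ i) x)"

definition ext_d2 :: "(real^3 \<Rightarrow> real^3^3) \<Rightarrow> real^3 \<Rightarrow> real"
  where "ext_d2 \<omega> = (\<lambda>x. pd 1 (\<lambda>y. \<omega> y $ 2 $ 3) x + pd 2 (\<lambda>y. \<omega> y $ 3 $ 1) x
    + pd 3 (\<lambda>y. \<omega> y $ 1 $ 2) x)"

definition wedge12 :: "(real^3 \<Rightarrow> real^3) \<Rightarrow> (real^3 \<Rightarrow> real^3^3) \<Rightarrow> real^3 \<Rightarrow> real"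
  where "wedge12 \<alpha> \<omega> = (\<lambda>x. \<alpha> x $ 1 * \<omega> x $ 2 $ 3 + \<alpha> x $ 2 * \<omega> x $ 3 $ 1
    + \<alpha> x $ 3 * \<omega> x $ 1 $ 2)"

(* Linear functionals on a space of smooth forms that are continuous in the C^infinity topology,
   that is, bounded by a multiple of some C^N norm.  Values off the space are irrelevant. *)
definition current_on :: "(real^3 \<Rightarrow> 'b::real_normed_vector) set \<Rightarrow> ((real^3 \<Rightarrow> 'b) \<Rightarrow> real) \<Rightarrow> bool"
  where "current_on V T \<longleftrightarrow>
    (\<forall>\<omega>\<in>V. \<forall>\<omega>'\<in>V. T (\<lambda>x. \<omega> x + \<omega>' x) = T \<omega> + T \<omega>') \<and>
    (\<forall>c. \<forall>\<omega>\<in>V. T (\<lambda>x. c *\<^sub>R \<omega> x) = c * T \<omega>) \<and>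
    (\<exists>C N. \<forall>\<omega>\<in>V. \<forall>B.
      (\<forall>vs x. set vs \<subseteq> Basis \<and> length vs \<le> N \<longrightarrow> norm (dirs vs \<omega> x) \<le> B) \<longrightarrow> \<bar>T \<omega>\<bar> \<le> C * B)"

type_synonym current2 = "(real^3 \<Rightarrow> real^3^3) \<Rightarrow> real"

definition closed_current2 :: "current2 \<Rightarrow> bool"
  where "closed_current2 T \<longleftrightarrow> current_on forms2 T \<and> (\<forall>\<alpha>\<in>forms1. T (ext_d1 \<alpha>) = 0)"

(* The class of T in the second homology of the complex of currents: closed 2-currents modulo
   boundaries of 3-currents, where the boundary of U is the functional U o d. *)
definition current_class :: "current2 \<Rightarrow> current2 set"
  where "current_class T = {S. closed_current2 S \<and>
    (\<exists>U. current_on forms3 U \<and> (\<forall>\<omega>\<in>forms2. S \<omega> - T \<omega> = U (ext_d2 \<omega>)))}"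

(* The homology class Poincare dual to the closed 1-form eta is that of the current
   omega |-> integral of eta wedge omega over the torus.  There is no sign ambiguity,
   as eta wedge omega = omega wedge eta for a 2-form omega. *)
definition dual_class :: "(real^3 \<Rightarrow> real^3) \<Rightarrow> current2 set"
  where "dual_class \<eta> = current_class (\<lambda>\<omega>. integral (cbox 0 1) (wedge12 \<eta> \<omega>))"

definition r_class :: "real \<Rightarrow> real \<Rightarrow> real \<Rightarrow> current2 set"
  where "r_class a b c = dual_class (\<lambda>_. vector [a, b, c])"

(* Unit simple 2-vectors are the wedges of orthonormal pairs (v, w). *)
definition comass :: "real^3^3 \<Rightarrow> real^3^3 \<Rightarrow> real"
  where "comass G W = Sup {v \<bullet> (W *v w) | v w.
    v \<bullet> (G *v v) = 1 \<and> w \<bullet> (G *v w) = 1 \<and> v \<bullet> (G *v w) = 0}"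

definition mass :: "(real^3 \<Rightarrow> real^3^3) \<Rightarrow> current2 \<Rightarrow> ereal"
  where "mass g T = (SUP \<omega>\<in>{\<omega>\<in>forms2. \<forall>x. comass (g x) (\<omega> x) \<le> 1}. ereal (T \<omega>))"

definition stable_norm :: "(real^3 \<Rightarrow> real^3^3) \<Rightarrow> current2 set \<Rightarrow> ereal"
  where "stable_norm g r = Inf {mass g T | T. closed_current2 T \<and> current_class T = r}"

definition D_mat :: "real \<Rightarrow> real^2^2"
  where "D_mat lam = vector [vector [lam^2, 0], vector [0, 1 / lam^2]]"

definition rot :: "real \<Rightarrow> real^2^2"
  where "rot \<theta> = vector [vector [cos \<theta>, - sin \<theta>], vector [sin \<theta>, cos \<theta>]]"

definition h_metric :: "real \<Rightarrow> real \<Rightarrow> real^2^2"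
  where "h_metric lam t = transpose (rot (2 * pi * t)) ** D_mat lam ** rot (2 * pi * t)"

definition kappa :: "real \<Rightarrow> real"
  where "kappa lam = integral {0..1}
    (\<lambda>t. sqrt ((cos (2 * pi * t))^2 / lam^2 + lam^2 * (sin (2 * pi * t))^2))"

definition q_fun :: "real \<Rightarrow> real \<Rightarrow> real \<Rightarrow> real"
  where "q_fun lam s t = inverse (kappa lam) * (1 + s * sin (2 * pi * t))"

definition g_metric :: "real \<Rightarrow> real \<Rightarrow> real^3 \<Rightarrow> real^3^3"
  where "g_metric lam s = (\<lambda>p. let h = h_metric lam (p $ 3) in
    vector [vector [h $ 1 $ 1, h $ 1 $ 2, 0],
            vector [h $ 2 $ 1, h $ 2 $ 2, 0],
            vector [0, 0, (q_fun lam s (p $ 3))^2]])"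

definition euclidean_metric :: "real^3 \<Rightarrow> real^3^3"
  where "euclidean_metric = (\<lambda>_. mat 1)"

end

theory Submission
  imports Defs
begin

text \<open>
On the torus the metric is \<open>g = q(t)\<^sup>2 dt\<^sup>2 + h(t)\<close>, where \<open>h(t)\<close> has determinant one and period 1/2, while
\<open>q\<close> is \<open>1 / kappa\<close> times \<open>1 + s sin (2 pi t)\<close>.

The stable norm. Let \<open>\<rho>\<close> be the Euclidean length of \<open>(\<alpha>, \<beta>)\<close> and \<open>n(t)\<close> the length of
\<open>\<alpha> dx + \<beta> dy\<close> for the dual of \<open>h(t)\<close>. Because \<open>h\<close> rotates, \<open>n\<close> is \<open>\<rho>\<close> times a translate of the
integrand of \<open>kappa\<close>, so the direction of \<open>(\<alpha>, \<beta>)\<close> does not affect its integral; and the factor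
\<open>sin (2 pi t)\<close> integrates to zero against \<open>n\<close> because it changes sign under a shift by 1/2. Hence \<open>q n\<close>
has integral \<open>\<rho>\<close> (\<open>integral_q_conorm\<close>). Put \<open>L = sqrt (\<rho>\<^sup>2 + \<gamma>\<^sup>2)\<close> and
let \<open>\<rho> > 0\<close>; for \<open>\<rho> = 0\<close> the form \<open>\<gamma> dt\<close> is calibrated by \<open>dx dy\<close> up to sign. The closed 1-form
\<open>\<alpha> dx + \<beta> dy + w dt\<close> with \<open>w = \<gamma> q n / \<rho>\<close> is cohomologous to \<open>\<alpha> dx + \<beta> dy + \<gamma> dt\<close>, and the integral of
its norm is \<open>L\<close>; as a current it lies in the required class and has mass at most \<open>L\<close>. Conversely its
normalised Hodge dual is a 2-form of comass one which is closed, since its coefficients depend on \<open>t\<close>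
only and its \<open>dx dy\<close> coefficient is the constant \<open>\<gamma> / L\<close>. All currents of the class take the same
value \<open>L\<close> on it, so none has smaller mass (\<open>stable_norm_calibrated\<close>).

Non-flatness. The tori of constant \<open>t\<close> are flat, but not totally geodesic; the Gauss equation turns
the determinant of \<open>dh/dt\<close>, which never vanishes, into a nonzero component of the curvature tensor
(\<open>not_flat_g\<close>).

Convergence. The substitution by normalised arc length along the \<open>t\<close>-circle does not depend on \<open>lam\<close>
and turns \<open>q dt\<close> into a constant multiple of the coordinate form. The resulting metric differs from
the Euclidean one by three fixed smooth tensors whose coefficients tend to zero
(\<open>arc_metric_converges\<close>).

Non-isometry. In the arc-length coordinate the three coordinate functions are harmonic. An isometry
pulls them back to harmonic functions (\<open>isometry_harmonic\<close>), which differ from linear functions by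
periodic ones; periodic harmonic functions are constant, so every isometry is affine
(\<open>isometry_affine\<close>). An affine isometry also carries the derivative of one metric to that of the
other. The invariant \<open>trace ((g\<^sup>-\<^sup>1 \<partial>g)\<^sup>2)\<close> of this derivative is a constant multiple of
\<open>(1 + s sin (2 pi t))\<^sup>-\<^sup>2\<close>; the ratio of its extreme values is unchanged by scaling and recovers \<open>s\<close>
(\<open>arc_metric_isometric_eq\<close>).
\<close>

section \<open>Smooth functions\<close>

text \<open>Smoothness asks for differentiability of all iterated partial derivatives. The recursion on the
order peels off the derivative that is taken first, so that the product and chain rules become
inductions on \<open>n\<close>: each expresses a derivative through functions that are known to be in the class of
order \<open>n\<close>.\<close>

primrec kdiff :: "nat \<Rightarrow> ('a::euclidean_space \<Rightarrow> 'b::real_normed_vector) \<Rightarrow> bool" where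
  "kdiff 0 f \<longleftrightarrow> (\<forall>x. f differentiable (at x))"
| "kdiff (Suc n) f \<longleftrightarrow> (\<forall>x. f differentiable (at x)) \<and> (\<forall>b\<in>Basis. kdiff n (ddir b f))"

lemma dirs_snoc: "dirs (vs @ [b]) f = dirs vs (ddir b f)"
  by (simp add: dirs_def)

lemma dirs_Cons: "dirs (b # vs) f = ddir b (dirs vs f)"
  by (simp add: dirs_def)

lemma dirs_Nil [simp]: "dirs [] f = f"
  by (simp add: dirs_def)

text \<open>The innermost directional derivative of \<open>dirs vs f\<close> belongs to the last entry of \<open>vs\<close>, hence the
decomposition of \<open>vs\<close> from its end.\<close>

lemma kdiff_iff:
  "kdiff n f \<longleftrightarrow> (\<forall>vs. set vs \<subseteq> Basis \<and> length vs \<le> n \<longrightarrow> (\<forall>x. dirs vs f differentiable (at x)))"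
proof (induction n arbitrary: f)
  case 0
  then show ?case by simp
next
  case (Suc n)
  show ?case
  proof
    assume L: "kdiff (Suc n) f"
    show "\<forall>vs. set vs \<subseteq> Basis \<and> length vs \<le> Suc n \<longrightarrow> (\<forall>x. dirs vs f differentiable (at x))"
    proof (intro allI impI)
      fix vs :: "'a list" and x
      assume vs: "set vs \<subseteq> Basis \<and> length vs \<le> Suc n"
      show "dirs vs f differentiable (at x)"
      proof (cases vs rule: rev_cases)
        case Nil
        then show ?thesis using L by simp
      next
        case (snoc ws b)
        have "kdiff n (ddir b f)" using L vs snoc by auto
        then have "dirs ws (ddir b f) differentiable (at x)"
          using Suc.IH vs snoc by auto
        then show ?thesis by (simp add: snoc dirs_snoc)
      qed
    qed
  next
    assume R: "\<forall>vs. set vs \<subseteq> Basis \<and> length vs \<le> Suc n \<longrightarrow> (\<forall>x. dirs vs f differentiable (at x))"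
    have "dirs ws (ddir b f) differentiable (at x)"
      if "b \<in> Basis" "set ws \<subseteq> Basis" "length ws \<le> n" for b ws x
      using R[rule_format, of "ws @ [b]" x] that by (simp add: dirs_snoc)
    moreover have "f differentiable (at x)" for x
      using R[rule_format, of "[]" x] by simp
    ultimately show "kdiff (Suc n) f" using Suc.IH by auto
  qed
qed

lemma smooth_iff_kdiff: "smooth f \<longleftrightarrow> (\<forall>n. kdiff n f)"
  unfolding smooth_def kdiff_iff by blast

lemma kdiff_differentiable: "kdiff n f \<Longrightarrow> f differentiable (at x)"
  by (cases n) auto

lemma kdiff_SucD: "kdiff (Suc n) f \<Longrightarrow> kdiff n f"
  unfolding kdiff_iff by auto

lemma smooth_differentiable: "smooth f \<Longrightarrow> f differentiable (at x)"
  by (meson kdiff_differentiable smooth_iff_kdiff)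

lemma smooth_ddir: "smooth f \<Longrightarrow> b \<in> Basis \<Longrightarrow> smooth (ddir b f)"
  unfolding smooth_iff_kdiff by (metis kdiff.simps(2))

lemma smooth_dirs: "smooth f \<Longrightarrow> set vs \<subseteq> Basis \<Longrightarrow> smooth (dirs vs f)"
  by (induction vs) (auto simp: dirs_Cons smooth_ddir)

lemma smooth_has_derivative:
  "smooth f \<Longrightarrow> (f has_derivative (\<lambda>v. ddir v f x)) (at x)"
  unfolding ddir_def
  using smooth_differentiable frechet_derivative_works by (metis (no_types, lifting) ext)

lemma smooth_continuous_on: "smooth f \<Longrightarrow> continuous_on S f"
  by (meson continuous_at_imp_continuous_on differentiable_imp_continuous_within smooth_differentiable)

lemma ddir_eqI:
  assumes "\<And>x. (f has_derivative f' x) (at x)"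
  shows "ddir v f = (\<lambda>x. f' x v)"
  unfolding ddir_def using frechet_derivative_at[OF assms] by metis

lemma ddir_vec_nth:
  assumes "smooth F"
  shows "ddir u (\<lambda>y. F y $ i) = (\<lambda>y. ddir u F y $ i)"
  by (rule ddir_eqI) (rule bounded_linear.has_derivative[OF bounded_linear_vec_nth smooth_has_derivative[OF assms]])

lemma differentiable_ddir: "f differentiable (at x) \<Longrightarrow> (f has_derivative (\<lambda>v. ddir v f x)) (at x)"
  unfolding ddir_def using frechet_derivative_works by (metis (no_types, lifting) ext)

lemma differentiableI: "(f has_derivative D) (at x) \<Longrightarrow> f differentiable (at x)"
  unfolding differentiable_def by blast

text \<open>The form in which the induction steps are carried out: one explicit formula for the derivative gives
both differentiability and all partial derivatives.\<close>

lemma kdiff_SucI: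
  assumes "\<And>x. (f has_derivative f' x) (at x)" "\<And>b. b \<in> Basis \<Longrightarrow> kdiff n (\<lambda>x. f' x b)"
  shows "kdiff (Suc n) f"
  using assms(2) differentiableI[OF assms(1)] ddir_eqI[of f f', OF assms(1)] by simp

lemma kdiff_const: "kdiff n (\<lambda>x. c)"
proof (induction n arbitrary: c)
  case (Suc n)
  have "ddir b (\<lambda>x::'a. c) = (\<lambda>x. 0)" for b
    by (rule ddir_eqI) (rule has_derivative_const)
  then show ?case using Suc by auto
qed auto

lemma kdiff_add:
  "kdiff n f \<Longrightarrow> kdiff n g \<Longrightarrow> kdiff n (\<lambda>x. f x + g x)"
proof (induction n arbitrary: f g)
  case (Suc n)
  have "ddir b (\<lambda>x. f x + g x) = (\<lambda>x. ddir b f x + ddir b g x)" for b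
    by (rule ddir_eqI) (use Suc.prems in \<open>auto intro!: has_derivative_add differentiable_ddir\<close>)
  then show ?case using Suc by auto
qed auto

lemma kdiff_linear:
  assumes "bounded_linear L"
  shows "kdiff n f \<Longrightarrow> kdiff n (\<lambda>x. L (f x))"
proof (induction n arbitrary: f)
  case 0
  then show ?case using bounded_linear_imp_differentiable[OF assms]
    by (auto intro: differentiable_compose)
next
  case (Suc n)
  have d: "((\<lambda>x. L (f x)) has_derivative (\<lambda>v. L (ddir v f x))) (at x)" for x
    by (rule bounded_linear.has_derivative[OF assms]) (use Suc.prems in \<open>auto intro!: differentiable_ddir\<close>)
  show ?case by (rule kdiff_SucI[OF d]) (use Suc in auto)
qed

lemma kdiff_bilinear:
  assumes "bounded_bilinear p"
  shows "kdiff n f \<Longrightarrow> kdiff n g \<Longrightarrow> kdiff n (\<lambda>x. p (f x) (g x))"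
proof (induction n arbitrary: f g)
  case 0
  then show ?case
    using differentiableI[OF bounded_bilinear.FDERIV[OF assms differentiable_ddir differentiable_ddir], of f _ g] by simp
next
  case (Suc n)
  have d: "((\<lambda>x. p (f x) (g x)) has_derivative (\<lambda>v. p (f x) (ddir v g x) + p (ddir v f x) (g x))) (at x)" for x
    by (rule bounded_bilinear.FDERIV[OF assms]) (use Suc.prems in \<open>auto intro!: differentiable_ddir\<close>)
  have "kdiff n f" "kdiff n g" using Suc.prems kdiff_SucD by blast+
  then show ?case by (intro kdiff_SucI[OF d] kdiff_add Suc.IH) (use Suc.prems in auto)
qed

lemma kdiff_sum: "(\<And>i. i \<in> S \<Longrightarrow> kdiff n (f i)) \<Longrightarrow> kdiff n (\<lambda>x. \<Sum>i\<in>S. f i x)"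
  by (induction S rule: infinite_finite_induct) (auto intro: kdiff_const kdiff_add)

text \<open>The chain rule with the outer derivative expanded in basis directions, because only derivatives in
basis directions occur in the definition of smoothness.\<close>

lemma has_derivative_chain_basis:
  fixes F :: "'a::real_normed_vector \<Rightarrow> 'b::euclidean_space"
  assumes F: "F differentiable (at x)" and f: "f differentiable (at (F x))"
  shows "((\<lambda>x. f (F x)) has_derivative (\<lambda>v. \<Sum>c\<in>Basis. (ddir v F x \<bullet> c) *\<^sub>R ddir c f (F x))) (at x)"
proof -
  define L where "L = (\<lambda>v. ddir v f (F x))"
  have lin: "linear L"
    using differentiable_ddir[OF f] has_derivative_linear unfolding L_def by blast
  have "L w = (\<Sum>c\<in>Basis. (w \<bullet> c) *\<^sub>R L c)" for w
    using linear_sum[OF lin, of "\<lambda>c. (w \<bullet> c) *\<^sub>R c" Basis]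
    by (simp only: euclidean_representation linear_scale[OF lin])
  then have *: "ddir w f (F x) = (\<Sum>c\<in>Basis. (w \<bullet> c) *\<^sub>R ddir c f (F x))" for w
    unfolding L_def .
  show ?thesis
    by (rule has_derivative_eq_rhs[OF has_derivative_compose[OF differentiable_ddir[OF F] differentiable_ddir[OF f]]])
       (rule ext, rule *)
qed

lemma kdiff_compose:
  fixes F :: "'a::euclidean_space \<Rightarrow> 'b::euclidean_space"
  shows "kdiff n F \<Longrightarrow> kdiff n f \<Longrightarrow> kdiff n (\<lambda>x. f (F x))"
proof (induction n arbitrary: f)
  case 0
  show ?case
    using 0 differentiableI[OF has_derivative_chain_basis, of F _ f] by simp
next
  case (Suc n)
  have d: "((\<lambda>x. f (F x)) has_derivative (\<lambda>v. \<Sum>c\<in>Basis. (ddir v F x \<bullet> c) *\<^sub>R ddir c f (F x))) (at x)" for x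
    by (rule has_derivative_chain_basis) (use Suc.prems in auto)
  have "kdiff n (\<lambda>x. \<Sum>c\<in>Basis. (ddir b F x \<bullet> c) *\<^sub>R ddir c f (F x))" if "b \<in> Basis" for b
  proof (intro kdiff_sum kdiff_bilinear[OF bounded_bilinear_scaleR])
    fix c :: 'b assume c: "c \<in> Basis"
    show "kdiff n (\<lambda>x. ddir b F x \<bullet> c)"
      using Suc.prems that by (intro kdiff_linear[OF bounded_linear_inner_left]) auto
    show "kdiff n (\<lambda>x. ddir c f (F x))"
      using Suc.prems c kdiff_SucD[OF Suc.prems(1)] by (intro Suc.IH) auto
  qed
  then show ?case by (rule kdiff_SucI[OF d])
qed

lemma kdiff_id: "kdiff n (\<lambda>x. x)"
proof (cases n)
  case (Suc m)
  have "ddir b (\<lambda>x::'a. x) = (\<lambda>x. b)" for b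
    by (rule ddir_eqI) (rule has_derivative_ident)
  then show ?thesis using Suc kdiff_const by auto
qed auto

text \<open>The derivative of the reciprocal is a product involving the reciprocal itself, so the induction
hypothesis applies to it.\<close>

lemma kdiff_inverse:
  fixes f :: "'a::euclidean_space \<Rightarrow> real"
  assumes nz: "\<And>x. f x \<noteq> 0"
  shows "kdiff n f \<Longrightarrow> kdiff n (\<lambda>x. inverse (f x))"
proof (induction n)
  case 0
  then show ?case using nz by (auto intro!: differentiable_inverse)
next
  case (Suc n)
  have d: "((\<lambda>x. inverse (f x)) has_derivative (\<lambda>v. - (inverse (f x) * ddir v f x * inverse (f x)))) (at x)" for x
    by (rule Deriv.has_derivative_inverse[where f = f, OF nz]) (use Suc.prems in \<open>auto intro!: differentiable_ddir\<close>)
  have "kdiff n (\<lambda>x. - (inverse (f x) * ddir b f x * inverse (f x)))" if "b \<in> Basis" for b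
    using Suc.prems that Suc.IH[OF kdiff_SucD[OF Suc.prems]]
    by (intro kdiff_linear[OF bounded_linear_minus[OF bounded_linear_ident]] kdiff_bilinear[OF bounded_bilinear_mult]) simp_all
  then show ?case by (rule kdiff_SucI[OF d])
qed

text \<open>As for the reciprocal: the derivative of \<open>sqrt f\<close> is built from \<open>f\<close>, the reciprocal and \<open>sqrt f\<close>.\<close>

lemma kdiff_sqrt:
  fixes f :: "'a::euclidean_space \<Rightarrow> real"
  assumes pos: "\<And>x. f x > 0"
  shows "kdiff n f \<Longrightarrow> kdiff n (\<lambda>x. sqrt (f x))"
proof (induction n)
  case 0
  then show ?case
    using differentiableI[OF has_derivative_real_sqrt[where g = f, OF pos differentiable_ddir]] by simp
next
  case (Suc n)
  have d: "((\<lambda>x. sqrt (f x)) has_derivative (\<lambda>v. (1/2) * (inverse (sqrt (f x)) * ddir v f x))) (at x)" for x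
    by (rule has_derivative_eq_rhs[OF has_derivative_real_sqrt[where g = f, OF pos differentiable_ddir]])
       (use Suc.prems in \<open>auto simp: field_simps\<close>)
  have "kdiff n (\<lambda>x. (1/2) * (inverse (sqrt (f x)) * ddir b f x))" if "b \<in> Basis" for b
  proof (intro kdiff_linear[OF bounded_linear_mult_right] kdiff_bilinear[OF bounded_bilinear_mult] kdiff_inverse)
    show "sqrt (f x) \<noteq> 0" for x using pos[of x] by simp
    show "kdiff n (\<lambda>x. sqrt (f x))" by (rule Suc.IH[OF kdiff_SucD[OF Suc.prems]])
    show "kdiff n (ddir b f)" using Suc.prems that by simp
  qed
  then show ?case by (rule kdiff_SucI[OF d])
qed

lemma kdiff_sin_cos: "kdiff n (sin :: real \<Rightarrow> real) \<and> kdiff n (cos :: real \<Rightarrow> real)"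
proof (induction n)
  case 0
  then show ?case
    using differentiableI[OF has_derivative_sin[OF has_derivative_ident]]
      differentiableI[OF has_derivative_cos[OF has_derivative_ident]] by simp
next
  case (Suc n)
  have s: "(sin has_derivative (\<lambda>v. v * cos x)) (at x)" for x :: real
    by (rule has_derivative_eq_rhs[OF has_derivative_sin[OF has_derivative_ident]]) auto
  have c: "(cos has_derivative (\<lambda>v. v * - sin x)) (at x)" for x :: real
    by (rule has_derivative_eq_rhs[OF has_derivative_cos[OF has_derivative_ident]]) auto
  have "kdiff n (\<lambda>x::real. - sin x)"
    by (rule kdiff_linear[OF bounded_linear_minus[OF bounded_linear_ident]]) (use Suc in blast)
  then have "kdiff (Suc n) (cos :: real \<Rightarrow> real)"
    by (intro kdiff_SucI[OF c]) simp
  moreover have "kdiff (Suc n) (sin :: real \<Rightarrow> real)"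
    by (intro kdiff_SucI[OF s]) (use Suc in simp)
  ultimately show ?case by blast
qed

lemma smooth_const: "smooth (\<lambda>x. c)"
  by (simp add: smooth_iff_kdiff kdiff_const)
lemma smooth_id: "smooth (\<lambda>x. x)"
  by (simp add: smooth_iff_kdiff kdiff_id)
lemma smooth_linear: "bounded_linear L \<Longrightarrow> smooth f \<Longrightarrow> smooth (\<lambda>x. L (f x))"
  by (simp add: smooth_iff_kdiff kdiff_linear)
lemma smooth_bilinear: "bounded_bilinear p \<Longrightarrow> smooth f \<Longrightarrow> smooth g \<Longrightarrow> smooth (\<lambda>x. p (f x) (g x))"
  by (simp add: smooth_iff_kdiff kdiff_bilinear)
lemma smooth_add: "smooth f \<Longrightarrow> smooth g \<Longrightarrow> smooth (\<lambda>x. f x + g x)"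
  by (simp add: smooth_iff_kdiff kdiff_add)
lemma smooth_minus: "smooth f \<Longrightarrow> smooth (\<lambda>x. - f x)"
  by (rule smooth_linear[OF bounded_linear_minus[OF bounded_linear_ident]])
lemma smooth_diff: "smooth f \<Longrightarrow> smooth g \<Longrightarrow> smooth (\<lambda>x. f x - g x)"
  using smooth_add[OF _ smooth_minus, of f g] by simp
lemma smooth_sum: "(\<And>i. i \<in> S \<Longrightarrow> smooth (f i)) \<Longrightarrow> smooth (\<lambda>x. \<Sum>i\<in>S. f i x)"
  by (simp add: smooth_iff_kdiff kdiff_sum)
lemma smooth_mult: "smooth f \<Longrightarrow> smooth g \<Longrightarrow> smooth (\<lambda>x. f x * g x :: real)"
  by (rule smooth_bilinear[OF bounded_bilinear_mult])
lemma smooth_scaleR: "smooth f \<Longrightarrow> smooth g \<Longrightarrow> smooth (\<lambda>x. f x *\<^sub>R g x)"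
  by (rule smooth_bilinear[OF bounded_bilinear_scaleR])
lemma smooth_power: "smooth f \<Longrightarrow> smooth (\<lambda>x. f x ^ n :: real)"
  by (induction n) (auto intro: smooth_const smooth_mult)
lemma smooth_compose:
  fixes F :: "'a::euclidean_space \<Rightarrow> 'b::euclidean_space"
  shows "smooth f \<Longrightarrow> smooth F \<Longrightarrow> smooth (\<lambda>x. f (F x))"
  by (simp add: smooth_iff_kdiff kdiff_compose)
lemma smooth_inverse: "smooth f \<Longrightarrow> (\<And>x. f x \<noteq> 0) \<Longrightarrow> smooth (\<lambda>x. inverse (f x :: real))"
  by (simp add: smooth_iff_kdiff kdiff_inverse)
lemma smooth_divide: "smooth f \<Longrightarrow> smooth g \<Longrightarrow> (\<And>x. g x \<noteq> 0) \<Longrightarrow> smooth (\<lambda>x. f x / g x :: real)"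
  using smooth_mult[OF _ smooth_inverse, of f g] by (simp add: divide_inverse)
lemma smooth_sqrt: "smooth f \<Longrightarrow> (\<And>x. f x > 0) \<Longrightarrow> smooth (\<lambda>x. sqrt (f x :: real))"
  by (simp add: smooth_iff_kdiff kdiff_sqrt)
lemma smooth_sin: "smooth f \<Longrightarrow> smooth (\<lambda>x. sin (f x :: real))"
  by (rule smooth_compose[where f = sin]) (simp_all add: smooth_iff_kdiff kdiff_sin_cos)
lemma smooth_cos: "smooth f \<Longrightarrow> smooth (\<lambda>x. cos (f x :: real))"
  by (rule smooth_compose[where f = cos]) (simp_all add: smooth_iff_kdiff kdiff_sin_cos)
lemma smooth_vec_nth: "smooth f \<Longrightarrow> smooth (\<lambda>x. f x $ i)"
  by (rule smooth_linear[OF bounded_linear_vec_nth])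
lemma smooth_fst: "smooth f \<Longrightarrow> smooth (\<lambda>x. fst (f x))"
  by (rule smooth_linear[OF bounded_linear_fst])
lemma smooth_snd: "smooth f \<Longrightarrow> smooth (\<lambda>x. snd (f x))"
  by (rule smooth_linear[OF bounded_linear_snd])

lemma bounded_linear_axis: "bounded_linear (axis i :: 'b::real_normed_vector \<Rightarrow> 'b^'n)"
proof (rule bounded_linear_intro[where K = 1])
  fix x y :: 'b and r
  show "axis i (x + y) = axis i x + (axis i y :: 'b^'n)"
    by (simp add: axis_def vec_eq_iff)
  show "axis i (r *\<^sub>R x) = r *\<^sub>R (axis i x :: 'b^'n)"
    by (simp add: axis_def vec_eq_iff)
  have "(\<Sum>j\<in>UNIV. (norm ((axis i x :: 'b^'n) $ j))\<^sup>2) = (\<Sum>j\<in>UNIV. if j = i then (norm x)\<^sup>2 else 0)"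
    by (intro sum.cong) (auto simp: axis_def)
  then show "norm (axis i x :: 'b^'n) \<le> norm x * 1"
    by (simp add: norm_vec_def L2_set_def)
qed

lemma vec_axis_sum: "x = (\<Sum>i\<in>UNIV. axis i (x $ i))"
  by (simp add: vec_eq_iff axis_def if_distrib cong: if_cong)

lemma smooth_vecI:
  assumes "\<And>i. smooth (\<lambda>x. f x $ i)"
  shows "smooth (f :: 'a::euclidean_space \<Rightarrow> 'b::real_normed_vector^'n)"
proof -
  have "smooth (\<lambda>x. \<Sum>i\<in>UNIV. axis i (f x $ i) :: 'b^'n)"
    by (intro smooth_sum smooth_linear[OF bounded_linear_axis] assms)
  then show ?thesis by (simp flip: vec_axis_sum)
qed

lemmas smooth_intros = smooth_const smooth_id smooth_add smooth_minus smooth_diff smooth_sum smooth_mult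
  smooth_scaleR smooth_power smooth_inverse smooth_divide smooth_sqrt smooth_sin smooth_cos smooth_vec_nth
  smooth_fst smooth_snd

section \<open>Derivatives and integrals of periodic functions\<close>

lemma line_has_vector_derivative:
  assumes "smooth f"
  shows "((\<lambda>r. f (y + r *\<^sub>R u)) has_vector_derivative ddir u f (y + r *\<^sub>R u)) (at r within S)"
proof -
  have 1: "((\<lambda>r. y + r *\<^sub>R u) has_derivative (\<lambda>h. h *\<^sub>R u)) (at r)"
    by (auto intro!: derivative_eq_intros)
  have "bounded_linear (\<lambda>v. ddir v f (y + r *\<^sub>R u))"
    using smooth_has_derivative[OF assms] has_derivative_bounded_linear by blast
  then have "ddir (h *\<^sub>R u) f (y + r *\<^sub>R u) = h *\<^sub>R ddir u f (y + r *\<^sub>R u)" for h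
    by (rule linear_scale[OF bounded_linear.linear])
  then show ?thesis
    using has_derivative_compose[OF 1 smooth_has_derivative[OF assms]]
    unfolding has_vector_derivative_def by (simp add: has_derivative_at_withinI)
qed

lemma ddir_scaleR: "smooth f \<Longrightarrow> ddir (c *\<^sub>R v) f x = c *\<^sub>R ddir v f x"
  using linear_scale[OF has_derivative_linear[OF smooth_has_derivative]] by blast

lemma ddir_basis_sum:
  fixes F :: "'a::euclidean_space \<Rightarrow> 'b::real_normed_vector"
  assumes "smooth F"
  shows "ddir v F x = (\<Sum>b\<in>Basis. (v \<bullet> b) *\<^sub>R ddir b F x)"
proof -
  define L where "L = (\<lambda>v. ddir v F x)"
  have lin: "linear L"
    using smooth_has_derivative[OF assms] has_derivative_linear unfolding L_def by blast
  have "L v = (\<Sum>c\<in>Basis. (v \<bullet> c) *\<^sub>R L c)"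
    using linear_sum[OF lin, of "\<lambda>c. (v \<bullet> c) *\<^sub>R c" Basis]
    by (simp only: euclidean_representation linear_scale[OF lin])
  then show ?thesis unfolding L_def .
qed

lemma smooth_ddir_any:
  fixes f :: "'a::euclidean_space \<Rightarrow> 'b::real_normed_vector"
  assumes "smooth f"
  shows "smooth (ddir u f)"
proof -
  have "ddir u f = (\<lambda>x. \<Sum>b\<in>Basis. (u \<bullet> b) *\<^sub>R ddir b f x)"
    by (rule ext) (rule ddir_basis_sum[OF assms])
  moreover have "smooth (\<lambda>x. \<Sum>b\<in>Basis. (u \<bullet> b) *\<^sub>R ddir b f x)"
    by (intro smooth_sum smooth_scaleR smooth_const smooth_ddir assms)
  ultimately show ?thesis by simp
qed

text \<open>Two applications of the mean value theorem. The left-hand side is symmetric in \<open>u\<close> and \<open>v\<close>, while the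
right-hand side has an iterated derivative in a definite order; this is the source of the symmetry
of second derivatives.\<close>

lemma second_difference:
  fixes f :: "'a::euclidean_space \<Rightarrow> real"
  assumes f: "smooth f" and h: "h > 0"
  shows "\<exists>a b. 0 < a \<and> a < h \<and> 0 < b \<and> b < h \<and>
    f (x + h *\<^sub>R u + h *\<^sub>R v) - f (x + h *\<^sub>R u) - f (x + h *\<^sub>R v) + f x
      = h * (h * ddir v (ddir u f) (x + a *\<^sub>R u + b *\<^sub>R v))"
proof -
  define g where "g = (\<lambda>r. f ((x + h *\<^sub>R v) + r *\<^sub>R u) - f (x + r *\<^sub>R u))"
  have dg: "(g has_real_derivative ddir u f ((x + h *\<^sub>R v) + r *\<^sub>R u) - ddir u f (x + r *\<^sub>R u)) (at r)" for r
    unfolding g_def has_real_derivative_iff_has_vector_derivative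
    by (intro has_vector_derivative_diff line_has_vector_derivative f)
  obtain a where a: "0 < a" "a < h"
    "g h - g 0 = (h - 0) * (ddir u f ((x + h *\<^sub>R v) + a *\<^sub>R u) - ddir u f (x + a *\<^sub>R u))"
    using MVT2[OF h dg] by blast
  define k where "k = (\<lambda>r. ddir u f ((x + a *\<^sub>R u) + r *\<^sub>R v))"
  have dk: "(k has_real_derivative ddir v (ddir u f) ((x + a *\<^sub>R u) + r *\<^sub>R v)) (at r)" for r
    unfolding k_def has_real_derivative_iff_has_vector_derivative
    by (intro line_has_vector_derivative smooth_ddir_any f)
  obtain b where b: "0 < b" "b < h"
    "k h - k 0 = (h - 0) * ddir v (ddir u f) ((x + a *\<^sub>R u) + b *\<^sub>R v)"
    using MVT2[OF h dk] by blast
  have "f (x + h *\<^sub>R u + h *\<^sub>R v) - f (x + h *\<^sub>R u) - f (x + h *\<^sub>R v) + f x = g h - g 0"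
    by (simp add: g_def add_ac)
  also have "\<dots> = h * (k h - k 0)"
    using a(3) by (simp add: k_def add_ac)
  finally show ?thesis using a b by auto
qed

lemma ddir_commute:
  fixes f :: "'a::euclidean_space \<Rightarrow> real"
  assumes f: "smooth f"
  shows "ddir u (ddir v f) x = ddir v (ddir u f) x"
proof (rule ccontr)
  let ?A = "ddir v (ddir u f)" and ?B = "ddir u (ddir v f)"
  assume ne: "?B x \<noteq> ?A x"
  define e where "e = \<bar>?A x - ?B x\<bar> / 2"
  have e: "e > 0" using ne by (simp add: e_def)
  have cA: "continuous (at x) ?A" and cB: "continuous (at x) ?B"
    using smooth_continuous_on[OF smooth_ddir_any[OF smooth_ddir_any[OF f]], of UNIV]
      smooth_continuous_on[OF smooth_ddir_any[OF smooth_ddir_any[OF f]], of UNIV]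
    by (auto simp: continuous_on_eq_continuous_at)
  obtain d1 where d1: "d1 > 0" "\<And>y. dist y x < d1 \<Longrightarrow> dist (?A y) (?A x) < e"
    using cA e unfolding continuous_at_eps_delta by blast
  obtain d2 where d2: "d2 > 0" "\<And>y. dist y x < d2 \<Longrightarrow> dist (?B y) (?B x) < e"
    using cB e unfolding continuous_at_eps_delta by blast
  \<comment> \<open>The points produced by the mean value theorem lie within \<open>h (norm u + norm v)\<close> of \<open>x\<close>.\<close>
  define c0 where "c0 = norm u + norm v + 1"
  have c0: "c0 > 0" by (simp add: c0_def add_nonneg_pos)
  define h where "h = min d1 d2 / c0"
  have h: "h > 0" using d1 d2 c0 by (simp add: h_def)
  obtain a b where ab: "0 < a" "a < h" "0 < b" "b < h"
    "f (x + h *\<^sub>R u + h *\<^sub>R v) - f (x + h *\<^sub>R u) - f (x + h *\<^sub>R v) + f x = h * (h * ?A (x + a *\<^sub>R u + b *\<^sub>R v))"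
    using second_difference[OF f h, of x u v] by blast
  obtain c d where cd: "0 < c" "c < h" "0 < d" "d < h"
    "f (x + h *\<^sub>R v + h *\<^sub>R u) - f (x + h *\<^sub>R v) - f (x + h *\<^sub>R u) + f x = h * (h * ?B (x + c *\<^sub>R v + d *\<^sub>R u))"
    using second_difference[OF f h, of x v u] by blast
  have "x + h *\<^sub>R v + h *\<^sub>R u = x + h *\<^sub>R u + h *\<^sub>R v" by simp
  then have "h * (h * ?A (x + a *\<^sub>R u + b *\<^sub>R v)) = h * (h * ?B (x + c *\<^sub>R v + d *\<^sub>R u))"
    using ab(5) cd(5) by (simp only:)
  then have eq: "?A (x + a *\<^sub>R u + b *\<^sub>R v) = ?B (x + c *\<^sub>R v + d *\<^sub>R u)"
    using h by simp
  have n: "dist (x + p *\<^sub>R w + q *\<^sub>R z) x < min d1 d2"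
    if "0 < p" "p < h" "0 < q" "q < h" "norm w + norm z = norm u + norm v" for p q and w z :: 'a
  proof -
    have "norm (p *\<^sub>R w + q *\<^sub>R z) \<le> p * norm w + q * norm z"
      using norm_triangle_ineq[of "p *\<^sub>R w" "q *\<^sub>R z"] that by simp
    also have "\<dots> \<le> h * norm w + h * norm z"
      using that by (intro add_mono mult_right_mono) auto
    also have "\<dots> = h * (c0 - 1)" using that(5) by (simp add: c0_def flip: distrib_left)
    also have "\<dots> < h * c0" using h by simp
    also have "\<dots> = min d1 d2" using c0 by (simp add: h_def)
    finally show ?thesis by (simp add: dist_norm add.assoc)
  qed
  have "dist (?A (x + a *\<^sub>R u + b *\<^sub>R v)) (?A x) < e"
    by (rule d1(2)) (use n[of a b u v] ab in auto)
  moreover have "dist (?B (x + c *\<^sub>R v + d *\<^sub>R u)) (?B x) < e"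
    by (rule d2(2)) (use n[of c d v u] cd in auto)
  moreover have "\<bar>?A x - ?B x\<bar> = 2 * e" by (simp add: e_def)
  ultimately show False using eq unfolding dist_real_def
    by (auto simp: abs_if split: if_splits)
qed

text \<open>The translated cube is cut along a hyperplane, and the part sticking out is moved back by one
period.\<close>

lemma integral_cube_shift:
  fixes f :: "'a::euclidean_space \<Rightarrow> real"
  assumes cont: "continuous_on UNIV f" and b: "b \<in> Basis" and per: "\<And>x. f (x + b) = f x"
    and r: "0 \<le> r" "r \<le> 1"
  shows "integral (cbox 0 One) (\<lambda>x. f (x + r *\<^sub>R b)) = integral (cbox 0 One) f"
proof -
  let ?c = "r *\<^sub>R b"
  have int: "f integrable_on cbox p q" for p q
    by (rule integrable_continuous) (rule continuous_on_subset[OF cont], simp)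
  have inn: "i \<bullet> b = (if i = b then 1 else 0)" "b \<bullet> i = (if i = b then 1 else 0)" if "i \<in> Basis" for i
    using that b by (auto simp: inner_Basis)
  have split_b: "(\<forall>i\<in>Basis. P i) \<longleftrightarrow> P b \<and> (\<forall>i\<in>Basis - {b}. P i)" for P
    using b by blast
  have "integral (cbox 0 One) (\<lambda>x. f (x + ?c)) = integral (cbox ?c (One + ?c)) f"
    using integral_shift_cbox_plus[of 0 One f ?c] by (simp add: o_def add.commute)
  also have "\<dots> = integral (cbox ?c (One + ?c) \<inter> {x. x \<bullet> b \<le> 1}) f + integral (cbox ?c (One + ?c) \<inter> {x. x \<bullet> b \<ge> 1}) f"
    by (rule integral_split[OF int b])
  also have "cbox ?c (One + ?c) \<inter> {x. x \<bullet> b \<le> 1} = cbox 0 One \<inter> {x. x \<bullet> b \<ge> r}"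
    using r b by (auto simp: mem_box split_b inner_add_left inn split: if_splits)
  also have "cbox ?c (One + ?c) \<inter> {x. x \<bullet> b \<ge> 1} = cbox (0 + b) (One + ?c - b + b)"
    using r b by (auto simp: mem_box split_b inner_add_left inn split: if_splits)
  also have "integral (cbox (0 + b) (One + ?c - b + b)) f = integral (cbox 0 (One + ?c - b)) f"
    using integral_shift_cbox_plus[of 0 "One + ?c - b" f b] per by (simp add: o_def add.commute)
  also have "cbox 0 (One + ?c - b) = cbox 0 One \<inter> {x. x \<bullet> b \<le> r}"
    using r b by (auto simp: mem_box split_b inner_add_left inner_diff_left inn split: if_splits)
  also have "integral (cbox 0 One \<inter> {x. x \<bullet> b \<ge> r}) f + integral (cbox 0 One \<inter> {x. x \<bullet> b \<le> r}) f = integral (cbox 0 One) f"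
    using integral_split[OF int b, of 0 One r] by simp
  finally show ?thesis .
qed

text \<open>The integral of \<open>f\<close> over the cube translated by \<open>r\<close> in direction \<open>b\<close> does not depend on \<open>r\<close>; its derivative at
\<open>r = 0\<close> is the integral of the directional derivative.\<close>

lemma integral_ddir_periodic:
  fixes f :: "'a::euclidean_space \<Rightarrow> real"
  assumes f: "smooth f" and b: "b \<in> Basis" and per: "\<And>x. f (x + b) = f x"
  shows "integral (cbox 0 One) (ddir b f) = 0"
proof -
  let ?F = "\<lambda>r. integral (cbox 0 One) (\<lambda>x. f (x + r *\<^sub>R b))"
  have cf: "continuous_on UNIV f" and cd: "continuous_on UNIV (ddir b f)"
    using f b by (auto intro: smooth_continuous_on smooth_ddir)
  have "(?F has_vector_derivative integral (cbox 0 One) (\<lambda>x. ddir b f (x + 0 *\<^sub>R b))) (at 0 within cbox 0 1)"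
  proof (rule leibniz_rule_vector_derivative)
    show "((\<lambda>r. f (x + r *\<^sub>R b)) has_vector_derivative ddir b f (x + r *\<^sub>R b)) (at r within cbox 0 1)" for r x
      by (rule line_has_vector_derivative[OF f])
    show "(\<lambda>x. f (x + r *\<^sub>R b)) integrable_on cbox 0 One" for r
      by (intro integrable_continuous continuous_on_compose2[OF cf] continuous_intros) auto
    show "continuous_on (cbox 0 1 \<times> cbox 0 One) (\<lambda>(r, x). ddir b f (x + r *\<^sub>R b))"
      unfolding split_beta by (intro continuous_on_compose2[OF cd] continuous_intros) auto
  qed auto
  moreover have "(?F has_vector_derivative 0) (at 0 within cbox 0 1)"
  proof (rule has_vector_derivative_transform)
    show "((\<lambda>r. integral (cbox 0 One) f) has_vector_derivative 0) (at 0 within cbox 0 1)"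
      by (rule has_vector_derivative_const)
    show "?F r = integral (cbox 0 One) f" if "r \<in> cbox 0 1" for r
      using integral_cube_shift[OF cf b per, of r] that by simp
  qed simp
  ultimately have "integral (cbox 0 One) (\<lambda>x. ddir b f (x + 0 *\<^sub>R b)) = 0"
    by (rule vector_derivative_unique_within_closed_interval[of 0 1 0, rotated 2]) auto
  then show ?thesis by simp
qed

lemma axis_Basis: "axis i (1::real) \<in> Basis"
  by (auto simp: Basis_vec_def)

lemma One_vec: "(One :: real^'n) = 1"
proof -
  have "(One :: real^'n) \<bullet> axis i 1 = 1" for i
    using inner_sum_left_Basis[OF axis_Basis[of i], of "\<lambda>_. 1"] by simp
  then show ?thesis unfolding vec_eq_iff cart_eq_inner_axis[of One] by simp
qed

lemma axis_lattice3: "axis i 1 \<in> lattice3"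
  by (auto simp: lattice3_def axis_def)

lemma integral_pd_periodic:
  fixes f :: "real^3 \<Rightarrow> real"
  assumes "smooth f" "periodic f"
  shows "integral (cbox 0 1) (pd i f) = 0"
proof -
  have "f (x + axis i 1) = f x" for x
    using assms(2) axis_lattice3 unfolding periodic_def by blast
  then show ?thesis
    using integral_ddir_periodic[OF assms(1), of "axis i 1"] by (simp add: One_vec axis_Basis)
qed

lemma smooth_antiderivative:
  fixes f :: "real \<Rightarrow> real"
  assumes "smooth f"
  obtains W where "smooth W" "\<And>t. (W has_real_derivative f t) (at t)"
proof -
  have "\<exists>F. \<forall>x::real. -\<infinity> < ereal x \<longrightarrow> ereal x < \<infinity> \<longrightarrow> (F has_vector_derivative f x) (at x)"
    by (rule einterval_antiderivative)
       (use smooth_continuous_on[OF assms, of UNIV] in \<open>auto simp: continuous_on_eq_continuous_at\<close>)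
  then obtain W where W: "\<And>t. (W has_real_derivative f t) (at t)"
    by (auto simp: has_real_derivative_iff_has_vector_derivative)
  have d: "(W has_derivative (\<lambda>v. f t * v)) (at t)" for t
    using W unfolding has_field_derivative_def .
  have "kdiff n W" for n
  proof (cases n)
    case 0
    then show ?thesis using differentiableI[OF d] by simp
  next
    case (Suc m)
    show ?thesis unfolding Suc
      by (rule kdiff_SucI[OF d]) (use assms in \<open>simp add: smooth_iff_kdiff\<close>)
  qed
  then have "smooth W" by (simp add: smooth_iff_kdiff)
  then show ?thesis using W that by blast
qed

text \<open>Subtracting the mean makes the increment of the antiderivative over a period vanish.\<close>

lemma smooth_periodic_antiderivative:
  fixes f :: "real \<Rightarrow> real"
  assumes f: "smooth f" and per: "\<And>t. f (t + 1) = f t"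
  obtains W where "smooth W" "\<And>t. W (t + 1) = W t"
    "\<And>t. (W has_real_derivative f t - integral {0..1} f) (at t)"
proof -
  let ?I = "integral {0..1} f"
  obtain W where W: "smooth W" "\<And>t. (W has_real_derivative f t - ?I) (at t)"
    using smooth_antiderivative[OF smooth_diff[OF f smooth_const]] by blast
  have "((\<lambda>t. W (t + 1) - W t) has_real_derivative 0) (at t)" for t
    by (rule derivative_eq_intros DERIV_shift[THEN iffD1] W)+ (simp add: per)
  then obtain c where c: "\<And>t. W (t + 1) - W t = c"
    using DERIV_isconst_all[of "\<lambda>t. W (t + 1) - W t"] by metis
  have "((\<lambda>t. f t - ?I) has_integral W 1 - W 0) {0..1}"
    using W(2) by (intro fundamental_theorem_of_calculus)
      (auto simp: has_real_derivative_iff_has_vector_derivative intro: has_vector_derivative_at_within)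
  moreover have "((\<lambda>t. f t - ?I) has_integral ?I - ?I) {0..1}"
    using smooth_continuous_on[OF f, of "{0..1}"]
    by (intro has_integral_diff integrable_integral integrable_continuous_interval)
       (use has_integral_const_real[of ?I 0 1] in auto)
  ultimately have "W 1 - W 0 = ?I - ?I" by (rule has_integral_unique)
  then have "W (t + 1) = W t" for t using c[of t] c[of 0] by simp
  then show ?thesis using that W by blast
qed

lemma smooth_nth3: "smooth (\<lambda>p::real^3. p $ i)"
  by (intro smooth_intros)

lemma smooth_of_t: "smooth (f :: real \<Rightarrow> 'b::real_normed_vector) \<Longrightarrow> smooth (\<lambda>p::real^3. f (p $ 3))"
  by (rule smooth_compose[OF _ smooth_nth3])

lemma pd_of_t:
  assumes "\<And>t. (f has_real_derivative f' t) (at t)"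
  shows "pd i (\<lambda>p. f (p $ 3)) = (\<lambda>p. if i = 3 then f' (p $ 3) else 0)"
proof -
  have "((\<lambda>p. f (p $ 3)) has_derivative (\<lambda>v. f' (x $ 3) * (v $ 3))) (at x)" for x :: "real^3"
    by (rule has_derivative_compose[OF bounded_linear_imp_has_derivative[OF bounded_linear_vec_nth]
          assms[unfolded has_field_derivative_def]])
  from ddir_eqI[OF this] show ?thesis by (auto simp: axis_def)
qed

text \<open>The difference between \<open>f(t)\<close> and its mean is the \<open>t\<close>-derivative of a periodic function, and so
integrates to zero over the cube. This replaces an appeal to Fubini's theorem.\<close>

lemma integral_cube_of_t:
  fixes f :: "real \<Rightarrow> real"
  assumes f: "smooth f" and per: "\<And>t. f (t + 1) = f t"
  shows "integral (cbox 0 1) (\<lambda>p::real^3. f (p $ 3)) = integral {0..1} f"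
proof -
  let ?I = "integral {0..1} f"
  obtain W where W: "smooth W" "\<And>t. W (t + 1) = W t" "\<And>t. (W has_real_derivative f t - ?I) (at t)"
    using smooth_periodic_antiderivative[OF assms] by blast
  have pd: "pd 3 (\<lambda>p. W (p $ 3)) = (\<lambda>p. f (p $ 3) - ?I)"
    using pd_of_t[OF W(3), of 3] by simp
  have "integral (cbox 0 One) (pd 3 (\<lambda>p. W (p $ 3))) = 0"
    by (rule integral_ddir_periodic) (auto intro: smooth_of_t W(1) simp: W(2) axis_Basis)
  then have "integral (cbox 0 1) (\<lambda>p::real^3. f (p $ 3) - ?I) = 0"
    by (simp add: pd One_vec)
  moreover have "integral (cbox 0 1) (\<lambda>p::real^3. f (p $ 3) - ?I) = integral (cbox 0 1) (\<lambda>p::real^3. f (p $ 3)) - integral (cbox 0 1) (\<lambda>p::real^3. ?I)"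
    by (intro integral_diff integrable_continuous smooth_continuous_on smooth_of_t smooth_const f)
  moreover have "integral (cbox 0 1) (\<lambda>p::real^3. ?I) = ?I"
    using content_unit[where 'a = "real^3"] by (simp add: One_vec)
  ultimately show ?thesis by simp
qed

lemma periodic_ddir:
  assumes "smooth f" "periodic f"
  shows "periodic (ddir u f)"
  unfolding periodic_def
proof (intro allI ballI)
  fix x v :: "real^3" assume v: "v \<in> lattice3"
  have "((\<lambda>x. f (x + v)) has_derivative (\<lambda>u. ddir u f (x + v))) (at x)"
    by (rule has_derivative_eq_rhs[OF has_derivative_compose[OF _ smooth_has_derivative[OF assms(1)], of "\<lambda>x. x + v" "\<lambda>u. u"]])
       (auto intro!: derivative_eq_intros)
  moreover have "(\<lambda>x. f (x + v)) = f" using assms(2) v by (auto simp: periodic_def)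
  ultimately have "(f has_derivative (\<lambda>u. ddir u f (x + v))) (at x)" by simp
  from has_derivative_unique[OF this smooth_has_derivative[OF assms(1)]] show "ddir u f (x + v) = ddir u f x"
    by meson
qed

lemma periodic_dirs: "smooth f \<Longrightarrow> periodic f \<Longrightarrow> set vs \<subseteq> Basis \<Longrightarrow> periodic (dirs vs f)"
  by (induction vs) (auto simp: dirs_Cons intro!: periodic_ddir smooth_dirs)

lemma lattice_reduce:
  fixes x :: "real^3"
  obtains y v where "x = y + v" "v \<in> lattice3" "y \<in> cbox 0 1"
proof
  let ?v = "\<chi> i. of_int \<lfloor>x $ i\<rfloor> :: real^3"
  show "x = (x - ?v) + ?v" by simp
  show "?v \<in> lattice3" by (auto simp: lattice3_def)
  show "x - ?v \<in> cbox 0 1"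
    by (auto simp: mem_box_cart) linarith
qed

lemma periodic_bounded:
  fixes f :: "real^3 \<Rightarrow> 'b::real_normed_vector"
  assumes "continuous_on UNIV f" "periodic f"
  obtains B where "\<And>x. norm (f x) \<le> B"
proof -
  have "compact (f ` cbox 0 1)"
    by (intro compact_continuous_image continuous_on_subset[OF assms(1)] compact_cbox) auto
  then obtain B where B: "\<And>y. y \<in> cbox 0 1 \<Longrightarrow> norm (f y) \<le> B"
    using compact_imp_bounded[of "f ` cbox 0 1"] unfolding bounded_iff by (meson image_eqI)
  have "norm (f x) \<le> B" for x
  proof -
    obtain y v where "x = y + v" "v \<in> lattice3" "y \<in> cbox 0 1" by (rule lattice_reduce)
    then show ?thesis using B assms(2) by (simp add: periodic_def)
  qed
  then show ?thesis using that by blast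
qed

lemma smooth_has_real_derivative:
  fixes f :: "real \<Rightarrow> real"
  assumes "smooth f"
  shows "(f has_real_derivative ddir 1 f t) (at t)"
proof -
  have "ddir v f t = ddir 1 f t * v" for v
    using ddir_scaleR[OF assms, of v 1 t] by (simp add: mult.commute)
  then have "(\<lambda>v. ddir v f t) = (\<lambda>v. ddir 1 f t * v)" by (rule ext)
  then show ?thesis
    using smooth_has_derivative[OF assms, of t] by (simp only: has_field_derivative_def)
qed

text \<open>The derivative of the inverse \<open>g\<close> is \<open>1 / (f' \<circ> g)\<close>, which is as often differentiable as \<open>g\<close> itself; this
bootstraps to all orders.\<close>

lemma smooth_inverse_function:
  fixes f :: "real \<Rightarrow> real"
  assumes f: "smooth f" and pos: "\<And>t. ddir 1 f t > 0"
    and fg: "\<And>t. f (g t) = t" and gf: "\<And>t. g (f t) = t"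
  shows "smooth g"
proof -
  have df: "(f has_derivative (\<lambda>v. v * ddir 1 f t)) (at t)" for t
    using smooth_has_real_derivative[OF f, of t]
    unfolding has_field_derivative_def by (simp add: mult_commute_abs)
  have cg: "isCont g t" for t
    using isCont_inverse_function[of 1 "g t" g f] gf fg
      smooth_continuous_on[OF f, of UNIV] by (auto simp: continuous_on_eq_continuous_at)
  have d: "(g has_derivative (\<lambda>v. v * inverse (ddir 1 f (g t)))) (at t)" for t
  proof (rule has_derivative_inverse_basic[OF df _ _ cg open_UNIV])
    show "bounded_linear (\<lambda>v. v * inverse (ddir 1 f (g t)))"
      by (rule bounded_linear_mult_left)
    show "(\<lambda>v. v * inverse (ddir 1 f (g t))) \<circ> (\<lambda>v. v * ddir 1 f (g t)) = id"
      using pos[of "g t"] by (auto simp: fun_eq_iff)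
  qed (auto simp: fg)
  have "kdiff n g" for n
  proof (induction n)
    case 0
    then show ?case using differentiableI[OF d] by simp
  next
    case (Suc n)
    have "kdiff n (\<lambda>t. inverse (ddir 1 f (g t)))"
    proof (intro kdiff_inverse kdiff_compose[OF Suc])
      show "ddir 1 f (g t) \<noteq> 0" for t using pos[of "g t"] by simp
      show "kdiff n (ddir 1 f)" using smooth_ddir[OF f, of 1] by (simp add: smooth_iff_kdiff)
    qed
    then show ?case by (intro kdiff_SucI[OF d]) simp
  qed
  then show ?thesis by (simp add: smooth_iff_kdiff)
qed

section \<open>The metrics, their volume and their curvature\<close>

text \<open>All metrics here, and their \<open>t\<close>-derivatives and inverses, have this shape: a symmetric form in the
coordinates \<open>x, y\<close> and a multiple of \<open>dt\<^sup>2\<close>.\<close>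

definition block :: "real \<Rightarrow> real \<Rightarrow> real \<Rightarrow> real \<Rightarrow> real^3^3" where
  "block a b c d = vector [vector [a, b, 0], vector [b, c, 0], vector [0, 0, d]]"

lemma block_nth [simp]:
  "block a b c d $ 1 $ 1 = a" "block a b c d $ 1 $ 2 = b" "block a b c d $ 1 $ 3 = 0"
  "block a b c d $ 2 $ 1 = b" "block a b c d $ 2 $ 2 = c" "block a b c d $ 2 $ 3 = 0"
  "block a b c d $ 3 $ 1 = 0" "block a b c d $ 3 $ 2 = 0" "block a b c d $ 3 $ 3 = d"
  by (simp_all add: block_def vector_3)

lemma transpose_block [simp]: "transpose (block a b c d) = block a b c d"
  by (simp add: vec_eq_iff forall_3 transpose_def)

lemma det_block: "det (block a b c d) = (a * c - b\<^sup>2) * d"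
  by (simp add: det_3 power2_eq_square algebra_simps)

lemma quad_block: "v \<bullet> (block a b c d *v w) =
    a * (v$1 * w$1) + b * (v$1 * w$2 + v$2 * w$1) + c * (v$2 * w$2) + d * (v$3 * w$3)"
  by (simp add: inner_vec_def matrix_vector_mult_def sum_3 algebra_simps)

lemma block_mult: "block a b c d ** block a' b' c' d' =
   vector [vector [a * a' + b * b', a * b' + b * c', 0], vector [b * a' + c * b', b * b' + c * c', 0], vector [0, 0, d * d']]"
  by (simp add: vec_eq_iff forall_3 matrix_matrix_mult_def sum_3 vector_3)

lemma mat1_block: "mat 1 = block 1 0 1 1"
  by (simp add: vec_eq_iff forall_3 mat_def)

lemma block_inverse:
  assumes "a * c - b\<^sup>2 = 1" "d \<noteq> 0"
  shows "block a b c d ** block c (-b) a (1 / d) = mat 1" "block c (-b) a (1 / d) ** block a b c d = mat 1"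
  using assms unfolding block_mult mat1_block
  by (simp_all add: block_def vec_eq_iff forall_3 vector_3 power2_eq_square algebra_simps)

lemma matrix_inv_unique:
  fixes A :: "real^'n^'n"
  assumes "A ** B = mat 1" "B ** A = mat 1"
  shows "matrix_inv A = B"
proof -
  have "A ** matrix_inv A = mat 1 \<and> matrix_inv A ** A = mat 1"
    unfolding matrix_inv_def by (rule someI[of _ B]) (use assms in blast)
  then show ?thesis using assms by (metis matrix_mul_assoc matrix_mul_lid matrix_mul_rid)
qed

lemma matrix_inv_block:
  assumes "a * c - b\<^sup>2 = 1" "d \<noteq> 0"
  shows "matrix_inv (block a b c d) = block c (-b) a (1 / d)"
  using block_inverse[OF assms] matrix_inv_unique by blast

text \<open>Completing the square in the first coordinate.\<close>

lemma block_pos: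
  assumes "a * c - b\<^sup>2 = 1" "a > 0" "d > 0" "v \<noteq> 0"
  shows "v \<bullet> (block a b c d *v v) > 0"
proof -
  have eq: "a * (v \<bullet> (block a b c d *v v)) = (a * v$1 + b * v$2)\<^sup>2 + (a * c - b\<^sup>2) * (v$2)\<^sup>2 + a * d * (v$3)\<^sup>2"
    unfolding quad_block by (simp add: power2_eq_square algebra_simps)
  have "(a * v$1 + b * v$2)\<^sup>2 + (v$2)\<^sup>2 + a * d * (v$3)\<^sup>2 > 0"
  proof (cases "v$3 = 0 \<and> v$2 = 0")
    case True
    then have "v$1 \<noteq> 0" using assms(4) by (auto simp: vec_eq_iff forall_3)
    then show ?thesis using True assms(2) by simp
  next
    case False
    then have "(v$2)\<^sup>2 + a * d * (v$3)\<^sup>2 > 0"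
      using assms(2,3) by (cases "v$2 = 0") (auto intro!: add_pos_nonneg)
    then show ?thesis by (simp add: add_nonneg_pos add.assoc)
  qed
  then have "a * (v \<bullet> (block a b c d *v v)) > 0" using eq assms(1) by simp
  then show ?thesis using assms(2) by (simp add: zero_less_mult_iff)
qed

text \<open>Half the sum and half the difference of the eigenvalues of \<open>h(t)\<close>. In terms of these the entries of
\<open>h(t)\<close> are linear in the cosine and sine of \<open>4 pi t\<close>, which exhibits the period 1/2.\<close>

definition mean :: "real \<Rightarrow> real" where "mean lam = (lam\<^sup>2 + 1 / lam\<^sup>2) / 2"
definition ecc :: "real \<Rightarrow> real" where "ecc lam = (lam\<^sup>2 - 1 / lam\<^sup>2) / 2"

definition h11 where "h11 lam t = mean lam + ecc lam * cos (4 * pi * t)"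
definition h12 where "h12 lam t = - ecc lam * sin (4 * pi * t)"
definition h22 where "h22 lam t = mean lam - ecc lam * cos (4 * pi * t)"

lemma mean_ecc: "lam > 1 \<Longrightarrow> (mean lam)\<^sup>2 - (ecc lam)\<^sup>2 = 1"
  by (simp add: mean_def ecc_def power2_eq_square field_simps)

lemma ecc_pos:
  assumes "lam > 1"
  shows "ecc lam > 0"
proof -
  have "lam\<^sup>2 > 1" using assms by (simp add: one_less_power)
  then have "1 / lam\<^sup>2 < 1" by (simp add: divide_less_eq)
  then show ?thesis using \<open>lam\<^sup>2 > 1\<close> by (simp add: ecc_def)
qed

lemma mean_minus_ecc: "mean lam - ecc lam = 1 / lam\<^sup>2" and mean_plus_ecc: "mean lam + ecc lam = lam\<^sup>2"
  by (simp_all add: mean_def ecc_def field_simps)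

lemma h_det: "lam > 1 \<Longrightarrow> h11 lam t * h22 lam t - (h12 lam t)\<^sup>2 = 1"
proof -
  assume "lam > 1"
  have "h11 lam t * h22 lam t - (h12 lam t)\<^sup>2
     = (mean lam)\<^sup>2 - (ecc lam)\<^sup>2 * ((sin (4 * pi * t))\<^sup>2 + (cos (4 * pi * t))\<^sup>2)"
    unfolding h11_def h12_def h22_def by algebra
  then show ?thesis using mean_ecc[OF \<open>lam > 1\<close>] by simp
qed

lemma mean_ecc_pos:
  assumes "lam > 1"
  shows "mean lam - ecc lam * cos u > 0" "mean lam + ecc lam * cos u > 0"
proof -
  have "\<bar>ecc lam * cos u\<bar> \<le> ecc lam"
    using ecc_pos[OF assms] abs_cos_le_one[of u] by (simp add: abs_mult)
  moreover have "mean lam - ecc lam > 0"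
    unfolding mean_minus_ecc using assms by simp
  ultimately show "mean lam - ecc lam * cos u > 0" "mean lam + ecc lam * cos u > 0" by linarith+
qed

lemma h11_pos: "lam > 1 \<Longrightarrow> h11 lam t > 0" and h22_pos: "lam > 1 \<Longrightarrow> h22 lam t > 0"
  using mean_ecc_pos by (simp_all add: h11_def h22_def)

lemma cos4: "cos (4 * pi * t) = (cos (2 * pi * t))\<^sup>2 - (sin (2 * pi * t))\<^sup>2"
  and sin4: "sin (4 * pi * t) = 2 * sin (2 * pi * t) * cos (2 * pi * t)"
  using cos_double[of "2 * pi * t"] sin_double[of "2 * pi * t"] by (simp_all add: mult.assoc)

lemma h_alt:
  "h11 lam t = lam\<^sup>2 * (cos (2 * pi * t))\<^sup>2 + (sin (2 * pi * t))\<^sup>2 / lam\<^sup>2"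
  "h22 lam t = (cos (2 * pi * t))\<^sup>2 / lam\<^sup>2 + lam\<^sup>2 * (sin (2 * pi * t))\<^sup>2"
  "h12 lam t = sin (2 * pi * t) * cos (2 * pi * t) / lam\<^sup>2 - lam\<^sup>2 * (sin (2 * pi * t) * cos (2 * pi * t))"
proof -
  let ?C = "(cos (2 * pi * t))\<^sup>2" and ?S = "(sin (2 * pi * t))\<^sup>2"
  have 1: "mean lam = mean lam * (?C + ?S)" by simp
  have "h11 lam t = (mean lam + ecc lam) * ?C + (mean lam - ecc lam) * ?S"
    unfolding h11_def cos4 using 1 by (simp only: algebra_simps)
  then show "h11 lam t = lam\<^sup>2 * ?C + ?S / lam\<^sup>2"
    unfolding mean_minus_ecc mean_plus_ecc by simp
  have "h22 lam t = (mean lam - ecc lam) * ?C + (mean lam + ecc lam) * ?S"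
    unfolding h22_def cos4 using 1 by (simp only: algebra_simps)
  then show "h22 lam t = ?C / lam\<^sup>2 + lam\<^sup>2 * ?S"
    unfolding mean_minus_ecc mean_plus_ecc by simp
  show "h12 lam t = sin (2 * pi * t) * cos (2 * pi * t) / lam\<^sup>2 - lam\<^sup>2 * (sin (2 * pi * t) * cos (2 * pi * t))"
    unfolding h12_def sin4 ecc_def by (simp add: field_simps)
qed

lemma g_metric_block:
  "g_metric lam s p = block (h11 lam (p$3)) (h12 lam (p$3)) (h22 lam (p$3)) ((q_fun lam s (p$3))\<^sup>2)"
proof -
  have "h_metric lam t $ 1 $ 1 = h11 lam t" "h_metric lam t $ 1 $ 2 = h12 lam t"
     "h_metric lam t $ 2 $ 1 = h12 lam t" "h_metric lam t $ 2 $ 2 = h22 lam t" for t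
    unfolding h_metric_def rot_def D_mat_def h_alt
    by (simp_all add: matrix_matrix_mult_def transpose_def sum_2 vector_2 power2_eq_square)
  then show ?thesis
    unfolding g_metric_def Let_def block_def by simp
qed

lemma kappa_eq: "kappa lam = integral {0..1} (\<lambda>t. sqrt (h22 lam t))"
  unfolding kappa_def h_alt ..

lemma smooth_h: "smooth (h11 lam)" "smooth (h12 lam)" "smooth (h22 lam)"
  unfolding h11_def[abs_def] h12_def[abs_def] h22_def[abs_def] by (intro smooth_intros)+

lemma smooth_q: "smooth (q_fun lam s)"
  unfolding q_fun_def[abs_def] by (intro smooth_intros)

lemma trig_shift: "cos (4 * pi * (t + 1)) = cos (4 * pi * t)" "sin (4 * pi * (t + 1)) = sin (4 * pi * t)"
  "sin (2 * pi * (t + 1)) = sin (2 * pi * t)" "cos (2 * pi * (t + 1)) = cos (2 * pi * t)"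
  using cos.plus_of_int[of "4 * pi * t" 2] sin.plus_of_int[of "4 * pi * t" 2]
    sin.plus_of_int[of "2 * pi * t" 1] cos.plus_of_int[of "2 * pi * t" 1]
  by (simp_all add: algebra_simps)

lemma h_periodic: "h11 lam (t + 1) = h11 lam t" "h12 lam (t + 1) = h12 lam t" "h22 lam (t + 1) = h22 lam t"
  unfolding h11_def h12_def h22_def trig_shift by simp_all

lemma q_periodic: "q_fun lam s (t + 1) = q_fun lam s t"
  unfolding q_fun_def trig_shift by simp

lemma periodic_shift_int:
  assumes "\<And>t::real. f (t + 1) = f t"
  shows "f (t + of_int k) = f t"
proof -
  have nat: "f (t + real n) = f t" for t n
  proof (induction n)
    case (Suc n)
    then show ?case using assms[of "t + real n"] by (simp add: add_ac)
  qed simp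
  show ?thesis
  proof (cases "k \<ge> 0")
    case True
    then show ?thesis using nat[of t "nat k"] by simp
  next
    case False
    then show ?thesis using nat[of "t + of_int k" "nat (- k)"] by simp
  qed
qed

lemma periodic_of_t:
  assumes "\<And>t::real. f (t + 1) = f t"
  shows "periodic (\<lambda>p. f (p $ 3))"
  unfolding periodic_def
proof (intro allI ballI)
  fix x v :: "real^3" assume "v \<in> lattice3"
  then obtain k where "v $ 3 = of_int k" by (auto simp: lattice3_def Ints_def)
  then show "f ((x + v) $ 3) = f (x $ 3)"
    using periodic_shift_int[of f, OF assms] by simp
qed

lemma smooth_block:
  assumes "smooth a" "smooth b" "smooth c" "smooth d"
  shows "smooth (\<lambda>x. block (a x) (b x) (c x) (d x))"
proof (intro smooth_vecI)
  fix i j :: 3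
  show "smooth (\<lambda>x. block (a x) (b x) (c x) (d x) $ i $ j)"
    using exhaust_3[of i] exhaust_3[of j] by (auto intro: assms smooth_const)
qed

text \<open>The integrand lies between the square roots of the eigenvalues of \<open>h(t)\<close>.\<close>

lemma kappa_bounds: assumes "lam > 1" shows "1 / lam \<le> kappa lam" "kappa lam \<le> lam"
proof -
  have i: "(\<lambda>t. sqrt (h22 lam t)) integrable_on {0..1}"
    by (intro integrable_continuous_interval continuous_on_real_sqrt smooth_continuous_on smooth_h)
  have e: "\<bar>ecc lam * cos (4 * pi * t)\<bar> \<le> ecc lam" for t
    using ecc_pos[OF assms] abs_cos_le_one[of "4 * pi * t"] by (simp add: abs_mult)
  have lo: "1 / lam \<le> sqrt (h22 lam t)" for t
  proof (rule real_le_rsqrt)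
    show "(1 / lam)\<^sup>2 \<le> h22 lam t"
      unfolding h22_def power_one_over using mean_minus_ecc[of lam] e[of t] by linarith
  qed
  have hi: "sqrt (h22 lam t) \<le> lam" for t
  proof (rule real_le_lsqrt)
    show "h22 lam t \<le> lam\<^sup>2"
      unfolding h22_def using mean_plus_ecc[of lam] e[of t] by linarith
  qed (use assms in simp)
  show "1 / lam \<le> kappa lam"
    using integral_le[OF _ i, of "\<lambda>_. 1 / lam"] lo unfolding kappa_eq by auto
  show "kappa lam \<le> lam"
    using integral_le[OF i, of "\<lambda>_. lam"] hi unfolding kappa_eq by auto
qed

lemma kappa_pos: "lam > 1 \<Longrightarrow> kappa lam > 0"
  using kappa_bounds(1)[of lam] by (smt (verit) divide_pos_pos)

lemma speed_pos:
  assumes "0 \<le> s" "s < 1" shows "1 + s * sin (u::real) > 0"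
proof -
  have "\<bar>s * sin u\<bar> \<le> s"
    using assms abs_sin_le_one[of u] by (simp add: abs_mult mult_left_le)
  then show ?thesis using assms by linarith
qed

lemma q_pos: "lam > 1 \<Longrightarrow> 0 \<le> s \<Longrightarrow> s < 1 \<Longrightarrow> q_fun lam s t > 0"
  unfolding q_fun_def by (intro mult_pos_pos speed_pos) (simp_all add: kappa_pos)

lemma riemannian_g:
  assumes "lam > 1" "0 \<le> s" "s < 1"
  shows "riemannian_metric (g_metric lam s)"
  unfolding riemannian_metric_def
proof (intro conjI allI impI)
  show "smooth (g_metric lam s)"
    unfolding g_metric_block[abs_def]
    by (intro smooth_block smooth_of_t smooth_h smooth_power smooth_q)
  have "periodic (\<lambda>p. (\<lambda>t. block (h11 lam t) (h12 lam t) (h22 lam t) ((q_fun lam s t)\<^sup>2)) (p $ 3))"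
    by (rule periodic_of_t) (simp add: h_periodic q_periodic)
  then show "periodic (g_metric lam s)"
    unfolding g_metric_block[abs_def] by simp
  show "transpose (g_metric lam s x) = g_metric lam s x" for x
    unfolding g_metric_block by simp
  show "v \<bullet> (g_metric lam s x *v v) > 0" if "v \<noteq> 0" for x v
    unfolding g_metric_block
    using assms that q_pos[OF assms] by (intro block_pos h_det h11_pos) (auto simp: less_imp_neq[symmetric])
qed

lemma integral_q:
  "integral {0..1} (q_fun lam s) = inverse (kappa lam)"
proof -
  have "((\<lambda>t. 1 + s * sin (2 * pi * t)) has_integral
     (1 - s * cos (2 * pi * 1) / (2 * pi)) - (0 - s * cos (2 * pi * 0) / (2 * pi))) {0..1}"
    by (rule fundamental_theorem_of_calculus)
       (auto intro!: derivative_eq_intros simp flip: has_real_derivative_iff_has_vector_derivative simp: field_simps)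
  then show ?thesis
    unfolding q_fun_def[abs_def] by (simp add: integral_unique)
qed

lemma volume_g:
  assumes "lam > 1" "0 \<le> s" "s < 1"
  shows "torus_volume (g_metric lam s) = inverse (kappa lam)"
proof -
  have "sqrt (det (g_metric lam s p)) = q_fun lam s (p $ 3)" for p
    unfolding g_metric_block det_block h_det[OF assms(1)]
    using q_pos[OF assms] by (simp add: less_imp_le)
  then have "torus_volume (g_metric lam s) = integral (cbox 0 1) (\<lambda>p::real^3. q_fun lam s (p $ 3))"
    unfolding torus_volume_def by simp
  also have "\<dots> = integral {0..1} (q_fun lam s)"
    by (rule integral_cube_of_t[OF smooth_q q_periodic])
  finally show ?thesis by (simp add: integral_q)
qed

text \<open>The metric depends on \<open>t\<close> only, so that only the partial derivatives with index 3 survive.\<close>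

lemma christoffel_block:
  assumes da: "\<And>t. (a has_real_derivative a' t) (at t)" and db: "\<And>t. (b has_real_derivative b' t) (at t)"
    and dc: "\<And>t. (c has_real_derivative c' t) (at t)" and dd: "\<And>t. (d has_real_derivative d' t) (at t)"
    and det: "\<And>t. a t * c t - (b t)\<^sup>2 = 1" and d: "\<And>t. d t \<noteq> 0"
  defines "G \<equiv> (\<lambda>p::real^3. block (a (p$3)) (b (p$3)) (c (p$3)) (d (p$3)))"
  defines "G' \<equiv> (\<lambda>p::real^3. block (a' (p$3)) (b' (p$3)) (c' (p$3)) (d' (p$3)))"
  shows "christoffel G k i j p = (\<Sum>l\<in>UNIV. block (c (p$3)) (- b (p$3)) (a (p$3)) (1 / d (p$3)) $ k $ l *
    ((if i = 3 then G' p $ j $ l else 0) + (if j = 3 then G' p $ i $ l else 0) - (if l = 3 then G' p $ i $ j else 0))) / 2"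
proof -
  have "pd i (\<lambda>y. G y $ j $ l) = (\<lambda>p. if i = 3 then G' p $ j $ l else 0)" for i j l
    unfolding G_def G'_def
    using exhaust_3[of j] exhaust_3[of l] pd_of_t[OF da, of i] pd_of_t[OF db, of i] pd_of_t[OF dc, of i]
      pd_of_t[OF dd, of i] pd_of_t[of "\<lambda>_. 0" "\<lambda>_. 0" i] by auto
  then show ?thesis
    unfolding christoffel_def by (simp add: G_def matrix_inv_block[OF det d])
qed

text \<open>At the origin \<open>h\<close> is diagonal and its derivative is off-diagonal. All that remains of the component
\<open>R(\<partial>\<^sub>x, \<partial>\<^sub>y) \<partial>\<^sub>y\<close> in direction \<open>x\<close> is one product of Christoffel symbols, which is the term of the Gauss
equation coming from the second fundamental form.\<close>

lemma not_flat_g: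
  assumes "lam > 1" "0 \<le> s" "s < 1"
  shows "\<not> flat_metric (g_metric lam s)"
proof
  assume flat: "flat_metric (g_metric lam s)"
  let ?d = "\<lambda>t. (q_fun lam s t)\<^sup>2"
  let ?a' = "\<lambda>t. - ecc lam * (4 * pi) * sin (4 * pi * t)"
  let ?b' = "\<lambda>t. - ecc lam * (4 * pi) * cos (4 * pi * t)"
  let ?c' = "\<lambda>t. ecc lam * (4 * pi) * sin (4 * pi * t)"
  let ?d' = "ddir 1 ?d"
  have da: "(h11 lam has_real_derivative ?a' t) (at t)" and db: "(h12 lam has_real_derivative ?b' t) (at t)"
    and dc: "(h22 lam has_real_derivative ?c' t) (at t)" for t
    unfolding h11_def[abs_def] h12_def[abs_def] h22_def[abs_def] by (auto intro!: derivative_eq_intros)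
  have dd: "(?d has_real_derivative ?d' t) (at t)" for t
    by (intro smooth_has_real_derivative smooth_power smooth_q)
  have q0: "?d t \<noteq> 0" for t using q_pos[OF assms, of t] by simp
  have gm: "(\<lambda>p. block (h11 lam (p$3)) (h12 lam (p$3)) (h22 lam (p$3)) ((q_fun lam s (p$3))\<^sup>2)) = g_metric lam s"
    by (simp add: fun_eq_iff g_metric_block)
  note chr = christoffel_block[OF da db dc dd h_det[OF assms(1)] q0, unfolded gm]
  let ?G = "christoffel (g_metric lam s)"
  have z: "?G 1 2 2 = (\<lambda>_. 0)" "?G 1 1 2 = (\<lambda>_. 0)"
    by (simp_all add: fun_eq_iff chr sum_3)
  have "pd i (\<lambda>_. 0 :: real) x = 0" for i x
    using pd_of_t[of "\<lambda>_. 0" "\<lambda>_. 0" i] by simp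
  then have "riemann (g_metric lam s) 1 2 1 2 0 =
     (\<Sum>m\<in>UNIV. ?G 1 1 m 0 * ?G m 2 2 0 - ?G 1 2 m 0 * ?G m 1 2 0)"
    unfolding riemann_def z by simp
  also have "\<dots> = - (?G 1 2 3 0 * ?G 3 1 2 0)"
    by (simp add: sum_3 chr)
  also have "\<dots> = h22 lam 0 * (4 * pi * ecc lam)\<^sup>2 / (4 * ?d 0)"
    by (simp add: chr sum_3 h12_def power2_eq_square)
  finally show False
    using flat h22_pos[OF assms(1), of 0] ecc_pos[OF assms(1)] q0[of 0] unfolding flat_metric_def
    by auto
qed

section \<open>Comass in dimension three\<close>

text \<open>A 2-form corresponds to the vector field \<open>X\<close> whose contraction with the volume form \<open>dx dy dt\<close> it is.
The wedge product with a 1-form then becomes the pairing with \<open>X\<close>, and evaluation on a pair of vectors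
becomes the triple product with \<open>X\<close>.\<close>

definition form_vec :: "real^3^3 \<Rightarrow> real^3" where
  "form_vec W = vector [W $ 2 $ 3, W $ 3 $ 1, W $ 1 $ 2]"

definition vec_form :: "real^3 \<Rightarrow> real^3^3" where
  "vec_form X = vector [vector [0, X$3, - X$2], vector [- X$3, 0, X$1], vector [X$2, - X$1, 0]]"

lemma vec_form_nth [simp]:
  "vec_form X $ 1 $ 1 = 0" "vec_form X $ 1 $ 2 = X$3" "vec_form X $ 1 $ 3 = - X$2"
  "vec_form X $ 2 $ 1 = - X$3" "vec_form X $ 2 $ 2 = 0" "vec_form X $ 2 $ 3 = X$1"
  "vec_form X $ 3 $ 1 = X$2" "vec_form X $ 3 $ 2 = - X$1" "vec_form X $ 3 $ 3 = 0"
  by (simp_all add: vec_form_def vector_3)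

lemma form_vec_vec_form [simp]: "form_vec (vec_form X) = X"
  by (simp add: form_vec_def vec_eq_iff forall_3 vector_3)

lemma transpose_vec_form: "transpose (vec_form X) = - vec_form X"
  by (simp add: vec_eq_iff forall_3 transpose_def)

lemma wedge12_eq: "wedge12 \<alpha> \<omega> x = \<alpha> x \<bullet> form_vec (\<omega> x)"
  by (simp add: wedge12_def form_vec_def inner_vec_def sum_3 vector_3)

lemma skew_nth:
  assumes "transpose W = - (W :: real^3^3)"
  shows "W $ i $ j = - W $ j $ i"
proof -
  have "transpose W $ j $ i = (- W) $ j $ i" using assms by simp
  then show ?thesis by (simp add: transpose_def)
qed

lemma gram_inner:
  fixes F :: "real^'n^'n"
  shows "v \<bullet> ((transpose F ** F) *v w) = (F *v v) \<bullet> (F *v w)"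
proof -
  have "v \<bullet> ((transpose F ** F) *v w) = ((F *v w) v* F) \<bullet> v"
    by (simp add: transpose_matrix_vector inner_commute flip: matrix_vector_mul_assoc)
  also have "\<dots> = (F *v w) \<bullet> (F *v v)" by (rule dot_lmul_matrix)
  finally show ?thesis by (simp add: inner_commute)
qed

lemma skew_cross:
  assumes "transpose W = - (W :: real^3^3)"
  shows "v \<bullet> (W *v w) = form_vec W \<bullet> (cross3 v w)"
proof -
  have "W $ 1 $ 1 = 0" "W $ 2 $ 2 = 0" "W $ 3 $ 3 = 0" "W $ 2 $ 1 = - W $ 1 $ 2" "W $ 1 $ 3 = - W $ 3 $ 1" "W $ 3 $ 2 = - W $ 2 $ 3"
    using skew_nth[OF assms, of 1 1] skew_nth[OF assms, of 2 2] skew_nth[OF assms, of 3 3] skew_nth[OF assms, of 2 1]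
      skew_nth[OF assms, of 1 3] skew_nth[OF assms, of 3 2] by auto
  then show ?thesis
    by (simp add: form_vec_def inner_vec_def matrix_vector_mult_def sum_3 cross_components vector_3 algebra_simps)
qed

text \<open>In three dimensions every unit vector is the normal of an oriented orthonormal pair; this is why the
comass of a 2-form is the length of its vector.\<close>

lemma orthonormal_cross_exists:
  fixes u :: "real^3"
  assumes "norm u = 1"
  obtains v w where "v \<bullet> v = 1" "w \<bullet> w = 1" "v \<bullet> w = 0" "cross3 v w = u"
proof -
  have "2 \<le> DIM(real^3)" by simp
  then obtain x where x: "x \<noteq> 0" "orthogonal u x" by (rule orthogonal_to_vector_exists)
  define v where "v = x /\<^sub>R norm x"
  have v: "v \<bullet> v = 1" "u \<bullet> v = 0"
    using x by (simp_all add: v_def dot_square_norm orthogonal_def power2_eq_square)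
  have uu: "u \<bullet> u = 1" using assms by (simp add: dot_square_norm)
  have c: "cross3 v (cross3 u v) = (v \<bullet> v) *\<^sub>R u - (v \<bullet> u) *\<^sub>R v"
    by (rule Lagrange)
  have "cross3 v (cross3 u v) = u" unfolding c using v by (simp add: inner_commute)
  moreover have "norm v = 1" using v(1) by (simp add: norm_eq_sqrt_inner)
  then have "(norm (cross3 u v))\<^sup>2 = 1"
    using norm_cross_dot[of u v] v(2) assms by simp
  then have "(cross3 u v) \<bullet> (cross3 u v) = 1" by (simp add: dot_square_norm)
  moreover have "v \<bullet> (cross3 u v) = 0" by (simp add: dot_cross_self)
  ultimately show ?thesis using that v by blast
qed

text \<open>A square root \<open>F\<close> of the metric takes \<open>G\<close>-orthonormal pairs to Euclidean orthonormal pairs, and cross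
products transform under \<open>F\<close> by the cofactor matrix. The supremum is thereby reduced to that of
\<open>Y \<bullet> u\<close> over Euclidean unit vectors \<open>u\<close>, where \<open>Y\<close> is the image of the vector of the 2-form.\<close>

lemma comass_eq:
  assumes G: "G = transpose F ** F" and det: "det F > 0" and W: "transpose W = - W"
  shows "comass G W = norm (F *v form_vec W) / det F"
proof -
  define Y where "Y = F *v form_vec W"
  have inner: "v \<bullet> (G *v w) = (F *v v) \<bullet> (F *v w)" for v w
    unfolding G by (rule gram_inner)
  have val: "v \<bullet> (W *v w) = (Y \<bullet> (cross3 (F *v v) (F *v w))) / det F" for v w
  proof -
    have "Y \<bullet> (cross3 (F *v v) (F *v w)) = form_vec W \<bullet> (transpose F *v (cross3 (F *v v) (F *v w)))"
      unfolding Y_def by (metis dot_lmul_matrix inner_commute transpose_matrix_vector)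
    also have "\<dots> = det F * (form_vec W \<bullet> (cross3 v w))"
      unfolding cross_matrix_mult by simp
    finally show ?thesis using det skew_cross[OF W] by simp
  qed
  have "invertible F" using det invertible_det_nz[of F] by simp
  then obtain E where E: "F ** E = mat 1" by (auto simp: invertible_def)
  have FE: "F *v (E *v x) = x" for x
    by (simp add: matrix_vector_mul_assoc E)
  obtain u where u: "norm u = 1" "Y = norm Y *\<^sub>R u"
  proof (cases "Y = 0")
    case True
    then show ?thesis using that[of "axis 1 1"] by simp
  next
    case False
    then show ?thesis using that[of "Y /\<^sub>R norm Y"] by simp
  qed
  obtain v w where vw: "v \<bullet> v = 1" "w \<bullet> w = 1" "v \<bullet> w = 0" "cross3 v w = u"
    using orthonormal_cross_exists[OF u(1)] by blast
  have "Y \<bullet> u = norm Y"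
    by (subst u(2)) (simp add: dot_square_norm u(1))
  then have "(E *v v) \<bullet> (W *v (E *v w)) = norm Y / det F"
    unfolding val FE vw(4) by simp
  then have mem: "norm Y / det F \<in> {v \<bullet> (W *v w) | v w.
    v \<bullet> (G *v v) = 1 \<and> w \<bullet> (G *v w) = 1 \<and> v \<bullet> (G *v w) = 0}" (is "_ \<in> ?S")
    using vw(1-3) unfolding inner by (intro CollectI exI[of _ "E *v v"] exI[of _ "E *v w"]) (simp add: FE)
  have "x \<le> norm Y / det F" if x: "x \<in> ?S" for x
  proof -
    obtain a b where ab: "x = a \<bullet> (W *v b)" "(F *v a) \<bullet> (F *v a) = 1" "(F *v b) \<bullet> (F *v b) = 1" "(F *v a) \<bullet> (F *v b) = 0"
      using x unfolding inner by blast
    have "(norm (cross3 (F *v a) (F *v b)))\<^sup>2 = 1"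
      using norm_cross_dot[of "F *v a" "F *v b"] ab by (simp add: norm_eq_sqrt_inner)
    then have "norm (cross3 (F *v a) (F *v b)) = 1"
      by (metis norm_ge_zero one_power2 power2_eq_imp_eq zero_le_one)
    then have "Y \<bullet> (cross3 (F *v a) (F *v b)) \<le> norm Y"
      using norm_cauchy_schwarz[of Y "cross3 (F *v a) (F *v b)"] by simp
    then show ?thesis unfolding ab(1) val using det by (simp add: divide_right_mono)
  qed
  then have "Sup ?S = norm Y / det F" by (intro cSup_eq_maximum mem)
  then show ?thesis unfolding comass_def Y_def .
qed

text \<open>The Cholesky factor of \<open>block a b c (q\<^sup>2)\<close> when \<open>a c - b\<^sup>2 = 1\<close>.\<close>

definition block_root :: "real \<Rightarrow> real \<Rightarrow> real \<Rightarrow> real^3^3" where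
  "block_root a b q = vector [vector [sqrt a, b / sqrt a, 0], vector [0, 1 / sqrt a, 0], vector [0, 0, q]]"

lemma block_root:
  assumes "a * c - b\<^sup>2 = 1" "a > 0"
  shows "block a b c (q\<^sup>2) = transpose (block_root a b q) ** block_root a b q" "det (block_root a b q) = q"
proof -
  have c: "c = (1 + b\<^sup>2) / a" using assms by (simp add: field_simps)
  show "block a b c (q\<^sup>2) = transpose (block_root a b q) ** block_root a b q"
    using assms(2) unfolding block_root_def c
    by (simp add: vec_eq_iff forall_3 matrix_matrix_mult_def transpose_def sum_3 vector_3 power2_eq_square add_divide_distrib)
  show "det (block_root a b q) = q"
    using assms(2) by (simp add: block_root_def det_3 vector_3)
qed

lemma comass_block:
  assumes "a * c - b\<^sup>2 = 1" "a > 0" "q > 0" "transpose W = - W"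
  shows "comass (block a b c (q\<^sup>2)) W = sqrt (form_vec W \<bullet> (block a b c (q\<^sup>2) *v form_vec W)) / q"
proof -
  have "form_vec W \<bullet> (block a b c (q\<^sup>2) *v form_vec W) = (block_root a b q *v form_vec W) \<bullet> (block_root a b q *v form_vec W)"
    unfolding block_root(1)[OF assms(1,2)] by (rule gram_inner)
  then show ?thesis
    using comass_eq[OF block_root(1)[OF assms(1,2), of q] _ assms(4)] block_root(2)[OF assms(1,2), of q] assms(3)
    by (simp add: norm_eq_sqrt_inner)
qed

text \<open>The Cauchy-Schwarz inequality in a \<open>G\<close>-orthonormal frame: the square root on the right is the dual
norm of the covector \<open>e\<close>, and \<open>q\<close> is the volume density.\<close>

lemma wedge_le_comass:
  fixes e :: "real^3"
  assumes g: "a * c - b\<^sup>2 = 1" "a > 0" "q > 0" and W: "transpose W = - W" and le: "comass (block a b c (q\<^sup>2)) W \<le> 1"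
  shows "e \<bullet> form_vec W \<le> q * sqrt (c * (e$1)\<^sup>2 - 2 * b * (e$1) * (e$2) + a * (e$2)\<^sup>2 + (e$3 / q)\<^sup>2)"
proof -
  let ?F = "block_root a b q" and ?X = "form_vec W"
  \<comment> \<open>The coordinates of \<open>e\<close> in the coframe formed by the rows of the Cholesky factor.\<close>
  define z :: "real^3" where "z = vector [e$1 / sqrt a, (a * e$2 - b * e$1) / sqrt a, e$3 / q]"
  have sa: "sqrt a * sqrt a = a" "sqrt a \<noteq> 0" using g by auto
  have "norm (?F *v ?X) / q \<le> 1"
    using le comass_eq[OF block_root(1)[OF g(1,2), of q] _ W] block_root(2)[OF g(1,2), of q] g(3) by simp
  then have n: "norm (?F *v ?X) \<le> q" using g(3) by (simp add: divide_le_eq)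
  have "e \<bullet> ?X = z \<bullet> (?F *v ?X)"
    using g sa by (simp add: z_def block_root_def inner_vec_def matrix_vector_mult_def sum_3 vector_3 field_simps)
  also have "\<dots> \<le> norm z * norm (?F *v ?X)" by (rule norm_cauchy_schwarz)
  also have "\<dots> \<le> norm z * q" using n by (intro mult_left_mono) auto
  also have "norm z = sqrt (c * (e$1)\<^sup>2 - 2 * b * (e$1) * (e$2) + a * (e$2)\<^sup>2 + (e$3 / q)\<^sup>2)"
  proof -
    have c: "c = (1 + b\<^sup>2) / a" using g by (simp add: field_simps)
    have "z \<bullet> z = ((e$1)\<^sup>2 + (a * e$2 - b * e$1)\<^sup>2) / a + (e$3 / q)\<^sup>2"
      using g sa by (simp add: z_def inner_vec_def sum_3 vector_3 power2_eq_square add_divide_distrib)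
    also have "\<dots> = c * (e$1)\<^sup>2 - 2 * b * (e$1) * (e$2) + a * (e$2)\<^sup>2 + (e$3 / q)\<^sup>2"
      using g(2) unfolding c by (simp add: field_simps power2_eq_square)
    finally show ?thesis by (simp add: norm_eq_sqrt_inner)
  qed
  finally show ?thesis by (simp add: mult.commute)
qed

section \<open>Currents of closed forms and calibrations\<close>

lemma integrable_smooth:
  fixes f :: "real^3 \<Rightarrow> real"
  shows "smooth f \<Longrightarrow> f integrable_on cbox 0 1"
  by (intro integrable_continuous smooth_continuous_on)

lemma periodic_map: "periodic f \<Longrightarrow> periodic (\<lambda>x. g (f x))"
  by (simp add: periodic_def)

lemma periodic_map2: "periodic f \<Longrightarrow> periodic h \<Longrightarrow> periodic (\<lambda>x. g (f x) (h x))"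
  by (simp add: periodic_def)

lemma pd_t_mult:
  fixes F :: "real^3 \<Rightarrow> real"
  assumes c: "smooth c" and F: "smooth F"
  shows "pd i (\<lambda>x. c (x$3) * F x) = (\<lambda>x. c (x$3) * pd i F x + (if i = 3 then ddir 1 c (x$3) else 0) * F x)"
proof -
  have "((\<lambda>x. c (x$3) * F x) has_derivative
     (\<lambda>v. c (x$3) * ddir v F x + ddir v (\<lambda>x. c (x$3)) x * F x)) (at x)" for x
    by (rule has_derivative_mult[OF smooth_has_derivative[OF smooth_of_t[OF c]] smooth_has_derivative[OF F]])
  from ddir_eqI[OF this] show ?thesis
    using pd_of_t[OF smooth_has_real_derivative[OF c], of i] by (simp add: fun_eq_iff)
qed

text \<open>Integration by parts on the torus against a weight that depends on \<open>t\<close> only.\<close>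

lemma pd_parts:
  fixes F :: "real^3 \<Rightarrow> real"
  assumes c: "smooth c" "\<And>t. c (t + 1) = c t" and F: "smooth F" "periodic F"
  shows "((\<lambda>x. c (x$3) * pd i F x) has_integral
    - integral (cbox 0 1) (\<lambda>x. (if i = 3 then ddir 1 c (x$3) else 0) * F x)) (cbox 0 1)"
proof -
  let ?P = "\<lambda>x. c (x$3) * F x" and ?R = "\<lambda>x. (if i = 3 then ddir 1 c (x$3) else 0) * F x"
  have sP: "smooth ?P" by (intro smooth_mult smooth_of_t c F)
  have sR: "smooth ?R"
    by (cases "i = 3") (use F c in \<open>auto intro!: smooth_mult smooth_of_t smooth_ddir smooth_const\<close>)
  have pP: "periodic ?P"
    by (intro periodic_map2[where g = "(*)"] F periodic_of_t c)
  have "(pd i ?P has_integral 0) (cbox 0 1)"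
    using integral_pd_periodic[OF sP pP, of i] integrable_integral[OF integrable_smooth[OF smooth_ddir[OF sP axis_Basis]], of i]
    by simp
  from has_integral_diff[OF this integrable_integral[OF integrable_smooth[OF sR]]]
  show ?thesis unfolding pd_t_mult[OF c(1) F(1)] by simp
qed

lemma pd_parts0:
  fixes F :: "real^3 \<Rightarrow> real"
  assumes c: "smooth c" "\<And>t. c (t + 1) = c t" and F: "smooth F" "periodic F" and i: "i \<noteq> 3"
  shows "((\<lambda>x. c (x$3) * pd i F x) has_integral 0) (cbox 0 1)"
  using pd_parts[OF assms(1-4), of i] i by simp

lemma pd_const0:
  fixes F :: "real^3 \<Rightarrow> real"
  assumes F: "smooth F" "periodic F"
  shows "((\<lambda>x. c * pd i F x) has_integral 0) (cbox 0 1)"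
proof -
  have "ddir 1 (\<lambda>_::real. c) = (\<lambda>t. 0)" by (rule ddir_eqI) (rule has_derivative_const)
  then have "ddir 1 (\<lambda>_::real. c) t = 0" for t by (rule fun_cong)
  then show ?thesis using pd_parts[of "\<lambda>_. c" F i, OF smooth_const _ F] by (simp cong: if_cong)
qed

lemma smooth_wedge12: "smooth \<alpha> \<Longrightarrow> smooth \<omega> \<Longrightarrow> smooth (wedge12 \<alpha> \<omega>)"
  unfolding wedge12_def[abs_def] by (intro smooth_intros)

lemma norm_form_vec_le: "norm (form_vec W) \<le> 3 * norm W"
proof -
  have c: "\<bar>W $ i $ j\<bar> \<le> norm W" for i j
    using component_le_norm_cart[of "W $ i" j] Finite_Cartesian_Product.norm_nth_le[of W i] by simp
  have "norm (form_vec W) \<le> \<bar>form_vec W $ 1\<bar> + \<bar>form_vec W $ 2\<bar> + \<bar>form_vec W $ 3\<bar>"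
    using norm_le_l1_cart[of "form_vec W"] by (simp add: sum_3)
  also have "\<dots> \<le> 3 * norm W"
    using c[of 2 3] c[of 3 1] c[of 1 2] by (simp add: form_vec_def vector_3)
  finally show ?thesis .
qed

lemma current_on_form:
  assumes \<eta>: "smooth \<eta>" "periodic \<eta>"
  shows "current_on forms2 (\<lambda>\<omega>. integral (cbox 0 1) (wedge12 \<eta> \<omega>))"
proof -
  obtain B where B: "\<And>x. norm (\<eta> x) \<le> B"
    using periodic_bounded[OF smooth_continuous_on \<eta>(2)] \<eta>(1) by blast
  have int: "wedge12 \<eta> \<omega> integrable_on cbox 0 1" if "\<omega> \<in> forms2" for \<omega>
    using that \<eta> unfolding forms2_def by (intro integrable_smooth smooth_wedge12) auto
  have B0: "0 \<le> B" using B[of 0] norm_ge_zero[of "\<eta> 0"] by linarith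
  have add: "wedge12 \<eta> (\<lambda>x. \<omega> x + \<omega>' x) = (\<lambda>x. wedge12 \<eta> \<omega> x + wedge12 \<eta> \<omega>' x)" for \<omega> \<omega>'
    by (simp add: wedge12_def fun_eq_iff algebra_simps)
  have scale: "wedge12 \<eta> (\<lambda>x. c *\<^sub>R \<omega> x) = (\<lambda>x. c * wedge12 \<eta> \<omega> x)" for c \<omega>
    by (simp add: wedge12_def fun_eq_iff algebra_simps)
  have bound: "\<bar>integral (cbox 0 1) (wedge12 \<eta> \<omega>)\<bar> \<le> (B * 3) * b"
    if \<omega>: "\<omega> \<in> forms2" and b: "\<forall>vs x. set vs \<subseteq> Basis \<and> length vs \<le> 0 \<longrightarrow> norm (dirs vs \<omega> x) \<le> b" for \<omega> b
  proof -
    have b': "norm (\<omega> x) \<le> b" for x using b[rule_format, of "[]"] by simp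
    have "norm (wedge12 \<eta> \<omega> x) \<le> B * 3 * b" for x
    proof -
      have "norm (wedge12 \<eta> \<omega> x) \<le> norm (\<eta> x) * norm (form_vec (\<omega> x))"
        unfolding wedge12_eq using Cauchy_Schwarz_ineq2 by simp
      also have "\<dots> \<le> B * (3 * b)"
        using B b' norm_form_vec_le[of "\<omega> x"] B0
        by (intro mult_mono) (auto intro: order_trans[OF norm_form_vec_le])
      finally show ?thesis by simp
    qed
    moreover have "0 \<le> b" using b'[of 0] norm_ge_zero[of "\<omega> 0"] by linarith
    ultimately have "norm (integral (cbox 0 1) (wedge12 \<eta> \<omega>)) \<le> B * 3 * b * Henstock_Kurzweil_Integration.content (cbox 0 (1::real^3))"
      using B0 by (intro has_integral_bound[OF _ integrable_integral[OF int[OF \<omega>]]]) auto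
    then show ?thesis using content_unit[where 'a = "real^3"] by (simp add: One_vec)
  qed
  show ?thesis unfolding current_on_def
  proof (intro conjI ballI allI exI impI)
    show "integral (cbox 0 1) (wedge12 \<eta> (\<lambda>x. \<omega> x + \<omega>' x)) =
       integral (cbox 0 1) (wedge12 \<eta> \<omega>) + integral (cbox 0 1) (wedge12 \<eta> \<omega>')"
      if "\<omega> \<in> forms2" "\<omega>' \<in> forms2" for \<omega> \<omega>'
      unfolding add by (rule integral_add[OF int[OF that(1)] int[OF that(2)]])
    show "integral (cbox 0 1) (wedge12 \<eta> (\<lambda>x. c *\<^sub>R \<omega> x)) = c * integral (cbox 0 1) (wedge12 \<eta> \<omega>)" for c \<omega>
      unfolding scale by simp
  qed (rule bound)
qed

lemma smooth_form_of_t: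
  assumes "smooth w"
  shows "smooth (\<lambda>p::real^3. vector [\<alpha>, \<beta>, w (p $ 3)] :: real^3)"
proof (rule smooth_vecI)
  fix i :: 3
  show "smooth (\<lambda>p::real^3. (vector [\<alpha>, \<beta>, w (p $ 3)] :: real^3) $ i)"
    using exhaust_3[of i] smooth_of_t[OF assms] smooth_const by (elim disjE) (simp_all add: vector_3)
qed

text \<open>Integration by parts moves the exterior derivative to the 1-form. Its only variable coefficient is
that of \<open>dt\<close>, which is never differentiated in direction \<open>t\<close>.\<close>

lemma closed_current_form:
  assumes w: "smooth w" "\<And>t. w (t + 1) = w t"
  shows "closed_current2 (\<lambda>\<omega>. integral (cbox 0 1) (wedge12 (\<lambda>p. vector [\<alpha>, \<beta>, w (p $ 3)]) \<omega>))"
  unfolding closed_current2_def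
proof (intro conjI ballI)
  let ?\<eta> = "\<lambda>p::real^3. vector [\<alpha>, \<beta>, w (p $ 3)] :: real^3"
  have s: "smooth ?\<eta>" by (rule smooth_form_of_t[OF w(1)])
  have p: "periodic ?\<eta>"
    using periodic_of_t[of "\<lambda>t. vector [\<alpha>, \<beta>, w t] :: real^3"] w by simp
  show "current_on forms2 (\<lambda>\<omega>. integral (cbox 0 1) (wedge12 ?\<eta> \<omega>))"
    by (rule current_on_form[OF s p])
  fix a assume "a \<in> forms1"
  then have a: "smooth (\<lambda>y. a y $ i)" "periodic (\<lambda>y. a y $ i)" for i
    by (auto simp: forms1_def intro: smooth_vec_nth periodic_map)
  have "((\<lambda>x. (\<alpha> * pd 2 (\<lambda>y. a y $ 3) x - \<alpha> * pd 3 (\<lambda>y. a y $ 2) x) +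
     (\<beta> * pd 3 (\<lambda>y. a y $ 1) x - \<beta> * pd 1 (\<lambda>y. a y $ 3) x) +
     (w (x$3) * pd 1 (\<lambda>y. a y $ 2) x - w (x$3) * pd 2 (\<lambda>y. a y $ 1) x)) has_integral (0-0)+(0-0)+(0-0)) (cbox 0 1)"
    by (intro has_integral_add has_integral_diff pd_const0 pd_parts0 a w) auto
  then have "(wedge12 ?\<eta> (ext_d1 a) has_integral 0) (cbox 0 1)"
    by (simp add: wedge12_def[abs_def] ext_d1_def vector_3 algebra_simps)
  then show "integral (cbox 0 1) (wedge12 ?\<eta> (ext_d1 a)) = 0"
    by (rule integral_unique)
qed

text \<open>The orders of the two continuity bounds may differ, so the larger one serves for the sum.\<close>

lemma current_on_add:
  assumes "current_on V T" "current_on V S"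
  shows "current_on V (\<lambda>\<omega>. T \<omega> + S \<omega>)"
proof -
  obtain C N where C: "\<And>\<omega> B. \<omega> \<in> V \<Longrightarrow> (\<And>vs x. set vs \<subseteq> Basis \<Longrightarrow> length vs \<le> N \<Longrightarrow> norm (dirs vs \<omega> x) \<le> B) \<Longrightarrow> \<bar>T \<omega>\<bar> \<le> C * B"
    using assms(1) unfolding current_on_def by (meson)
  obtain C' N' where C': "\<And>\<omega> B. \<omega> \<in> V \<Longrightarrow> (\<And>vs x. set vs \<subseteq> Basis \<Longrightarrow> length vs \<le> N' \<Longrightarrow> norm (dirs vs \<omega> x) \<le> B) \<Longrightarrow> \<bar>S \<omega>\<bar> \<le> C' * B"
    using assms(2) unfolding current_on_def by (meson)
  have "\<bar>T \<omega> + S \<omega>\<bar> \<le> (C + C') * B" if "\<omega> \<in> V"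
    "\<forall>vs x. set vs \<subseteq> Basis \<and> length vs \<le> max N N' \<longrightarrow> norm (dirs vs \<omega> x) \<le> B" for \<omega> B
    using C[OF that(1), of B] C'[OF that(1), of B] that(2) by (simp add: algebra_simps)
  then have "\<exists>C N. \<forall>\<omega>\<in>V. \<forall>B. (\<forall>vs x. set vs \<subseteq> Basis \<and> length vs \<le> N \<longrightarrow> norm (dirs vs \<omega> x) \<le> B)
     \<longrightarrow> \<bar>T \<omega> + S \<omega>\<bar> \<le> C * B"
    by blast
  then show ?thesis using assms unfolding current_on_def by (simp add: algebra_simps)
qed

lemma current_on_minus:
  assumes "current_on V T"
  shows "current_on V (\<lambda>\<omega>. - T \<omega>)"
  using assms unfolding current_on_def by simp

lemma current_on_zero: "current_on V (\<lambda>_. 0)"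
  unfolding current_on_def by (auto intro!: exI[of _ 0])

lemma mem_current_class: "closed_current2 T \<Longrightarrow> T \<in> current_class T"
  unfolding current_class_def using current_on_zero by auto

lemma current_class_eqI:
  assumes U: "current_on forms3 U" and eq: "\<And>\<omega>. \<omega> \<in> forms2 \<Longrightarrow> T \<omega> - T' \<omega> = U (ext_d2 \<omega>)"
  shows "current_class T = current_class T'"
proof -
  have *: "S \<in> current_class T'" if S: "S \<in> current_class T" and "current_on forms3 U" "\<And>\<omega>. \<omega> \<in> forms2 \<Longrightarrow> T \<omega> - T' \<omega> = U (ext_d2 \<omega>)"
    for S T T' U
  proof -
    obtain V where V: "current_on forms3 V" "\<And>\<omega>. \<omega> \<in> forms2 \<Longrightarrow> S \<omega> - T \<omega> = V (ext_d2 \<omega>)" "closed_current2 S"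
      using S unfolding current_class_def by blast
    have "S \<omega> - T' \<omega> = V (ext_d2 \<omega>) + U (ext_d2 \<omega>)" if "\<omega> \<in> forms2" for \<omega>
      using V(2)[OF that] \<open>\<And>\<omega>. \<omega> \<in> forms2 \<Longrightarrow> T \<omega> - T' \<omega> = U (ext_d2 \<omega>)\<close>[OF that] by linarith
    then show ?thesis
      using V(3) current_on_add[OF V(1) that(2)] unfolding current_class_def by blast
  qed
  have "T' \<omega> - T \<omega> = - U (ext_d2 \<omega>)" if "\<omega> \<in> forms2" for \<omega> using eq[OF that] by simp
  then show ?thesis using *[OF _ U eq] *[OF _ current_on_minus[OF U]] by blast
qed

lemma current_on_function:
  assumes "smooth W" "periodic W"
  shows "current_on forms3 (\<lambda>\<rho>. integral (cbox 0 1) (\<lambda>x. W x * \<rho> x))"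
proof -
  obtain B where B: "\<And>x. norm (W x) \<le> B"
    using periodic_bounded[OF smooth_continuous_on assms(2)] assms(1) by blast
  have B0: "0 \<le> B" using B[of 0] norm_ge_zero[of "W 0"] by linarith
  have int: "(\<lambda>x. W x * \<rho> x) integrable_on cbox 0 1" if "\<rho> \<in> forms3" for \<rho>
    using that assms unfolding forms3_def by (intro integrable_smooth smooth_mult) auto
  have bound: "\<bar>integral (cbox 0 1) (\<lambda>x. W x * \<rho> x)\<bar> \<le> B * b"
    if \<rho>: "\<rho> \<in> forms3" and b: "\<forall>vs x. set vs \<subseteq> Basis \<and> length vs \<le> 0 \<longrightarrow> norm (dirs vs \<rho> x) \<le> b" for \<rho> b
  proof -
    have b': "norm (\<rho> x) \<le> b" for x using b[rule_format, of "[]"] by simp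
    have b0: "0 \<le> b" using b'[of 0] norm_ge_zero[of "\<rho> 0"] by linarith
    have "norm (W x * \<rho> x) \<le> B * b" for x
      unfolding norm_mult using B b' B0 by (intro mult_mono) auto
    then have "norm (integral (cbox 0 1) (\<lambda>x. W x * \<rho> x)) \<le> B * b * Henstock_Kurzweil_Integration.content (cbox 0 (1::real^3))"
      using B0 b0 by (intro has_integral_bound[OF _ integrable_integral[OF int[OF \<rho>]]]) auto
    then show ?thesis using content_unit[where 'a = "real^3"] by (simp add: One_vec)
  qed
  show ?thesis unfolding current_on_def
  proof (intro conjI ballI allI exI impI)
    show "integral (cbox 0 1) (\<lambda>x. W x * (\<omega> x + \<omega>' x)) =
       integral (cbox 0 1) (\<lambda>x. W x * \<omega> x) + integral (cbox 0 1) (\<lambda>x. W x * \<omega>' x)"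
      if "\<omega> \<in> forms3" "\<omega>' \<in> forms3" for \<omega> \<omega>'
      unfolding distrib_left by (rule integral_add[OF int[OF that(1)] int[OF that(2)]])
    show "integral (cbox 0 1) (\<lambda>x. W x * (c *\<^sub>R \<omega> x)) = c * integral (cbox 0 1) (\<lambda>x. W x * \<omega> x)" for c \<omega>
      by (simp add: mult.left_commute)
  qed (rule bound)
qed

text \<open>The form \<open>w dt\<close> and its mean times \<open>dt\<close> differ by \<open>dW\<close> for a periodic \<open>W\<close>. Integration by parts shows that
the corresponding currents differ by the boundary of the 3-current with density \<open>- W\<close>.\<close>

lemma class_form:
  assumes w: "smooth w" "\<And>t. w (t + 1) = w t"
  shows "current_class (\<lambda>\<omega>. integral (cbox 0 1) (wedge12 (\<lambda>p. vector [\<alpha>, \<beta>, w (p $ 3)]) \<omega>))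
       = r_class \<alpha> \<beta> (integral {0..1} w)"
proof -
  let ?c = "integral {0..1} w"
  obtain W where W: "smooth W" "\<And>t. W (t + 1) = W t" "\<And>t. (W has_real_derivative w t - ?c) (at t)"
    using smooth_periodic_antiderivative[OF w] by blast
  have dW: "ddir 1 W t = w t - ?c" for t
    using DERIV_unique[OF smooth_has_real_derivative[OF W(1)] W(3)] .
  let ?U = "\<lambda>\<rho>. integral (cbox 0 1) (\<lambda>x::real^3. (- W (x$3)) * \<rho> x)"
  show ?thesis unfolding r_class_def dual_class_def
  proof (rule current_class_eqI)
    have "periodic (\<lambda>x. - W (x $ 3))" by (rule periodic_of_t) (simp add: W)
    then show "current_on forms3 ?U"
      by (intro current_on_function smooth_minus smooth_of_t W)
    fix \<omega> :: "real^3 \<Rightarrow> real^3^3" assume "\<omega> \<in> forms2"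
    then have o: "smooth (\<lambda>y. \<omega> y $ i $ j)" "periodic (\<lambda>y. \<omega> y $ i $ j)" for i j
      by (auto simp: forms2_def intro: smooth_vec_nth periodic_map)
    have so: "smooth \<omega>" using \<open>\<omega> \<in> forms2\<close> by (simp add: forms2_def)
    let ?V = "\<lambda>t. - W t"
    have V: "smooth ?V" "\<And>t. ?V (t + 1) = ?V t" by (auto intro: smooth_minus W simp: W)
    have dV: "ddir 1 ?V t = - (w t - ?c)" for t
      by (rule DERIV_unique[OF smooth_has_real_derivative[OF V(1)] DERIV_minus[OF W(3)]])
    let ?J = "integral (cbox 0 1) (\<lambda>x. (w (x$3) - ?c) * \<omega> x $ 1 $ 2)"
    have "((\<lambda>x. ?V (x$3) * pd 3 (\<lambda>y. \<omega> y $ 1 $ 2) x) has_integral ?J) (cbox 0 1)"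
    proof -
      have "(\<lambda>x. (if (3::3) = 3 then ddir 1 ?V (x$3) else 0) * \<omega> x $ 1 $ 2) = (\<lambda>x. - ((w (x$3) - ?c) * \<omega> x $ 1 $ 2))"
        by (simp only: dV simp_thms if_True mult_minus_left)
      then show ?thesis using pd_parts[OF V o, of 3 1 2] by (simp only: integral_neg minus_minus)
    qed
    then have "((\<lambda>x. ?V (x$3) * pd 1 (\<lambda>y. \<omega> y $ 2 $ 3) x + ?V (x$3) * pd 2 (\<lambda>y. \<omega> y $ 3 $ 1) x
        + ?V (x$3) * pd 3 (\<lambda>y. \<omega> y $ 1 $ 2) x) has_integral 0 + 0 + ?J) (cbox 0 1)"
      by (intro has_integral_add pd_parts0 V o) auto
    then have 1: "?U (ext_d2 \<omega>) = ?J"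
      unfolding ext_d2_def by (simp add: integral_unique distrib_left)
    have "integral (cbox 0 1) (wedge12 (\<lambda>p. vector [\<alpha>, \<beta>, w (p $ 3)]) \<omega>) -
          integral (cbox 0 1) (wedge12 (\<lambda>p. vector [\<alpha>, \<beta>, ?c]) \<omega>) =
          integral (cbox 0 1) (\<lambda>x. wedge12 (\<lambda>p. vector [\<alpha>, \<beta>, w (p $ 3)]) \<omega> x - wedge12 (\<lambda>p. vector [\<alpha>, \<beta>, ?c]) \<omega> x)"
      by (intro integral_diff[symmetric] integrable_smooth smooth_wedge12 so smooth_form_of_t w smooth_const)
    also have "\<dots> = ?J"
      by (intro arg_cong[where f = "integral _"]) (simp add: wedge12_def vector_3 fun_eq_iff algebra_simps)
    finally show "integral (cbox 0 1) (wedge12 (\<lambda>p. vector [\<alpha>, \<beta>, w (p $ 3)]) \<omega>) -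
          integral (cbox 0 1) (wedge12 (\<lambda>p. vector [\<alpha>, \<beta>, ?c]) \<omega>) = ?U (ext_d2 \<omega>)"
      using 1 by simp
  qed
qed

text \<open>Homologous currents differ by a functional that factors through the exterior derivative.\<close>

lemma current_eq_on_closed:
  assumes T: "T \<in> current_class T0" and \<Omega>: "\<Omega> \<in> forms2" and cl: "ext_d2 \<Omega> = (\<lambda>_. 0)"
  shows "T \<Omega> = T0 \<Omega>"
proof -
  obtain U where U: "current_on forms3 U" "T \<Omega> - T0 \<Omega> = U (ext_d2 \<Omega>)"
    using T \<Omega> unfolding current_class_def by blast
  have z: "(\<lambda>_. 0) \<in> forms3" by (simp add: forms3_def smooth_const periodic_def)
  have "\<forall>c. \<forall>\<rho>\<in>forms3. U (\<lambda>x. c *\<^sub>R \<rho> x) = c * U \<rho>"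
    using U(1) unfolding current_on_def by blast
  from this[rule_format, OF z, of 0] have "U (\<lambda>_. 0) = 0" by simp
  then show ?thesis using U(2) cl by simp
qed

text \<open>Calibration. The current of the 1-form with coefficients \<open>\<alpha>, \<beta>, w\<close> bounds the stable norm from above,
because \<open>m\<close> dominates its pointwise norm times the volume density. The 2-form of the vector field
\<open>(X1, X2, X3)\<close> bounds it from below: it is closed because \<open>X1\<close> and \<open>X2\<close> depend on \<open>t\<close> only and \<open>X3\<close> is
constant, its comass is at most one, and its value depends only on the homology class.\<close>

lemma stable_norm_calibrated:
  fixes a b c q w m X1 X2 :: "real \<Rightarrow> real" and X3 \<alpha> \<beta> L :: real
  assumes G: "\<And>p. G p = block (a (p$3)) (b (p$3)) (c (p$3)) ((q (p$3))\<^sup>2)"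
    and det: "\<And>t. a t * c t - (b t)\<^sup>2 = 1" and a: "\<And>t. a t > 0" and q: "\<And>t. q t > 0"
    and w: "smooth w" "\<And>t. w (t + 1) = w t"
    and m: "smooth m" "\<And>t. m (t + 1) = m t" "integral {0..1} m \<le> L"
      "\<And>t. q t * sqrt (c t * \<alpha>\<^sup>2 - 2 * b t * \<alpha> * \<beta> + a t * \<beta>\<^sup>2 + (w t / q t)\<^sup>2) \<le> m t"
    and X1: "smooth X1" "\<And>t. X1 (t + 1) = X1 t" and X2: "smooth X2" "\<And>t. X2 (t + 1) = X2 t"
    and unit: "\<And>t. a t * (X1 t)\<^sup>2 + 2 * b t * X1 t * X2 t + c t * (X2 t)\<^sup>2 + (q t)\<^sup>2 * X3\<^sup>2 \<le> (q t)\<^sup>2"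
    and L: "L \<le> integral {0..1} (\<lambda>t. \<alpha> * X1 t + \<beta> * X2 t + integral {0..1} w * X3)"
  shows "stable_norm G (r_class \<alpha> \<beta> (integral {0..1} w)) = ereal L"
proof (rule antisym)
  let ?\<eta> = "\<lambda>p::real^3. vector [\<alpha>, \<beta>, w (p $ 3)] :: real^3"
  let ?T = "\<lambda>\<omega>. integral (cbox 0 1) (wedge12 ?\<eta> \<omega>)"
  have s\<eta>: "smooth ?\<eta>" by (rule smooth_form_of_t[OF w(1)])
  have "mass G ?T \<le> ereal L"
    unfolding mass_def
  proof (rule SUP_least)
    fix \<omega> :: "real^3 \<Rightarrow> real^3^3" assume "\<omega> \<in> {\<omega> \<in> forms2. \<forall>x. comass (G x) (\<omega> x) \<le> 1}"
    then have \<omega>: "smooth \<omega>" "\<And>x. transpose (\<omega> x) = - \<omega> x" "\<And>x. comass (G x) (\<omega> x) \<le> 1"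
      by (auto simp: forms2_def)
    have "?T \<omega> \<le> integral (cbox 0 1) (\<lambda>p::real^3. m (p $ 3))"
    proof (rule integral_le)
      show "wedge12 ?\<eta> \<omega> integrable_on cbox 0 1"
        by (intro integrable_smooth smooth_wedge12 \<omega> s\<eta>)
      show "(\<lambda>p::real^3. m (p $ 3)) integrable_on cbox 0 1"
        by (intro integrable_smooth smooth_of_t m)
      show "wedge12 ?\<eta> \<omega> x \<le> m (x $ 3)" for x
        using order_trans[OF wedge_le_comass[OF det a q \<omega>(2) \<omega>(3)[unfolded G], of "?\<eta> x"] ] m(4)[of "x $ 3"]
        by (simp add: wedge12_eq vector_3)
    qed
    also have "\<dots> = integral {0..1} m" by (rule integral_cube_of_t[OF m(1,2)])
    finally show "ereal (?T \<omega>) \<le> ereal L" using m(3) by simp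
  qed
  moreover have "stable_norm G (r_class \<alpha> \<beta> (integral {0..1} w)) \<le> mass G ?T"
    unfolding stable_norm_def
    by (rule Inf_lower) (use closed_current_form[OF w] class_form[OF w] in blast)
  ultimately show "stable_norm G (r_class \<alpha> \<beta> (integral {0..1} w)) \<le> ereal L" by (rule order_trans[rotated])
next
  let ?c = "integral {0..1} w"
  let ?X = "\<lambda>p::real^3. vector [X1 (p$3), X2 (p$3), X3] :: real^3"
  let ?\<Omega> = "\<lambda>p. vec_form (?X p)"
  have "smooth (\<lambda>p. ?\<Omega> p $ i $ j)" for i j
    using exhaust_3[of i] exhaust_3[of j] by (auto simp: vector_3 intro!: smooth_const smooth_minus smooth_of_t X1 X2)
  then have s: "smooth ?\<Omega>" by (intro smooth_vecI)
  have "periodic ?\<Omega>"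
    using periodic_of_t[of "\<lambda>t. vec_form (vector [X1 t, X2 t, X3])"] X1 X2 by simp
  then have \<Omega>: "?\<Omega> \<in> forms2" using s by (simp add: forms2_def transpose_vec_form)
  have cl: "ext_d2 ?\<Omega> = (\<lambda>_. 0)"
    unfolding ext_d2_def
    using pd_of_t[OF smooth_has_real_derivative[OF X1(1)], of 1] pd_of_t[OF smooth_has_real_derivative[OF X2(1)], of 2]
      pd_of_t[of "\<lambda>_. X3" "\<lambda>_. 0" 3]
    by (simp add: vector_3 fun_eq_iff)
  have cm: "comass (G x) (?\<Omega> x) \<le> 1" for x
  proof -
    have "?X x \<bullet> (G x *v ?X x) \<le> (q (x$3))\<^sup>2"
      using unit[of "x$3"] unfolding G quad_block by (simp add: vector_3 power2_eq_square algebra_simps)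
    then have "sqrt (?X x \<bullet> (G x *v ?X x)) \<le> q (x$3)"
      using q[of "x$3"] by (intro real_le_lsqrt) auto
    then show ?thesis
      unfolding G using comass_block[OF det[of "x$3"] a q[of "x$3"] transpose_vec_form, of "?X x"] q[of "x$3"]
      by (simp add: divide_le_eq)
  qed
  have val: "integral (cbox 0 1) (wedge12 (\<lambda>_. vector [\<alpha>, \<beta>, ?c]) ?\<Omega>) = integral {0..1} (\<lambda>t. \<alpha> * X1 t + \<beta> * X2 t + ?c * X3)"
  proof -
    define f where "f = (\<lambda>t. \<alpha> * X1 t + \<beta> * X2 t + ?c * X3)"
    have "wedge12 (\<lambda>_. vector [\<alpha>, \<beta>, ?c]) ?\<Omega> = (\<lambda>p. f (p $ 3))"
      by (simp add: wedge12_def vector_3 fun_eq_iff f_def)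
    moreover have "integral (cbox 0 1) (\<lambda>p::real^3. f (p $ 3)) = integral {0..1} f"
      unfolding f_def by (rule integral_cube_of_t) (auto intro!: smooth_add smooth_mult smooth_const X1 X2 simp: X1 X2)
    ultimately show ?thesis by (simp add: f_def)
  qed
  show "ereal L \<le> stable_norm G (r_class \<alpha> \<beta> ?c)"
    unfolding stable_norm_def
  proof (rule Inf_greatest)
    fix M assume "M \<in> {mass G T |T. closed_current2 T \<and> current_class T = r_class \<alpha> \<beta> ?c}"
    then obtain T where T: "M = mass G T" "T \<in> r_class \<alpha> \<beta> ?c"
      using mem_current_class by blast
    have "T ?\<Omega> = integral (cbox 0 1) (wedge12 (\<lambda>_. vector [\<alpha>, \<beta>, ?c]) ?\<Omega>)"
      using current_eq_on_closed[OF _ \<Omega> cl] T(2) unfolding r_class_def dual_class_def by blast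
    then have "ereal L \<le> ereal (T ?\<Omega>)" using L val by simp
    also have "\<dots> \<le> M"
      unfolding T(1) mass_def by (rule SUP_upper) (use \<Omega> cm in simp)
    finally show "ereal L \<le> M" .
  qed
qed

section \<open>The stable norm of the twisted metrics\<close>

lemma integral_shift_periodic:
  fixes f :: "real \<Rightarrow> real"
  assumes "continuous_on UNIV f" "\<And>t. f (t + 1) = f t" "0 \<le> r" "r \<le> 1"
  shows "integral {0..1} (\<lambda>t. f (t + r)) = integral {0..1} f"
  using integral_cube_shift[of f 1 r] assms by simp

text \<open>The squared length of \<open>\<alpha> dx + \<beta> dy\<close> with respect to the inverse of \<open>h(t)\<close>.\<close>

definition conorm2 :: "real \<Rightarrow> real \<Rightarrow> real \<Rightarrow> real \<Rightarrow> real" where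
  "conorm2 lam \<alpha> \<beta> t = h22 lam t * \<alpha>\<^sup>2 - 2 * h12 lam t * \<alpha> * \<beta> + h11 lam t * \<beta>\<^sup>2"

text \<open>In polar coordinates for \<open>(\<alpha>, \<beta>)\<close> the angle can be absorbed into the rotation that defines \<open>h\<close>.\<close>

lemma conorm2_polar:
  assumes "\<rho> > 0" "\<rho>\<^sup>2 = \<alpha>\<^sup>2 + \<beta>\<^sup>2"
  obtains r where "0 \<le> r" "r \<le> 1" "\<And>t. conorm2 lam \<alpha> \<beta> t = \<rho>\<^sup>2 * h22 lam (t + r)"
proof -
  have "(\<alpha> / \<rho>)\<^sup>2 + (\<beta> / \<rho>)\<^sup>2 = \<rho>\<^sup>2 / \<rho>\<^sup>2"
    unfolding assms(2) power_divide add_divide_distrib ..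
  then have "(\<alpha> / \<rho>)\<^sup>2 + (\<beta> / \<rho>)\<^sup>2 = 1" using assms(1) by simp
  then obtain \<phi> where \<phi>: "0 \<le> \<phi>" "\<phi> < 2 * pi" "\<alpha> / \<rho> = cos \<phi>" "\<beta> / \<rho> = sin \<phi>"
    using sincos_total_2pi by blast
  then have ab: "\<alpha> = \<rho> * cos \<phi>" "\<beta> = \<rho> * sin \<phi>" using assms by (auto simp: field_simps)
  have "conorm2 lam \<alpha> \<beta> t = \<rho>\<^sup>2 * h22 lam (t + \<phi> / (2 * pi))" for t
  proof -
    have "4 * pi * (t + \<phi> / (2 * pi)) = 4 * pi * t + 2 * \<phi>" by (simp add: field_simps)
    then have "h22 lam (t + \<phi> / (2 * pi)) = mean lam - ecc lam *
       (cos (4 * pi * t) * ((cos \<phi>)\<^sup>2 - (sin \<phi>)\<^sup>2) - sin (4 * pi * t) * (2 * sin \<phi> * cos \<phi>))"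
      unfolding h22_def by (simp only: cos_add cos_double sin_double)
    moreover have "mean lam = mean lam * ((sin \<phi>)\<^sup>2 + (cos \<phi>)\<^sup>2)" by simp
    ultimately show ?thesis
      unfolding conorm2_def h22_def h12_def h11_def ab by algebra
  qed
  then show ?thesis using that[of "\<phi> / (2 * pi)"] \<phi> by (simp add: divide_le_eq)
qed

lemma conorm2_pos:
  assumes "lam > 1" "\<rho> > 0" "\<rho>\<^sup>2 = \<alpha>\<^sup>2 + \<beta>\<^sup>2"
  shows "conorm2 lam \<alpha> \<beta> t > 0"
proof -
  obtain r where "\<And>t. conorm2 lam \<alpha> \<beta> t = \<rho>\<^sup>2 * h22 lam (t + r)"
    using conorm2_polar[OF assms(2,3)] by blast
  then show ?thesis using h22_pos[OF assms(1)] assms(2) by simp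
qed

lemma smooth_conorm2: "smooth (conorm2 lam \<alpha> \<beta>)"
  unfolding conorm2_def[abs_def] by (intro smooth_intros smooth_h)

lemma conorm2_periodic: "conorm2 lam \<alpha> \<beta> (t + 1) = conorm2 lam \<alpha> \<beta> t"
  by (simp add: conorm2_def h_periodic)

lemma h_half_periodic: "h11 lam (t + 1/2) = h11 lam t" "h12 lam (t + 1/2) = h12 lam t" "h22 lam (t + 1/2) = h22 lam t"
proof -
  have "4 * pi * (t + 1/2) = 4 * pi * t + 2 * pi" by (simp add: field_simps)
  then show "h11 lam (t + 1/2) = h11 lam t" "h12 lam (t + 1/2) = h12 lam t" "h22 lam (t + 1/2) = h22 lam t"
    unfolding h11_def h12_def h22_def by simp_all
qed

text \<open>After the translation from the polar form, the constant part of \<open>q\<close> contributes \<open>\<rho> kappa\<close> by the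
definition of \<open>kappa\<close>. The part with \<open>sin (2 pi t)\<close> is odd under a shift by half a period, while the norm
is invariant, so that it contributes nothing.\<close>

lemma integral_q_conorm:
  assumes "lam > 1" "\<rho> > 0" "\<rho>\<^sup>2 = \<alpha>\<^sup>2 + \<beta>\<^sup>2"
  shows "integral {0..1} (\<lambda>t. q_fun lam s t * sqrt (conorm2 lam \<alpha> \<beta> t)) = \<rho>"
proof -
  let ?n = "\<lambda>t. sqrt (conorm2 lam \<alpha> \<beta> t)"
  have sn: "smooth ?n" by (rule smooth_sqrt[OF smooth_conorm2 conorm2_pos[OF assms]])
  obtain r where r: "0 \<le> r" "r \<le> 1" "\<And>t. conorm2 lam \<alpha> \<beta> t = \<rho>\<^sup>2 * h22 lam (t + r)"
    using conorm2_polar[OF assms(2,3)] by blast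
  have sh: "smooth (\<lambda>t. sqrt (h22 lam t))" by (rule smooth_sqrt[OF smooth_h(3) h22_pos[OF assms(1)]])
  have "?n = (\<lambda>t. \<rho> * sqrt (h22 lam (t + r)))"
    using r(3) assms(2) by (simp add: real_sqrt_mult)
  then have "integral {0..1} ?n = \<rho> * integral {0..1} (\<lambda>t. sqrt (h22 lam (t + r)))" by simp
  also have "integral {0..1} (\<lambda>t. sqrt (h22 lam (t + r))) = kappa lam"
    unfolding kappa_eq
    by (rule integral_shift_periodic[of "\<lambda>t. sqrt (h22 lam t)"]) (use r smooth_continuous_on[OF sh] in \<open>auto simp: h_periodic\<close>)
  finally have 1: "integral {0..1} ?n = \<rho> * kappa lam" .
  define f where "f = (\<lambda>t. sin (2 * pi * t) * ?n t)"
  have sf: "smooth f" unfolding f_def by (intro smooth_intros sn)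
  have "f (t + 1/2) = - f t" for t
  proof -
    have "2 * pi * (t + 1/2) = 2 * pi * t + pi" by (simp add: field_simps)
    then show ?thesis by (simp add: f_def conorm2_def h_half_periodic)
  qed
  then have "integral {0..1} (\<lambda>t. f (t + 1/2)) = - integral {0..1} f" by simp
  moreover have "integral {0..1} (\<lambda>t. f (t + 1/2)) = integral {0..1} f"
    by (rule integral_shift_periodic) (use smooth_continuous_on[OF sf] in \<open>auto simp: f_def trig_shift conorm2_periodic\<close>)
  ultimately have 2: "integral {0..1} f = 0" by simp
  have "(\<lambda>t. q_fun lam s t * ?n t) = (\<lambda>t. inverse (kappa lam) * (?n t + s * f t))"
    by (simp add: q_fun_def f_def fun_eq_iff algebra_simps)
  then have "integral {0..1} (\<lambda>t. q_fun lam s t * ?n t) = inverse (kappa lam) * integral {0..1} (\<lambda>t. ?n t + s * f t)"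
    by simp
  also have "integral {0..1} (\<lambda>t. ?n t + s * f t) = integral {0..1} ?n + integral {0..1} (\<lambda>t. s * f t)"
    by (intro integral_add integrable_continuous_interval smooth_continuous_on sn smooth_mult sf smooth_const)
  also have "\<dots> = \<rho> * kappa lam" by (simp add: 1 2)
  finally show ?thesis using kappa_pos[OF assms(1)] by simp
qed

text \<open>If \<open>\<alpha> = \<beta> = 0\<close>, the calibrating form is \<open>dx dy\<close> up to sign. Otherwise the 1-form with
\<open>w = \<gamma> q n / \<rho>\<close>, where \<open>n\<close> is the length of \<open>\<alpha> dx + \<beta> dy\<close>, is chosen so that its norm is the multiple
\<open>L / \<rho>\<close> of \<open>n\<close>, and the calibrating vector field is its normalised dual.\<close>

lemma stable_norm_g:
  assumes "lam > 1" "0 \<le> s" "s < 1"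
  shows "stable_norm (g_metric lam s) (r_class \<alpha> \<beta> \<gamma>) = ereal (sqrt (\<alpha>\<^sup>2 + \<beta>\<^sup>2 + \<gamma>\<^sup>2))"
proof (cases "\<alpha>\<^sup>2 + \<beta>\<^sup>2 = 0")
  case True
  then have z: "\<alpha> = 0" "\<beta> = 0" by (simp_all add: sum_power2_eq_zero_iff)
  have "stable_norm (g_metric lam s) (r_class 0 0 (integral {0..1} (\<lambda>t::real. \<gamma>))) = ereal \<bar>\<gamma>\<bar>"
  proof (rule stable_norm_calibrated[where a = "h11 lam" and b = "h12 lam" and c = "h22 lam" and q = "q_fun lam s" and G = "g_metric lam s", OF g_metric_block h_det[OF assms(1)] h11_pos[OF assms(1)] q_pos[OF assms], where
      m = "\<lambda>t. \<bar>\<gamma>\<bar>" and ?X1.0 = "\<lambda>t. 0" and ?X2.0 = "\<lambda>t. 0" and ?X3.0 = "sgn \<gamma>"])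
    show "q_fun lam s t * sqrt (h22 lam t * 0\<^sup>2 - 2 * h12 lam t * 0 * 0 + h11 lam t * 0\<^sup>2 + (\<gamma> / q_fun lam s t)\<^sup>2) \<le> \<bar>\<gamma>\<bar>" for t
      using q_pos[OF assms, of t] by (simp add: abs_divide)
  qed (auto simp: smooth_const sgn_if)
  then show ?thesis by (simp add: z)
next
  case False
  define \<rho> where "\<rho> = sqrt (\<alpha>\<^sup>2 + \<beta>\<^sup>2)"
  have \<rho>2: "\<rho>\<^sup>2 = \<alpha>\<^sup>2 + \<beta>\<^sup>2" by (simp add: \<rho>_def)
  have \<rho>: "\<rho> > 0" using False by (simp add: \<rho>_def sum_power2_gt_zero_iff)
  define L where "L = sqrt (\<alpha>\<^sup>2 + \<beta>\<^sup>2 + \<gamma>\<^sup>2)"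
  have L2: "L\<^sup>2 = \<rho>\<^sup>2 + \<gamma>\<^sup>2" by (simp add: L_def \<rho>2)
  have L: "L > 0" using \<rho> L2 by (simp add: L_def \<rho>2[symmetric] add_pos_nonneg)
  let ?q = "q_fun lam s"
  define n where "n = (\<lambda>t. sqrt (conorm2 lam \<alpha> \<beta> t))"
  have n2: "(n t)\<^sup>2 = conorm2 lam \<alpha> \<beta> t" and n: "n t > 0" for t
    using conorm2_pos[OF assms(1) \<rho> \<rho>2, of t] by (simp_all add: n_def)
  have sn: "smooth n" unfolding n_def by (rule smooth_sqrt[OF smooth_conorm2 conorm2_pos[OF assms(1) \<rho> \<rho>2]])
  have np: "n (t + 1) = n t" for t by (simp add: n_def conorm2_periodic)
  have iqn: "integral {0..1} (\<lambda>t. ?q t * n t) = \<rho>"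
    unfolding n_def by (rule integral_q_conorm[OF assms(1) \<rho> \<rho>2])
  have iqnc: "integral {0..1} (\<lambda>t. c * (?q t * n t)) = c * \<rho>" for c
    using iqn by simp
  have q: "?q t > 0" for t by (rule q_pos[OF assms])
  define w where "w = (\<lambda>t. (\<gamma> / \<rho>) * (?q t * n t))"
  have iw: "integral {0..1} w = \<gamma>" unfolding w_def iqnc using \<rho> by simp
  \<comment> \<open>The scalar that normalises the dual of the 1-form: the volume density \<open>q\<close> over its norm \<open>n L / \<rho>\<close>.\<close>
  define k where "k = (\<lambda>t. ?q t * \<rho> / (n t * L))"
  have sk: "smooth k" unfolding k_def
    by (intro smooth_divide smooth_mult smooth_const smooth_q sn) (use n L in \<open>auto simp: less_imp_neq[symmetric]\<close>)
  have kp: "k (t + 1) = k t" for t by (simp add: k_def q_periodic np)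
  have kn: "k t * n t = ?q t * \<rho> / L" for t using n[of t] by (simp add: k_def)
  have "stable_norm (g_metric lam s) (r_class \<alpha> \<beta> (integral {0..1} w)) = ereal L"
  proof (rule stable_norm_calibrated[where a = "h11 lam" and b = "h12 lam" and c = "h22 lam" and q = "q_fun lam s" and G = "g_metric lam s", OF g_metric_block h_det[OF assms(1)] h11_pos[OF assms(1)] q, where
      m = "\<lambda>t. (L / \<rho>) * (?q t * n t)" and ?X1.0 = "\<lambda>t. k t * (h22 lam t * \<alpha> - h12 lam t * \<beta>)"
      and ?X2.0 = "\<lambda>t. k t * (h11 lam t * \<beta> - h12 lam t * \<alpha>)" and ?X3.0 = "\<gamma> / L"])
    show "smooth w" unfolding w_def by (intro smooth_mult smooth_const smooth_q sn)
    show "w (t + 1) = w t" for t by (simp add: w_def q_periodic np)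
    show "smooth (\<lambda>t. (L / \<rho>) * (?q t * n t))" by (intro smooth_mult smooth_const smooth_q sn)
    show "(L / \<rho>) * (?q (t + 1) * n (t + 1)) = (L / \<rho>) * (?q t * n t)" for t by (simp add: q_periodic np)
    show "integral {0..1} (\<lambda>t. (L / \<rho>) * (?q t * n t)) \<le> L" unfolding iqnc using \<rho> by simp
    show "?q t * sqrt (h22 lam t * \<alpha>\<^sup>2 - 2 * h12 lam t * \<alpha> * \<beta> + h11 lam t * \<beta>\<^sup>2 + (w t / ?q t)\<^sup>2)
        \<le> L / \<rho> * (?q t * n t)" for t
    proof -
      have wq: "w t / ?q t = \<gamma> / \<rho> * n t" using q[of t] by (simp add: w_def)
      have "conorm2 lam \<alpha> \<beta> t + (w t / ?q t)\<^sup>2 = (L / \<rho> * n t)\<^sup>2"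
        unfolding n2[symmetric] wq using \<rho> by (simp add: power_mult_distrib power_divide L2 field_simps)
      then have "sqrt (conorm2 lam \<alpha> \<beta> t + (w t / ?q t)\<^sup>2) = L / \<rho> * n t"
        using L \<rho> n[of t] by simp
      then show ?thesis unfolding conorm2_def by (simp add: mult_ac)
    qed
    show "smooth (\<lambda>t. k t * (h22 lam t * \<alpha> - h12 lam t * \<beta>))" "smooth (\<lambda>t. k t * (h11 lam t * \<beta> - h12 lam t * \<alpha>))"
      by (intro smooth_mult sk smooth_diff smooth_h smooth_const)+
    show "k (t + 1) * (h22 lam (t + 1) * \<alpha> - h12 lam (t + 1) * \<beta>) = k t * (h22 lam t * \<alpha> - h12 lam t * \<beta>)"
      "k (t + 1) * (h11 lam (t + 1) * \<beta> - h12 lam (t + 1) * \<alpha>) = k t * (h11 lam t * \<beta> - h12 lam t * \<alpha>)" for t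
      by (simp_all add: kp h_periodic)
    show "h11 lam t * (k t * (h22 lam t * \<alpha> - h12 lam t * \<beta>))\<^sup>2 +
         2 * h12 lam t * (k t * (h22 lam t * \<alpha> - h12 lam t * \<beta>)) * (k t * (h11 lam t * \<beta> - h12 lam t * \<alpha>)) +
         h22 lam t * (k t * (h11 lam t * \<beta> - h12 lam t * \<alpha>))\<^sup>2 + (?q t)\<^sup>2 * (\<gamma> / L)\<^sup>2 \<le> (?q t)\<^sup>2" for t
    proof -
      have "h11 lam t * (k t * (h22 lam t * \<alpha> - h12 lam t * \<beta>))\<^sup>2 +
         2 * h12 lam t * (k t * (h22 lam t * \<alpha> - h12 lam t * \<beta>)) * (k t * (h11 lam t * \<beta> - h12 lam t * \<alpha>)) +
         h22 lam t * (k t * (h11 lam t * \<beta> - h12 lam t * \<alpha>))\<^sup>2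
         = (k t)\<^sup>2 * (h11 lam t * h22 lam t - (h12 lam t)\<^sup>2) * conorm2 lam \<alpha> \<beta> t"
        unfolding conorm2_def by algebra
      also have "\<dots> = (k t * n t)\<^sup>2" unfolding h_det[OF assms(1)] n2[symmetric] by (simp add: power_mult_distrib)
      also have "\<dots> = (?q t)\<^sup>2 * (\<rho>\<^sup>2 / L\<^sup>2)" unfolding kn by (simp add: power_mult_distrib power_divide)
      finally have e: "h11 lam t * (k t * (h22 lam t * \<alpha> - h12 lam t * \<beta>))\<^sup>2 +
         2 * h12 lam t * (k t * (h22 lam t * \<alpha> - h12 lam t * \<beta>)) * (k t * (h11 lam t * \<beta> - h12 lam t * \<alpha>)) +
         h22 lam t * (k t * (h11 lam t * \<beta> - h12 lam t * \<alpha>))\<^sup>2 = (?q t)\<^sup>2 * (\<rho>\<^sup>2 / L\<^sup>2)" .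
      have "\<rho>\<^sup>2 / L\<^sup>2 + \<gamma>\<^sup>2 / L\<^sup>2 = L\<^sup>2 / L\<^sup>2" unfolding L2 add_divide_distrib ..
      then have "\<rho>\<^sup>2 / L\<^sup>2 + \<gamma>\<^sup>2 / L\<^sup>2 = 1" using L by simp
      then have "(?q t)\<^sup>2 * (\<rho>\<^sup>2 / L\<^sup>2) + (?q t)\<^sup>2 * (\<gamma> / L)\<^sup>2 = (?q t)\<^sup>2"
        by (simp only: power_divide distrib_left[symmetric] mult_1_right)
      then show ?thesis unfolding e by simp
    qed
    have "\<alpha> * (k t * (h22 lam t * \<alpha> - h12 lam t * \<beta>)) + \<beta> * (k t * (h11 lam t * \<beta> - h12 lam t * \<alpha>)) + \<gamma> * (\<gamma> / L)
       = (\<rho> / L) * (?q t * n t) + \<gamma>\<^sup>2 / L" for t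
    proof -
      have "\<alpha> * (k t * (h22 lam t * \<alpha> - h12 lam t * \<beta>)) + \<beta> * (k t * (h11 lam t * \<beta> - h12 lam t * \<alpha>))
        = k t * conorm2 lam \<alpha> \<beta> t" unfolding conorm2_def by algebra
      also have "\<dots> = (k t * n t) * n t" unfolding n2[symmetric] by (simp add: power2_eq_square)
      also have "\<dots> = (\<rho> / L) * (?q t * n t)" unfolding kn by simp
      finally show ?thesis by (simp add: power2_eq_square)
    qed
    moreover have "integral {0..1} (\<lambda>t. (\<rho> / L) * (?q t * n t) + \<gamma>\<^sup>2 / L) = (\<rho> / L) * \<rho> + \<gamma>\<^sup>2 / L"
    proof -
      have "integral {0..1} (\<lambda>t. (\<rho> / L) * (?q t * n t) + \<gamma>\<^sup>2 / L)
        = integral {0..1} (\<lambda>t. (\<rho> / L) * (?q t * n t)) + integral {0..1} (\<lambda>t::real. \<gamma>\<^sup>2 / L)"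
        by (intro integral_add integrable_continuous_interval smooth_continuous_on smooth_mult smooth_const smooth_q sn)
      then show ?thesis unfolding iqnc by simp
    qed
    moreover have "(\<rho> / L) * \<rho> + \<gamma>\<^sup>2 / L = L"
      using L L2 by (simp add: field_simps power2_eq_square)
    ultimately show "L \<le> integral {0..1} (\<lambda>t. \<alpha> * (k t * (h22 lam t * \<alpha> - h12 lam t * \<beta>)) +
       \<beta> * (k t * (h11 lam t * \<beta> - h12 lam t * \<alpha>)) + integral {0..1} w * (\<gamma> / L))"
      unfolding iw by simp
  qed
  then show ?thesis unfolding iw L_def .
qed

section \<open>Arc-length coordinate and convergence to the flat metric\<close>

lemma shift_int:
  assumes "\<And>t::real. f (t + 1) = f t + (1::real)"
  shows "f (t + of_int k) = f t + of_int k"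
  using periodic_shift_int[of "\<lambda>t. f t - t" t k] assms by simp

text \<open>Degree one makes the lift of a circle map unbounded in both directions, hence surjective.\<close>

lemma circle_diffeo_inverse:
  fixes f :: "real \<Rightarrow> real"
  assumes f: "smooth f" and pos: "\<And>t. ddir 1 f t > 0" and per: "\<And>t. f (t + 1) = f t + 1"
  defines "g \<equiv> inv f"
  shows "smooth g" "\<And>t. f (g t) = t" "\<And>t. g (f t) = t" "\<And>t. g (t + 1) = g t + 1"
    "\<And>t. ddir 1 g t = inverse (ddir 1 f (g t))"
proof -
  have mono: "strict_mono f"
  proof (rule strict_monoI)
    fix x y :: real assume "x < y"
    then show "f x < f y"
      by (rule DERIV_pos_imp_increasing) (use smooth_has_real_derivative[OF f] pos in blast)
  qed
  then have inj: "inj f" by (rule strict_mono_imp_inj_on)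
  have "\<exists>t. f t = y" for y
  proof -
    \<comment> \<open>The last integer whose image under \<open>f\<close> is not above \<open>y\<close>.\<close>
    let ?k = "\<lfloor>y - f 0\<rfloor>"
    have k: "f (of_int ?k) \<le> y" "y \<le> f (of_int ?k + 1)"
      using shift_int[of f 0 ?k, OF per] per[of "of_int ?k"] by simp_all linarith+
    then show ?thesis
      using IVT'[of f "of_int ?k" y "of_int ?k + 1"] smooth_continuous_on[OF f] by auto
  qed
  then have surj: "surj f" by (metis surj_def)
  show fg: "f (g t) = t" for t unfolding g_def by (rule surj_f_inv_f[OF surj])
  show gf: "g (f t) = t" for t unfolding g_def by (rule inv_f_f[OF inj])
  show sg: "smooth g" by (rule smooth_inverse_function[OF f pos fg gf])
  show "g (t + 1) = g t + 1" for t
    using gf[of "g t + 1"] by (simp add: per fg)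
  show "ddir 1 g t = inverse (ddir 1 f (g t))" for t
  proof -
    have "((\<lambda>t. f (g t)) has_real_derivative ddir 1 f (g t) * ddir 1 g t) (at t)"
      by (rule DERIV_chain2[OF smooth_has_real_derivative[OF f] smooth_has_real_derivative[OF sg]])
    then have "ddir 1 f (g t) * ddir 1 g t = 1"
      unfolding fg using DERIV_unique DERIV_ident by blast
    then show ?thesis using pos[of "g t"] by (simp add: field_simps)
  qed
qed

text \<open>Reparametrisation of the circle factor by \<open>f\<close>.\<close>

definition base_map :: "(real \<Rightarrow> real) \<Rightarrow> real^3 \<Rightarrow> real^3" where
  "base_map f p = vector [p $ 1, p $ 2, f (p $ 3)]"

lemma base_map_nth [simp]: "base_map f p $ 1 = p $ 1" "base_map f p $ 2 = p $ 2" "base_map f p $ 3 = f (p $ 3)"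
  by (simp_all add: base_map_def vector_3)

lemma smooth_base_map: "smooth f \<Longrightarrow> smooth (base_map f)"
proof (rule smooth_vecI)
  fix i assume "smooth f"
  then show "smooth (\<lambda>x. base_map f x $ i)"
    using exhaust_3[of i] smooth_nth3 smooth_of_t[of f] by (elim disjE) simp_all
qed

lemma base_map_compose: "(\<And>t. f (g t) = t) \<Longrightarrow> base_map f (base_map g p) = p"
  by (simp add: vec_eq_iff forall_3)

lemma base_map_lattice:
  assumes "\<And>t. f (t + 1) = f t + 1" "v \<in> lattice3"
  shows "base_map f (x + v) = base_map f x + v"
proof -
  obtain k where "v $ 3 = of_int k" using assms(2) by (auto simp: lattice3_def Ints_def)
  then show ?thesis using shift_int[of f "x $ 3" k, OF assms(1)] by (simp add: vec_eq_iff forall_3)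
qed

lemma torus_map_base_map:
  assumes "smooth f" "\<And>t. f (t + 1) = f t + 1"
  shows "torus_map (base_map f)"
  unfolding torus_map_def using smooth_base_map[OF assms(1)] base_map_lattice[of f, OF assms(2)] by simp

lemma zero_lattice: "0 \<in> lattice3" by (simp add: lattice3_def)

lemma torus_diffeo_base_map:
  assumes "smooth f" "\<And>t. ddir 1 f t > 0" "\<And>t. f (t + 1) = f t + 1"
  shows "torus_diffeo (base_map f)"
proof -
  note g = circle_diffeo_inverse[OF assms]
  show ?thesis unfolding torus_diffeo_def
    using torus_map_base_map[OF assms(1,3)] torus_map_base_map[OF g(1,4)] base_map_compose[of f "inv f"] base_map_compose[of "inv f" f] g(2,3)
    by (intro conjI exI[of _ "base_map (inv f)"]) (simp_all add: zero_lattice)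
qed

text \<open>Increasing maps that commute with the unit translation form a convex set, so the straight line from
the identity to \<open>f\<close> consists of diffeomorphisms.\<close>

lemma isotopic_base_map:
  assumes f: "smooth f" "\<And>t. ddir 1 f t > 0" "\<And>t. f (t + 1) = f t + 1"
  shows "isotopic_to_id (base_map f)"
proof -
  define H :: "real \<times> (real^3) \<Rightarrow> real^3" where
    "H = (\<lambda>(u, x). base_map (\<lambda>t. (1 - u) * t + u * f t) x)"
  have "smooth (\<lambda>z. H z $ i)" for i
  proof -
    have c: "smooth (\<lambda>z::real \<times> (real^3). snd z $ j)" for j by (intro smooth_intros)
    have "smooth (\<lambda>z::real \<times> (real^3). (1 - fst z) * (snd z $ 3) + fst z * f (snd z $ 3))"
      by (intro smooth_add smooth_mult smooth_diff smooth_const smooth_fst smooth_id c smooth_compose[OF f(1) c])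
    then show ?thesis
      using exhaust_3[of i] c by (elim disjE) (simp_all add: H_def split_beta)
  qed
  then have "smooth H" by (rule smooth_vecI)
  moreover have "torus_diffeo (\<lambda>x. H (u, x))" if u: "u \<in> {0..1}" for u
  proof -
    let ?k = "\<lambda>t. (1 - u) * t + u * f t"
    have sk: "smooth ?k" by (intro smooth_intros f)
    have "(?k has_real_derivative (1 - u) * 1 + u * ddir 1 f t) (at t)" for t
      by (auto intro!: derivative_eq_intros smooth_has_real_derivative[OF f(1)])
    then have d: "ddir 1 ?k t = (1 - u) + u * ddir 1 f t" for t
      using DERIV_unique[OF smooth_has_real_derivative[OF sk]] by simp
    have p: "(1 - u) + u * ddir 1 f t > 0" for t
      using u f(2)[of t] by (cases "u = 0") (auto intro!: add_nonneg_pos)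
    have "ddir 1 ?k t > 0" for t by (simp only: d p)
    then have "torus_diffeo (base_map ?k)"
      by (intro torus_diffeo_base_map sk) (simp_all add: f(3) algebra_simps)
    then show ?thesis by (simp add: H_def base_map_def[abs_def])
  qed
  moreover have "H (0, x) = x" "H (1, x) = base_map f x" for x
    by (simp_all add: H_def vec_eq_iff forall_3)
  ultimately show ?thesis unfolding isotopic_to_id_def
    by (intro exI[of _ H]) (simp add: zero_lattice)
qed

lemma matrix_frechet_nth:
  fixes F :: "real^3 \<Rightarrow> real^3"
  assumes "smooth F"
  shows "matrix (frechet_derivative F (at x)) $ i $ j = pd j (\<lambda>y. F y $ i) x"
proof -
  have "pd j (\<lambda>y. F y $ i) x = pd j F x $ i" by (simp add: ddir_vec_nth[OF assms])
  then show ?thesis by (simp add: matrix_def ddir_def)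
qed

lemma pullback_base_map:
  assumes f: "smooth f" and g: "\<And>p. g p = block (a (p$3)) (b (p$3)) (c (p$3)) (d (p$3))"
  shows "pullback_metric (base_map f) g p =
     block (a (f (p$3))) (b (f (p$3))) (c (f (p$3))) (d (f (p$3)) * (ddir 1 f (p$3))\<^sup>2)"
proof -
  have n: "pd j (\<lambda>y::real^3. y $ i) = (\<lambda>x. if i = j then 1 else 0)" for i j
  proof -
    have "((\<lambda>y::real^3. y $ i) has_derivative (\<lambda>v. v $ i)) (at x)" for x
      by (rule bounded_linear_imp_has_derivative[OF bounded_linear_vec_nth])
    from ddir_eqI[OF this] show ?thesis by (auto simp: axis_def)
  qed
  have J: "matrix (frechet_derivative (base_map f) (at p)) = block 1 0 1 (ddir 1 f (p$3))"
    unfolding vec_eq_iff forall_3 matrix_frechet_nth[OF smooth_base_map[OF f]]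
    using pd_of_t[OF smooth_has_real_derivative[OF f]] by (simp add: n)
  show ?thesis unfolding pullback_metric_def Let_def g J transpose_block
    by (simp add: matrix_matrix_mult_def sum_3 vec_eq_iff forall_3 power2_eq_square)
qed

text \<open>The length of the \<open>t\<close>-circle from \<open>0\<close> to \<open>t\<close> in units of the total length, which is the integral of
\<open>1 + s sin (2 pi t)\<close>; it does not depend on \<open>lam\<close>.\<close>

definition arc_len :: "real \<Rightarrow> real \<Rightarrow> real" where
  "arc_len s t = t + s * (1 - cos (2 * pi * t)) / (2 * pi)"

lemma smooth_arc_len: "smooth (arc_len s)"
  unfolding arc_len_def[abs_def] by (intro smooth_intros) auto

lemma ddir_arc_len: "ddir 1 (arc_len s) t = 1 + s * sin (2 * pi * t)"
proof -
  have "(arc_len s has_real_derivative 1 + s * sin (2 * pi * t)) (at t)"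
    unfolding arc_len_def[abs_def] by (auto intro!: derivative_eq_intros simp: field_simps)
  then show ?thesis using DERIV_unique smooth_has_real_derivative[OF smooth_arc_len] by blast
qed

lemma arc_len_shift: "arc_len s (t + 1) = arc_len s t + 1"
  unfolding arc_len_def trig_shift by simp

definition psi :: "real \<Rightarrow> real \<Rightarrow> real" where "psi s = inv (arc_len s)"

lemma psi:
  assumes "0 \<le> s" "s < 1"
  shows "smooth (psi s)" "arc_len s (psi s t) = t" "psi s (arc_len s t) = t" "psi s (t + 1) = psi s t + 1"
    "ddir 1 (psi s) t = inverse (1 + s * sin (2 * pi * psi s t))" "ddir 1 (psi s) t > 0"
proof -
  have "ddir 1 (arc_len s) t > 0" for t unfolding ddir_arc_len by (rule speed_pos[OF assms])
  note * = circle_diffeo_inverse[OF smooth_arc_len this arc_len_shift, folded psi_def]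
  show "smooth (psi s)" "arc_len s (psi s t) = t" "psi s (arc_len s t) = t" "psi s (t + 1) = psi s t + 1" using * by auto
  show d: "ddir 1 (psi s) t = inverse (1 + s * sin (2 * pi * psi s t))" using *(5) by (simp add: ddir_arc_len)
  show "ddir 1 (psi s) t > 0" unfolding d using speed_pos[OF assms] by simp
qed

text \<open>The metric in the arc-length coordinate.\<close>

definition arc_metric :: "real \<Rightarrow> real \<Rightarrow> real^3 \<Rightarrow> real^3^3" where
  "arc_metric lam s p = block (h11 lam (psi s (p$3))) (h12 lam (psi s (p$3))) (h22 lam (psi s (p$3))) ((inverse (kappa lam))\<^sup>2)"

lemma pullback_psi:
  assumes "0 \<le> s" "s < 1"
  shows "pullback_metric (base_map (psi s)) (g_metric lam s) = arc_metric lam s"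
proof
  fix p :: "real^3"
  have nz: "1 + s * sin (2 * pi * psi s (p$3)) \<noteq> 0"
    using speed_pos[OF assms, of "2 * pi * psi s (p$3)"] by simp
  have "q_fun lam s (psi s (p$3)) * ddir 1 (psi s) (p$3) = inverse (kappa lam)"
    unfolding psi(5)[OF assms] q_fun_def using nz by (simp add: field_simps)
  then have "(q_fun lam s (psi s (p$3)))\<^sup>2 * (ddir 1 (psi s) (p$3))\<^sup>2 = (inverse (kappa lam))\<^sup>2"
    by (simp flip: power_mult_distrib)
  then show "pullback_metric (base_map (psi s)) (g_metric lam s) p = arc_metric lam s p"
    using pullback_base_map[where a = "h11 lam" and b = "h12 lam" and c = "h22 lam" and d = "\<lambda>t. (q_fun lam s t)\<^sup>2"
        and g = "g_metric lam s" and p = p, OF psi(1)[OF assms] g_metric_block]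
    unfolding arc_metric_def by simp
qed

lemma dirs_add_scaleR:
  assumes "smooth f" "smooth A" "set vs \<subseteq> Basis"
  shows "dirs vs (\<lambda>x. f x + c *\<^sub>R A x) = (\<lambda>x. dirs vs f x + c *\<^sub>R dirs vs A x)"
  using assms(3)
proof (induction vs)
  case (Cons v vs)
  have "((\<lambda>x. dirs vs f x + c *\<^sub>R dirs vs A x) has_derivative
     (\<lambda>u. ddir u (dirs vs f) x + c *\<^sub>R ddir u (dirs vs A) x)) (at x)" for x
    by (intro has_derivative_add has_derivative_scaleR_right smooth_has_derivative smooth_dirs assms) (use Cons in auto)
  from ddir_eqI[OF this] show ?case using Cons by (simp add: dirs_Cons)
qed simp

text \<open>A smooth periodic tensor has bounded derivatives of every order, so that a scalar factor tending to
zero makes all of them tend to zero uniformly.\<close>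

lemma Cinf_tendsto_add_scaleR:
  fixes f :: "'p \<Rightarrow> real^3 \<Rightarrow> 'b::real_normed_vector"
  assumes f: "Cinf_tendsto f f0 Fl" and A: "smooth A" "periodic A" and c: "(c \<longlongrightarrow> 0) Fl"
  shows "Cinf_tendsto (\<lambda>p x. f p x + c p *\<^sub>R A x) f0 Fl"
proof -
  have sf: "\<forall>\<^sub>F p in Fl. smooth (f p)" and s0: "smooth f0" using f by (auto simp: Cinf_tendsto_def)
  have "uniform_limit UNIV (\<lambda>p. dirs vs (\<lambda>x. f p x + c p *\<^sub>R A x)) (dirs vs f0) Fl" if vs: "set vs \<subseteq> Basis" for vs
  proof -
    obtain B where B: "\<And>x. norm (dirs vs A x) \<le> B"
      using periodic_bounded[OF smooth_continuous_on[OF smooth_dirs[OF A(1) vs]] periodic_dirs[OF A vs]] by blast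
    have B0: "0 \<le> B" using B[of 0] norm_ge_zero[of "dirs vs A 0"] by linarith
    have "uniform_limit UNIV (\<lambda>p x. c p *\<^sub>R dirs vs A x) (\<lambda>x. 0) Fl"
    proof (rule uniform_limitI)
      fix e :: real assume e: "e > 0"
      have "e / (B + 1) > 0" using e B0 by simp
      with c have "\<forall>\<^sub>F p in Fl. dist (c p) 0 < e / (B + 1)" by (rule tendstoD)
      then show "\<forall>\<^sub>F p in Fl. \<forall>x\<in>UNIV. dist (c p *\<^sub>R dirs vs A x) 0 < e"
      proof eventually_elim
        case (elim p)
        have "\<bar>c p\<bar> * norm (dirs vs A x) < e" for x
        proof -
          have "\<bar>c p\<bar> * norm (dirs vs A x) \<le> \<bar>c p\<bar> * (B + 1)" using B[of x] by (intro mult_left_mono) auto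
          also have "\<dots> < e" using elim B0 by (simp add: dist_real_def field_simps)
          finally show ?thesis .
        qed
        then show ?case by simp
      qed
    qed
    moreover have "uniform_limit UNIV (\<lambda>p. dirs vs (f p)) (dirs vs f0) Fl"
      using f vs by (simp add: Cinf_tendsto_def)
    ultimately have ul: "uniform_limit UNIV (\<lambda>p x. dirs vs (f p) x + c p *\<^sub>R dirs vs A x) (\<lambda>x. dirs vs f0 x + 0) Fl"
      by (intro uniform_limit_add)
    have ev: "\<forall>\<^sub>F p in Fl. \<forall>x\<in>UNIV. dirs vs (f p) x + c p *\<^sub>R dirs vs A x = dirs vs (\<lambda>x. f p x + c p *\<^sub>R A x) x"
      using sf by eventually_elim (simp add: dirs_add_scaleR[OF _ A(1) vs])
    show ?thesis
      using uniform_limit_cong[OF ev, of "\<lambda>x. dirs vs f0 x + 0" "dirs vs f0"] ul by simp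
  qed
  moreover have "\<forall>\<^sub>F p in Fl. smooth (\<lambda>x. f p x + c p *\<^sub>R A x)"
    using sf by eventually_elim (intro smooth_add smooth_scaleR smooth_const A)
  ultimately show ?thesis using s0 by (simp add: Cinf_tendsto_def)
qed

text \<open>The entries of \<open>h\<close> involve \<open>lam\<close> only through \<open>mean lam\<close> and \<open>ecc lam\<close>, which tend to 1 and 0, and \<open>kappa lam\<close>
tends to 1 by its bounds.\<close>

lemma arc_metric_converges:
  assumes s: "0 \<le> s" "s < 1"
  shows "Cinf_tendsto (\<lambda>lam. arc_metric lam s) euclidean_metric (at_right 1)"
proof -
  let ?C = "\<lambda>t. cos (4 * pi * psi s t)" and ?S = "\<lambda>t. sin (4 * pi * psi s t)"
  let ?A = "\<lambda>_::real^3. block 1 0 1 0"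
  let ?B = "\<lambda>p::real^3. block (?C (p$3)) (- ?S (p$3)) (- ?C (p$3)) 0"
  let ?D = "\<lambda>_::real^3. block 0 0 0 1"
  have eq: "arc_metric lam s = (\<lambda>x. ((euclidean_metric x + (mean lam - 1) *\<^sub>R ?A x) + ecc lam *\<^sub>R ?B x)
     + ((inverse (kappa lam))\<^sup>2 - 1) *\<^sub>R ?D x)" for lam
    unfolding arc_metric_def[abs_def] euclidean_metric_def mat1_block
    by (simp add: fun_eq_iff vec_eq_iff forall_3 h11_def h12_def h22_def)
  have sC: "smooth ?C" "smooth ?S" by (intro smooth_intros psi(1)[OF s])+
  have pC: "?C (t + 1) = ?C t" "?S (t + 1) = ?S t" for t
    by (simp_all add: psi(4)[OF s] trig_shift)
  have const: "smooth (\<lambda>_. c :: real^3^3)" "periodic (\<lambda>_. c :: real^3^3)" for c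
    by (simp_all add: smooth_const periodic_def)
  have sB: "smooth ?B" by (intro smooth_block smooth_of_t[of ?C] smooth_minus smooth_of_t[of ?S] sC smooth_const)
  have pB: "periodic ?B"
    by (rule periodic_of_t[of "\<lambda>t. block (?C t) (- ?S t) (- ?C t) 0"]) (simp add: pC)
  have m: "((\<lambda>lam. mean lam - 1) \<longlongrightarrow> 0) (at_right 1)"
    unfolding mean_def by (auto intro!: tendsto_eq_intros)
  have e: "(ecc \<longlongrightarrow> 0) (at_right 1)"
    unfolding ecc_def[abs_def] by (auto intro!: tendsto_eq_intros)
  have "(kappa \<longlongrightarrow> 1) (at_right 1)"
  proof (rule tendsto_sandwich)
    show "\<forall>\<^sub>F lam in at_right 1. 1 / lam \<le> kappa lam" "\<forall>\<^sub>F lam in at_right 1. kappa lam \<le> lam"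
      using kappa_bounds by (auto simp: eventually_at_right_field intro!: exI[of _ 2])
    show "((\<lambda>lam::real. 1 / lam) \<longlongrightarrow> 1) (at_right 1)" "((\<lambda>lam::real. lam) \<longlongrightarrow> 1) (at_right 1)"
      by (auto intro!: tendsto_eq_intros)
  qed
  then have k: "((\<lambda>lam. (inverse (kappa lam))\<^sup>2 - 1) \<longlongrightarrow> 0) (at_right 1)"
    by (auto intro!: tendsto_eq_intros)
  have 0: "Cinf_tendsto (\<lambda>_::real. euclidean_metric) euclidean_metric (at_right 1)"
    using const unfolding Cinf_tendsto_def euclidean_metric_def by (simp add: uniform_limit_const)
  show ?thesis unfolding eq
    by (intro Cinf_tendsto_add_scaleR const sB pB m e k 0)
qed

section \<open>Isometries\<close>

lemma matrix_frechet:
  fixes F :: "real^3 \<Rightarrow> real^3"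
  assumes "smooth F"
  shows "matrix (frechet_derivative F (at x)) *v u = ddir u F x"
proof -
  have "linear (frechet_derivative F (at x))"
    using smooth_has_derivative[OF assms, of x] has_derivative_linear unfolding ddir_def by blast
  then show ?thesis using fun_cong[OF matrix_vector_mul(2), of _ u] by (simp add: ddir_def)
qed

text \<open>Pullbacks are handled through their values on pairs of vectors, which turns the matrix formula into
the statement that \<open>dF\<close> preserves inner products.\<close>

lemma quad_pullback:
  assumes "smooth F"
  shows "u \<bullet> (pullback_metric F g x *v v) = ddir u F x \<bullet> (g (F x) *v ddir v F x)"
proof -
  let ?J = "matrix (frechet_derivative F (at x))"
  have "u \<bullet> (pullback_metric F g x *v v) = u \<bullet> (transpose ?J *v (g (F x) *v (?J *v v)))"
    unfolding pullback_metric_def Let_def by (simp add: matrix_vector_mul_assoc matrix_mul_assoc)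
  also have "\<dots> = (?J *v u) \<bullet> (g (F x) *v (?J *v v))"
    by (metis dot_lmul_matrix inner_commute transpose_matrix_vector)
  finally show ?thesis unfolding matrix_frechet[OF assms] .
qed

lemma ddir_compose:
  fixes F G :: "real^3 \<Rightarrow> real^3"
  assumes "smooth F" "smooth G"
  shows "ddir u (\<lambda>x. F (G x)) x = ddir (ddir u G x) F (G x)"
  using fun_cong[OF ddir_eqI[OF has_derivative_compose[OF smooth_has_derivative[OF assms(2)] smooth_has_derivative[OF assms(1)]]]]
  by blast

lemma mat_eq_quad:
  fixes A B :: "real^'n^'n"
  assumes "\<And>u v. u \<bullet> (A *v v) = u \<bullet> (B *v v)" shows "A = B"
proof -
  have "A *v v = B *v v" for v using assms by (metis vector_eq_ldot)
  then show ?thesis by (simp add: matrix_eq)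
qed

lemma pullback_compose:
  assumes "smooth F" "smooth G"
  shows "pullback_metric (\<lambda>x. F (G x)) g = pullback_metric G (pullback_metric F g)"
proof
  fix x
  show "pullback_metric (\<lambda>x. F (G x)) g x = pullback_metric G (pullback_metric F g) x"
  proof (rule mat_eq_quad)
    fix u v
    show "u \<bullet> (pullback_metric (\<lambda>x. F (G x)) g x *v v) = u \<bullet> (pullback_metric G (pullback_metric F g) x *v v)"
      unfolding quad_pullback[OF assms(2)] quad_pullback[OF assms(1)] quad_pullback[OF smooth_compose[OF assms]]
        ddir_compose[OF assms] ..
  qed
qed

lemma pullback_id: "pullback_metric (\<lambda>x. x) g = g"
proof
  fix x
  have "ddir u (\<lambda>x::real^3. x) x = u" for u
    using fun_cong[OF ddir_eqI[OF has_derivative_ident], of u x] by simp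
  then show "pullback_metric (\<lambda>x. x) g x = g x"
    by (intro mat_eq_quad) (simp add: quad_pullback[OF smooth_id])
qed

lemma torus_map_compose:
  assumes F: "torus_map F" and G: "torus_map G"
  shows "torus_map (\<lambda>x. F (G x))"
  unfolding torus_map_def
proof (intro conjI allI ballI)
  show "smooth (\<lambda>x. F (G x))" using assms by (auto simp: torus_map_def intro: smooth_compose)
  fix x v :: "real^3" assume v: "v \<in> lattice3"
  then have "G (x + v) - G x \<in> lattice3" using G by (simp add: torus_map_def)
  then have "F (G x + (G (x + v) - G x)) - F (G x) \<in> lattice3" using F unfolding torus_map_def by blast
  then show "F (G (x + v)) - F (G x) \<in> lattice3" by simp
qed

text \<open>Conjugation with the arc-length substitutions.\<close>

lemma isometric_arc_metric:
  assumes s: "0 \<le> s" "s < 1" and s': "0 \<le> s'" "s' < 1"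
    and iso: "isometric_metrics (g_metric lam s) (g_metric lam s')"
  obtains F where "torus_map F" "pullback_metric F (arc_metric lam s') = arc_metric lam s"
proof -
  obtain F where F: "torus_map F" "pullback_metric F (g_metric lam s') = g_metric lam s"
    using iso unfolding isometric_metrics_def torus_diffeo_def by blast
  note p = psi[OF s] and p' = psi[OF s']
  let ?G = "\<lambda>x. base_map (arc_len s') (F (base_map (psi s) x))"
  have sF: "smooth F" using F by (simp add: torus_map_def)
  have "pullback_metric (base_map (arc_len s')) (arc_metric lam s') = pullback_metric (\<lambda>x. base_map (psi s') (base_map (arc_len s') x)) (g_metric lam s')"
    unfolding pullback_psi[OF s', symmetric] by (rule pullback_compose[symmetric]) (intro smooth_base_map p' smooth_arc_len)+
  also have "(\<lambda>x. base_map (psi s') (base_map (arc_len s') x)) = (\<lambda>x. x)"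
    using base_map_compose[of "psi s'" "arc_len s'"] p'(3) by simp
  finally have 1: "pullback_metric (base_map (arc_len s')) (arc_metric lam s') = g_metric lam s'" by (simp add: pullback_id)
  have "pullback_metric ?G (arc_metric lam s') = pullback_metric (\<lambda>x. F (base_map (psi s) x)) (pullback_metric (base_map (arc_len s')) (arc_metric lam s'))"
    by (intro pullback_compose smooth_compose[OF sF] smooth_base_map smooth_arc_len p)
  also have "\<dots> = pullback_metric (base_map (psi s)) (pullback_metric F (g_metric lam s'))"
    unfolding 1 by (intro pullback_compose sF smooth_base_map p)
  also have "\<dots> = arc_metric lam s" unfolding F(2) by (rule pullback_psi[OF s])
  finally have "pullback_metric ?G (arc_metric lam s') = arc_metric lam s" .
  moreover have "torus_map ?G"
    by (rule torus_map_compose[OF torus_map_base_map[OF smooth_arc_len arc_len_shift] torus_map_compose[OF F(1) torus_map_base_map[OF p(1,4)]]])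
  ultimately show ?thesis using that by blast
qed

definition k11 where "k11 lam s t = h11 lam (psi s t)"
definition k12 where "k12 lam s t = h12 lam (psi s t)"
definition k22 where "k22 lam s t = h22 lam (psi s t)"
text \<open>The rate of rotation of the metric in the arc-length coordinate; the derivatives of the entries of
\<open>arc_metric\<close> are \<open>twist\<close> times a cosine or a sine.\<close>

definition twist where "twist lam s t = 4 * pi * ecc lam * ddir 1 (psi s) t"
definition cos_arc where "cos_arc s t = cos (4 * pi * psi s t)"
definition sin_arc where "sin_arc s t = sin (4 * pi * psi s t)"
definition arc_metric_diff :: "real \<Rightarrow> real \<Rightarrow> real^3 \<Rightarrow> real^3^3" where
  "arc_metric_diff lam s p = block (- twist lam s (p$3) * sin_arc s (p$3)) (- twist lam s (p$3) * cos_arc s (p$3)) (twist lam s (p$3) * sin_arc s (p$3)) 0"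

lemma arc_metric_k: "arc_metric lam s p = block (k11 lam s (p$3)) (k12 lam s (p$3)) (k22 lam s (p$3)) ((inverse (kappa lam))\<^sup>2)"
  by (simp add: arc_metric_def k11_def k12_def k22_def)

lemma k_eq: "k11 lam s t = mean lam + ecc lam * cos_arc s t" "k12 lam s t = - ecc lam * sin_arc s t" "k22 lam s t = mean lam - ecc lam * cos_arc s t"
  by (simp_all add: k11_def k12_def k22_def h11_def h12_def h22_def cos_arc_def sin_arc_def)

lemma cos_sin_arc: "(cos_arc s t)\<^sup>2 + (sin_arc s t)\<^sup>2 = 1" by (simp add: cos_arc_def sin_arc_def)

lemma k_deriv:
  assumes "0 \<le> s" "s < 1"
  shows "(k11 lam s has_real_derivative - twist lam s t * sin_arc s t) (at t)"
    "(k12 lam s has_real_derivative - twist lam s t * cos_arc s t) (at t)"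
    "(k22 lam s has_real_derivative twist lam s t * sin_arc s t) (at t)"
  unfolding k11_def[abs_def] k12_def[abs_def] k22_def[abs_def] h11_def h12_def h22_def twist_def cos_arc_def sin_arc_def
  by (auto intro!: derivative_eq_intros smooth_has_real_derivative[OF psi(1)[OF assms]])

lemma k_det: "lam > 1 \<Longrightarrow> k11 lam s t * k22 lam s t - (k12 lam s t)\<^sup>2 = 1"
  unfolding k11_def k12_def k22_def by (rule h_det)

lemma smooth_k:
  assumes "0 \<le> s" "s < 1"
  shows "smooth (k11 lam s)" "smooth (k12 lam s)" "smooth (k22 lam s)"
  unfolding k11_def[abs_def] k12_def[abs_def] k22_def[abs_def]
  by (intro smooth_compose[OF smooth_h(1)] smooth_compose[OF smooth_h(2)] smooth_compose[OF smooth_h(3)] psi[OF assms])+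

lemma k_periodic:
  assumes "0 \<le> s" "s < 1"
  shows "k11 lam s (t + 1) = k11 lam s t" "k12 lam s (t + 1) = k12 lam s t" "k22 lam s (t + 1) = k22 lam s t"
  unfolding k11_def k12_def k22_def psi(4)[OF assms] h_periodic by auto

lemma arc_metric_deriv:
  assumes "0 \<le> s" "s < 1"
  shows "((\<lambda>x. u \<bullet> (arc_metric lam s x *v v)) has_derivative (\<lambda>w. w $ 3 * (u \<bullet> (arc_metric_diff lam s x *v v)))) (at x)"
proof -
  have d: "((\<lambda>x. f (x $ 3)) has_derivative (\<lambda>w. D * w $ 3)) (at x)"
    if "(f has_real_derivative D) (at (x $ 3))" for f D
    by (rule has_derivative_compose[OF bounded_linear_imp_has_derivative[OF bounded_linear_vec_nth] that[unfolded has_field_derivative_def]])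
  show ?thesis unfolding arc_metric_k arc_metric_diff_def quad_block
    by (rule has_derivative_eq_rhs, (rule d k_deriv[OF assms] has_derivative_add has_derivative_mult_left has_derivative_const)+)
       (auto simp: fun_eq_iff algebra_simps)
qed

text \<open>The columns of \<open>E\<close> are orthonormal for \<open>G\<close>.\<close>

definition frame :: "real^3^3 \<Rightarrow> real^3^3 \<Rightarrow> bool" where
  "frame G E \<longleftrightarrow> transpose E ** G ** E = mat 1"

text \<open>An orthonormal frame resolves the inverse metric; sums over a frame thus become contractions with
the inverse metric.\<close>

lemma frame_inverse:
  assumes "frame (block a b c d) E" "a * c - b\<^sup>2 = 1" "d \<noteq> 0"
  shows "E ** transpose E = block c (-b) a (1 / d)"
proof -
  let ?G = "block a b c d"
  have "E ** (transpose E ** ?G) = mat 1"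
    using assms(1) unfolding frame_def by (simp add: matrix_left_right_inverse)
  then have 1: "(E ** transpose E) ** ?G = mat 1" by (simp add: matrix_mul_assoc)
  then have "?G ** (E ** transpose E) = mat 1" by (simp add: matrix_left_right_inverse)
  then show ?thesis using matrix_inv_unique[OF _ 1] matrix_inv_block[OF assms(2,3)] by simp
qed

lemma arc_metric_frame_inverse:
  assumes "lam > 1" "frame (arc_metric lam s y) E"
  shows "E ** transpose E = block (k22 lam s (y$3)) (- k12 lam s (y$3)) (k11 lam s (y$3)) ((kappa lam)\<^sup>2)"
proof -
  have "1 / (inverse (kappa lam))\<^sup>2 = (kappa lam)\<^sup>2" by (simp add: power_inverse divide_inverse)
  then show ?thesis
    using frame_inverse[OF assms(2)[unfolded arc_metric_k] k_det[OF assms(1)]] kappa_pos[OF assms(1)] by simp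
qed

lemma arc_metric_frame_exists:
  assumes "lam > 1"
  obtains E where "frame (arc_metric lam s x) E"
proof -
  let ?F = "block_root (k11 lam s (x$3)) (k12 lam s (x$3)) (inverse (kappa lam))"
  have a: "k11 lam s (x$3) > 0" unfolding k11_def by (rule h11_pos[OF assms])
  note f = block_root[OF k_det[OF assms] a, of "inverse (kappa lam)"]
  have "invertible ?F" using f(2) kappa_pos[OF assms] by (simp add: invertible_det_nz)
  then obtain E where E: "?F ** E = mat 1" by (auto simp: invertible_def)
  have "transpose E ** arc_metric lam s x ** E = transpose (?F ** E) ** (?F ** E)"
    unfolding arc_metric_k f(1) by (simp add: matrix_transpose_mul matrix_mul_assoc)
  then show ?thesis using that unfolding frame_def E by simp
qed

text \<open>The contraction of the Christoffel symbols with the metric, which is the Laplacian of the coordinate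
functions up to sign and index lowering, vanishes: the inverse metric has no mixed entries with
index 3, and the trace of \<open>h\<^sup>-\<^sup>1 dh/dt\<close> is the logarithmic derivative of \<open>det h = 1\<close>.\<close>

lemma arc_metric_frame_cancel:
  assumes "lam > 1" "frame (arc_metric lam s y) E"
  shows "(\<Sum>a\<in>UNIV. E$3$a * (column a E \<bullet> (arc_metric_diff lam s y *v v)) - (1/2) * (v$3 * (column a E \<bullet> (arc_metric_diff lam s y *v column a E)))) = 0"
proof -
  let ?a = "k11 lam s (y$3)" and ?b = "k12 lam s (y$3)" and ?c = "k22 lam s (y$3)"
  let ?a' = "- twist lam s (y$3) * sin_arc s (y$3)" and ?b' = "- twist lam s (y$3) * cos_arc s (y$3)" and ?c' = "twist lam s (y$3) * sin_arc s (y$3)"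
  have ent: "E$i$1 * E$j$1 + E$i$2 * E$j$2 + E$i$3 * E$j$3 = block ?c (- ?b) ?a ((kappa lam)\<^sup>2) $ i $ j" for i j
    unfolding arc_metric_frame_inverse[OF assms, symmetric] by (simp add: matrix_matrix_mult_def transpose_def sum_3)
  have tr: "?c * ?a' - 2 * ?b * ?b' + ?a * ?c' = 0"
    unfolding k_eq by algebra
  have "2 * (\<Sum>a\<in>UNIV. E$3$a * (column a E \<bullet> (arc_metric_diff lam s y *v v)) - (1/2) * (v$3 * (column a E \<bullet> (arc_metric_diff lam s y *v column a E)))) =
     2 * (E$3$1 * E$1$1 + E$3$2 * E$1$2 + E$3$3 * E$1$3) * (?a' * v$1 + ?b' * v$2)
   + 2 * (E$3$1 * E$2$1 + E$3$2 * E$2$2 + E$3$3 * E$2$3) * (?b' * v$1 + ?c' * v$2)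
   - v$3 * ((E$1$1 * E$1$1 + E$1$2 * E$1$2 + E$1$3 * E$1$3) * ?a' + 2 * ?b' * (E$1$1 * E$2$1 + E$1$2 * E$2$2 + E$1$3 * E$2$3)
      + ?c' * (E$2$1 * E$2$1 + E$2$2 * E$2$2 + E$2$3 * E$2$3))"
    unfolding arc_metric_diff_def quad_block sum_3 column_def by (simp add: algebra_simps)
  also have "\<dots> = - (v$3 * (?c * ?a' - 2 * ?b * ?b' + ?a * ?c'))"
    unfolding ent by (simp add: algebra_simps)
  finally show ?thesis unfolding tr by simp
qed

lemma frame_push:
  assumes "smooth F" "frame (pullback_metric F g x) E"
  shows "frame (g (F x)) (matrix (frechet_derivative F (at x)) ** E)"
  using assms unfolding frame_def pullback_metric_def Let_def
  by (simp add: matrix_transpose_mul matrix_mul_assoc)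

lemma ddir_commute_vec:
  fixes F :: "real^3 \<Rightarrow> real^3"
  assumes "smooth F"
  shows "ddir u (ddir v F) x = ddir v (ddir u F) x"
proof -
  have "ddir u (ddir v F) x $ i = ddir v (ddir u F) x $ i" for i
    using ddir_commute[OF smooth_vec_nth[OF assms], of u v i x]
    by (simp add: ddir_vec_nth assms smooth_ddir_any)
  then show ?thesis by (simp add: vec_eq_iff)
qed

lemma arc_metric_pullback_deriv:
  assumes s': "0 \<le> s'" "s' < 1" and F: "smooth F"
  shows "((\<lambda>x. ddir u F x \<bullet> (arc_metric lam s' (F x) *v ddir v F x)) has_derivative
    (\<lambda>w. ddir w (ddir u F) x \<bullet> (arc_metric lam s' (F x) *v ddir v F x)
       + ddir w F x $ 3 * (ddir u F x \<bullet> (arc_metric_diff lam s' (F x) *v ddir v F x))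
       + ddir u F x \<bullet> (arc_metric lam s' (F x) *v ddir w (ddir v F) x))) (at x)"
proof -
  have e: "((\<lambda>x. f (F x $ 3)) has_derivative (\<lambda>w. D * ddir w F x $ 3)) (at x)"
    if "(f has_real_derivative D) (at (F x $ 3))" for f D
    by (rule has_derivative_compose[OF bounded_linear.has_derivative[OF bounded_linear_vec_nth smooth_has_derivative[OF F]] that[unfolded has_field_derivative_def]])
  have d: "((\<lambda>x. ddir u F x $ i) has_derivative (\<lambda>w. ddir w (ddir u F) x $ i)) (at x)" for u i
    by (rule bounded_linear.has_derivative[OF bounded_linear_vec_nth smooth_has_derivative[OF smooth_ddir_any[OF F]]])
  show ?thesis unfolding arc_metric_k arc_metric_diff_def quad_block
    by (rule has_derivative_eq_rhs, (rule e k_deriv[OF s'] d has_derivative_add has_derivative_mult has_derivative_const)+)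
       (auto simp: fun_eq_iff algebra_simps)
qed

text \<open>The derivative in direction \<open>w\<close> of the isometry equation evaluated on constant vectors \<open>u\<close> and \<open>v\<close>.\<close>

lemma isometry_deriv:
  assumes s: "0 \<le> s" "s < 1" and s': "0 \<le> s'" "s' < 1" and F: "smooth F" "pullback_metric F (arc_metric lam s') = arc_metric lam s"
  shows "w $ 3 * (u \<bullet> (arc_metric_diff lam s x *v v)) =
       ddir w (ddir u F) x \<bullet> (arc_metric lam s' (F x) *v ddir v F x)
       + ddir w F x $ 3 * (ddir u F x \<bullet> (arc_metric_diff lam s' (F x) *v ddir v F x))
       + ddir u F x \<bullet> (arc_metric lam s' (F x) *v ddir w (ddir v F) x)"
proof -
  have eq: "(\<lambda>x. u \<bullet> (arc_metric lam s x *v v)) = (\<lambda>x. ddir u F x \<bullet> (arc_metric lam s' (F x) *v ddir v F x))"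
    unfolding F(2)[symmetric] quad_pullback[OF F(1)] ..
  then show ?thesis
    using has_derivative_unique[OF arc_metric_deriv[OF s, of u lam v x, unfolded eq] arc_metric_pullback_deriv[OF s' F(1), of u lam v x]]
    by meson
qed

lemma arc_metric_sym: "u \<bullet> (arc_metric lam s x *v v) = v \<bullet> (arc_metric lam s x *v u)"
  unfolding arc_metric_k quad_block by (simp add: algebra_simps)

text \<open>The components of an isometry are harmonic. In the sum over a frame of the differentiated isometry
equation the terms with the derivative of either metric drop out by \<open>arc_metric_frame_cancel\<close>, because
\<open>dF\<close> maps orthonormal frames to orthonormal frames. The symmetry of the second derivative cancels the
remaining terms except the inner product of the Laplacian of \<open>F\<close> with an arbitrary vector.\<close>

lemma isometry_harmonic:
  assumes lam: "lam > 1" and s: "0 \<le> s" "s < 1" and s': "0 \<le> s'" "s' < 1"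
    and F: "smooth F" "pullback_metric F (arc_metric lam s') = arc_metric lam s" and E: "frame (arc_metric lam s x) E"
  shows "(\<Sum>a\<in>UNIV. ddir (column a E) (ddir (column a E) F) x) = 0"
proof -
  let ?e = "\<lambda>a. column a E" and ?g = "arc_metric lam s' (F x)" and ?g' = "arc_metric_diff lam s' (F x)"
  let ?J = "matrix (frechet_derivative F (at x))"
  have fr: "frame ?g (?J ** E)"
    using frame_push[OF F(1), of "arc_metric lam s'" x E] E unfolding F(2) .
  have col: "column a (?J ** E) = ddir (?e a) F x" for a
    unfolding matrix_frechet[OF F(1), symmetric]
    by (simp add: column_def matrix_matrix_mult_def matrix_vector_mult_def vec_eq_iff)
  have c3: "(?J ** E) $ 3 $ a = ddir (?e a) F x $ 3" for a
    unfolding col[symmetric] by (simp add: column_def)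
  let ?L = "\<Sum>a\<in>UNIV. ddir (?e a) (ddir (?e a) F) x"
  have orth: "?L \<bullet> (?g *v ddir v F x) = 0" for v
  proof -
    have "E$3$a * (?e a \<bullet> (arc_metric_diff lam s x *v v)) - (1/2) * (v$3 * (?e a \<bullet> (arc_metric_diff lam s x *v ?e a)))
      = ddir (?e a) (ddir (?e a) F) x \<bullet> (?g *v ddir v F x)
       + (ddir (?e a) F x $ 3 * (ddir (?e a) F x \<bullet> (?g' *v ddir v F x))
       - (1/2) * (ddir v F x $ 3 * (ddir (?e a) F x \<bullet> (?g' *v ddir (?e a) F x))))" for a
    proof -
      have e3: "?e a $ 3 = E $ 3 $ a" by (simp add: column_def)
      note i1 = isometry_deriv[OF s s' F, of "?e a" "?e a" x v, unfolded e3]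
      note i2 = isometry_deriv[OF s s' F, of v "?e a" x "?e a", unfolded ddir_commute_vec[OF F(1), of v "?e a" x]]
      show ?thesis
        using i1 i2 arc_metric_sym[of "ddir (?e a) F x" lam s' "F x" "ddir (?e a) (ddir v F) x"] by linarith
    qed
    then have "0 = (\<Sum>a\<in>UNIV. ddir (?e a) (ddir (?e a) F) x \<bullet> (?g *v ddir v F x)
       + (ddir (?e a) F x $ 3 * (ddir (?e a) F x \<bullet> (?g' *v ddir v F x))
       - (1/2) * (ddir v F x $ 3 * (ddir (?e a) F x \<bullet> (?g' *v ddir (?e a) F x)))))"
      using arc_metric_frame_cancel[OF lam E, of v] by simp
    also have "\<dots> = (\<Sum>a\<in>UNIV. ddir (?e a) (ddir (?e a) F) x \<bullet> (?g *v ddir v F x))"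
      using arc_metric_frame_cancel[OF lam fr, of "ddir v F x"] unfolding col c3 sum.distrib by simp
    finally show ?thesis by (simp add: inner_sum_left)
  qed
  have "transpose (?J ** E) ** ?g ** (?J ** E) = mat 1" using fr by (simp add: frame_def)
  then have inv: "?J ** E ** (transpose (?J ** E) ** ?g) = mat 1" by (simp add: matrix_left_right_inverse)
  have "?J *v (E *v (transpose (?J ** E) *v (?g *v ?L))) = (?J ** E ** (transpose (?J ** E) ** ?g)) *v ?L"
    by (simp only: matrix_vector_mul_assoc matrix_mul_assoc)
  then have surj: "?J *v (E *v (transpose (?J ** E) *v (?g *v ?L))) = ?L"
    unfolding inv by simp
  \<comment> \<open>The vector which \<open>dF\<close> maps to \<open>?L\<close>, so that \<open>?L\<close> is orthogonal to itself.\<close>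
  define v where "v = E *v (transpose (?J ** E) *v (?g *v ?L))"
  have v: "ddir v F x = ?L" using surj unfolding v_def matrix_frechet[OF F(1)] by simp
  have "?L \<bullet> (?g *v ?L) = 0" using orth[of v] unfolding v .
  moreover have "?L \<noteq> 0 \<Longrightarrow> ?L \<bullet> (?g *v ?L) > 0"
    unfolding arc_metric_k using kappa_pos[OF lam] h11_pos[OF lam]
    by (intro block_pos k_det[OF lam]) (auto simp: k11_def)
  ultimately show ?thesis by fastforce
qed

lemma periodic_axesI:
  assumes "\<And>i x. f (x + axis i 1) = f x"
  shows "periodic f"
  unfolding periodic_def
proof (intro allI ballI)
  fix x v :: "real^3" assume v: "v \<in> lattice3"
  have *: "f (y + of_int k *\<^sub>R axis i 1) = f y" for y k i
    using periodic_shift_int[of "\<lambda>t. f (y + t *\<^sub>R axis i 1)" 0 k] assms[of "y + t *\<^sub>R axis i 1" i for t]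
    by (simp add: scaleR_add_left add.assoc)
  have k: "of_int \<lfloor>v $ i\<rfloor> = v $ i" for i
    using v by (auto simp: lattice3_def Ints_def)
  have "x + v = x + of_int \<lfloor>v $ 1\<rfloor> *\<^sub>R axis 1 1 + of_int \<lfloor>v $ 2\<rfloor> *\<^sub>R axis 2 1 + of_int \<lfloor>v $ 3\<rfloor> *\<^sub>R axis 3 1"
    by (simp add: k vec_eq_iff forall_3 axis_def)
  then show "f (x + v) = f x" by (simp only: *)
qed

lemma lattice_valued_constant:
  assumes "continuous_on UNIV f" "\<And>x::real^3. f x \<in> lattice3"
  shows "f x = f y"
proof -
  have "(\<lambda>x. f x $ i) constant_on UNIV" for i
  proof (rule continuous_discrete_range_constant)
    show "continuous_on UNIV (\<lambda>x. f x $ i)" using assms(1) by (intro continuous_intros)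
    fix x :: "real^3"
    have "1 \<le> norm (f y $ i - f x $ i)" if "f y $ i \<noteq> f x $ i" for y
      using assms(2)[of x] assms(2)[of y] that Ints_nonzero_abs_ge1[of "f y $ i - f x $ i"]
      by (simp add: lattice3_def)
    then show "\<exists>e>0. \<forall>y. y \<in> UNIV \<and> f y $ i \<noteq> f x $ i \<longrightarrow> e \<le> norm (f y $ i - f x $ i)"
      by (intro exI[of _ 1]) auto
  qed (rule convex_connected[OF convex_UNIV])
  then show ?thesis unfolding constant_on_def vec_eq_iff by (metis UNIV_I)
qed

lemma ddir_sum_pd:
  fixes f :: "real^3 \<Rightarrow> real"
  assumes "smooth f"
  shows "ddir v f x = v$1 * pd 1 f x + v$2 * pd 2 f x + v$3 * pd 3 f x"
proof -
  define L where "L = (\<lambda>v. ddir v f x)"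
  have lin: "linear L"
    using smooth_has_derivative[OF assms] has_derivative_linear unfolding L_def by blast
  have "v = v$1 *\<^sub>R axis 1 1 + v$2 *\<^sub>R axis 2 1 + v$3 *\<^sub>R axis 3 1"
    by (simp add: vec_eq_iff forall_3 axis_def)
  then have "L v = L (v$1 *\<^sub>R axis 1 1 + v$2 *\<^sub>R axis 2 1 + v$3 *\<^sub>R axis 3 1)" by simp
  also have "\<dots> = v$1 * L (axis 1 1) + v$2 * L (axis 2 1) + v$3 * L (axis 3 1)"
    by (simp add: linear_add[OF lin] linear_scale[OF lin])
  finally show ?thesis unfolding L_def .
qed

lemma ddir_ddir_sum:
  fixes f :: "real^3 \<Rightarrow> real"
  assumes "smooth f"
  shows "ddir u (ddir v f) x =
    u$1 * (v$1 * pd 1 (pd 1 f) x + v$2 * pd 2 (pd 1 f) x + v$3 * pd 3 (pd 1 f) x) +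
    u$2 * (v$1 * pd 1 (pd 2 f) x + v$2 * pd 2 (pd 2 f) x + v$3 * pd 3 (pd 2 f) x) +
    u$3 * (v$1 * pd 1 (pd 3 f) x + v$2 * pd 2 (pd 3 f) x + v$3 * pd 3 (pd 3 f) x)"
proof -
  have "pd i (ddir v f) x = v$1 * pd 1 (pd i f) x + v$2 * pd 2 (pd i f) x + v$3 * pd 3 (pd i f) x" for i
    unfolding ddir_commute[OF assms, of "axis i 1" v x] by (rule ddir_sum_pd[OF smooth_ddir_any[OF assms]])
  moreover have "ddir u (ddir v f) x = u$1 * pd 1 (ddir v f) x + u$2 * pd 2 (ddir v f) x + u$3 * pd 3 (ddir v f) x"
    by (rule ddir_sum_pd[OF smooth_ddir_any[OF assms]])
  ultimately show ?thesis by presburger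
qed

text \<open>The energy method: the Laplacian has divergence form, since its variable coefficients multiply
only derivatives in the directions \<open>x\<close> and \<open>y\<close>. Integrating \<open>P\<close> times the Laplacian of \<open>P\<close> by parts shows
that the squared norm \<open>\<Gamma>\<close> of the gradient has integral zero.\<close>

lemma periodic_harmonic_constant:
  fixes P :: "real^3 \<Rightarrow> real"
  assumes P: "smooth P" "periodic P"
    and sm: "smooth a" "smooth b" "smooth c" and per: "\<And>t. a (t + 1) = a t" "\<And>t. b (t + 1) = b t" "\<And>t. c (t + 1) = c t"
    and det: "\<And>t. a t * c t - (b t)\<^sup>2 = 1" and pos: "\<And>t. a t > 0" "K > 0"
    and harm: "\<And>x. a (x$3) * pd 1 (pd 1 P) x + b (x$3) * pd 1 (pd 2 P) x + b (x$3) * pd 2 (pd 1 P) x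
      + c (x$3) * pd 2 (pd 2 P) x + K * pd 3 (pd 3 P) x = 0"
  shows "pd i P x = 0"
proof -
  define grad where "grad = (\<lambda>x. vector [pd 1 P x, pd 2 P x, pd 3 P x] :: real^3)"
  define \<Gamma> where "\<Gamma> = (\<lambda>x. grad x \<bullet> (block (a (x$3)) (b (x$3)) (c (x$3)) K *v grad x))"
  have sp: "smooth (pd i P)" and pp: "periodic (pd i P)" for i
    using P by (auto intro: smooth_ddir_any periodic_ddir)
  have s2: "smooth (\<lambda>y. P y * pd j P y)" and p2: "periodic (\<lambda>y. P y * pd j P y)" for j
    using P sp pp by (auto intro: smooth_mult periodic_map2)
  have d: "pd i (\<lambda>y. P y * pd j P y) = (\<lambda>x. P x * pd i (pd j P) x + pd i P x * pd j P x)" for i j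
    by (rule ddir_eqI) (rule has_derivative_mult[OF smooth_has_derivative[OF P(1)] smooth_has_derivative[OF sp]])
  have "((\<lambda>x. a (x$3) * pd 1 (\<lambda>y. P y * pd 1 P y) x + b (x$3) * pd 1 (\<lambda>y. P y * pd 2 P y) x
      + b (x$3) * pd 2 (\<lambda>y. P y * pd 1 P y) x + c (x$3) * pd 2 (\<lambda>y. P y * pd 2 P y) x
      + K * pd 3 (\<lambda>y. P y * pd 3 P y) x) has_integral 0 + 0 + 0 + 0 + 0) (cbox 0 1)"
    by (intro has_integral_add pd_parts0 pd_const0 sm per s2 p2) auto
  moreover have "a (x$3) * pd 1 (\<lambda>y. P y * pd 1 P y) x + b (x$3) * pd 1 (\<lambda>y. P y * pd 2 P y) x
      + b (x$3) * pd 2 (\<lambda>y. P y * pd 1 P y) x + c (x$3) * pd 2 (\<lambda>y. P y * pd 2 P y) x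
      + K * pd 3 (\<lambda>y. P y * pd 3 P y) x = \<Gamma> x" for x
  proof -
    have "a (x$3) * pd 1 (\<lambda>y. P y * pd 1 P y) x + b (x$3) * pd 1 (\<lambda>y. P y * pd 2 P y) x
      + b (x$3) * pd 2 (\<lambda>y. P y * pd 1 P y) x + c (x$3) * pd 2 (\<lambda>y. P y * pd 2 P y) x
      + K * pd 3 (\<lambda>y. P y * pd 3 P y) x = P x * (a (x$3) * pd 1 (pd 1 P) x + b (x$3) * pd 1 (pd 2 P) x + b (x$3) * pd 2 (pd 1 P) x
      + c (x$3) * pd 2 (pd 2 P) x + K * pd 3 (pd 3 P) x) + \<Gamma> x"
      unfolding d \<Gamma>_def quad_block grad_def vector_3 by (simp add: algebra_simps)
    then show ?thesis unfolding harm by simp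
  qed
  ultimately have int: "(\<Gamma> has_integral 0) (cbox 0 1)" by simp
  have nonneg: "\<Gamma> x \<ge> 0" for x
    using block_pos[OF det pos, of "grad x"] unfolding \<Gamma>_def by (cases "grad x = 0") (auto intro: less_imp_le)
  have "smooth \<Gamma>"
    unfolding \<Gamma>_def quad_block grad_def vector_3
    by (intro smooth_add smooth_mult smooth_const smooth_of_t sm sp)
  have "periodic (\<lambda>p. block (a (p$3)) (b (p$3)) (c (p$3)) K)"
    by (rule periodic_of_t[of "\<lambda>t. block (a t) (b t) (c t) K"]) (simp add: per)
  then have pG: "periodic \<Gamma>"
    using pp unfolding \<Gamma>_def grad_def periodic_def by simp
  have "\<Gamma> y = 0" if y: "y \<in> cbox 0 1" for y
  proof (rule has_integral_0_cbox_imp_0[OF _ nonneg int _ y])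
    show "continuous_on (cbox 0 1) \<Gamma>" by (rule smooth_continuous_on) fact
    show "box (0::real^3) 1 \<noteq> {}" unfolding One_vec[symmetric] by (rule box_ne_empty(2)[THEN iffD2]) simp
  qed
  then have "\<Gamma> x = 0" using lattice_reduce[of x] pG unfolding periodic_def by metis
  then have "grad x = 0" using block_pos[OF det pos, of "grad x" "x$3"] unfolding \<Gamma>_def by fastforce
  then show ?thesis using exhaust_3[of i] unfolding grad_def vec_eq_iff forall_3 vector_3 by auto
qed

lemma isometry_component_harmonic:
  assumes lam: "lam > 1" and s: "0 \<le> s" "s < 1" and s': "0 \<le> s'" "s' < 1"
    and F: "smooth F" "pullback_metric F (arc_metric lam s') = arc_metric lam s"
  defines "f \<equiv> \<lambda>k x. F x $ k"
  shows "k22 lam s (x$3) * pd 1 (pd 1 (f k)) x + (- k12 lam s (x$3)) * pd 1 (pd 2 (f k)) x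
   + (- k12 lam s (x$3)) * pd 2 (pd 1 (f k)) x + k11 lam s (x$3) * pd 2 (pd 2 (f k)) x + (kappa lam)\<^sup>2 * pd 3 (pd 3 (f k)) x = 0"
proof -
  obtain E where E: "frame (arc_metric lam s x) E" using arc_metric_frame_exists[OF lam] by blast
  let ?a = "k11 lam s (x$3)" and ?b = "k12 lam s (x$3)" and ?c = "k22 lam s (x$3)"
  have ent: "E$i$1 * E$j$1 + E$i$2 * E$j$2 + E$i$3 * E$j$3 = block ?c (- ?b) ?a ((kappa lam)\<^sup>2) $ i $ j" for i j
    unfolding arc_metric_frame_inverse[OF lam E, symmetric] by (simp add: matrix_matrix_mult_def transpose_def sum_3)
  have sf: "smooth (f k)" unfolding f_def by (rule smooth_vec_nth[OF F(1)])
  have "0 = (\<Sum>a\<in>UNIV. ddir (column a E) (ddir (column a E) F) x) $ k"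
    using isometry_harmonic[OF lam s s' F E] by simp
  also have "\<dots> = (\<Sum>a\<in>UNIV. ddir (column a E) (ddir (column a E) (f k)) x)"
    unfolding f_def by (simp add: ddir_vec_nth F(1) smooth_ddir_any)
  also have "\<dots> = (\<Sum>i\<in>UNIV. \<Sum>j\<in>UNIV. (E$i$1 * E$j$1 + E$i$2 * E$j$2 + E$i$3 * E$j$3) * pd j (pd i (f k)) x)"
    unfolding sum_3 ddir_ddir_sum[OF sf, of "column 1 E" "column 1 E"]
      ddir_ddir_sum[OF sf, of "column 2 E" "column 2 E"] ddir_ddir_sum[OF sf, of "column 3 E" "column 3 E"]
    by (simp add: column_def algebra_simps)
  also have "\<dots> = ?c * pd 1 (pd 1 (f k)) x + (- ?b) * pd 1 (pd 2 (f k)) x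
   + (- ?b) * pd 2 (pd 1 (f k)) x + ?a * pd 2 (pd 2 (f k)) x + (kappa lam)\<^sup>2 * pd 3 (pd 3 (f k)) x"
    unfolding ent sum_3 by simp
  finally show ?thesis by simp
qed

text \<open>The lift \<open>F\<close> changes by a constant lattice vector under each unit translation, so \<open>F\<close> differs from a
linear map \<open>A\<close> by a periodic map. Linear functions are harmonic for the metric because its Laplacian
has no first-order terms; so the periodic map is harmonic too, and therefore constant.\<close>

lemma isometry_affine:
  assumes lam: "lam > 1" and s: "0 \<le> s" "s < 1" and s': "0 \<le> s'" "s' < 1"
    and F: "torus_map F" "pullback_metric F (arc_metric lam s') = arc_metric lam s"
  obtains A where "\<And>x u. ddir u F x = A *v u"
proof -
  have sF: "smooth F" using F(1) by (simp add: torus_map_def)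
  \<comment> \<open>The columns of \<open>A\<close> are the translation vectors of \<open>F\<close> along the generators of the lattice.\<close>
  define A :: "real^3^3" where "A = (\<chi> k j. (F (axis j 1) - F 0) $ k)"
  have shift: "F (x + axis j 1) - F x = F (axis j 1) - F 0" for x j
  proof -
    have "F (x + axis j 1) - F x = F (0 + axis j 1) - F 0"
    proof (rule lattice_valued_constant[of "\<lambda>x. F (x + axis j 1) - F x"])
      show "continuous_on UNIV (\<lambda>x. F (x + axis j 1) - F x)"
        by (intro continuous_intros continuous_on_compose2[OF smooth_continuous_on[OF sF, of UNIV]]) auto
      show "F (x + axis j 1) - F x \<in> lattice3" for x
        using F(1) axis_lattice3 by (simp add: torus_map_def)
    qed
    then show ?thesis by simp
  qed
  have lin: "pd j (\<lambda>x. (A *v x) $ k) = (\<lambda>_. A $ k $ j)" for j k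
  proof -
    have "((\<lambda>x. (A *v x) $ k) has_derivative (\<lambda>v. (A *v v) $ k)) (at x)" for x
      by (intro bounded_linear_imp_has_derivative bounded_linear_compose[OF bounded_linear_vec_nth] matrix_vector_mul_bounded_linear)
    from ddir_eqI[OF this] show ?thesis
      by (simp add: matrix_vector_mult_basis column_def)
  qed
  have "pd j (\<lambda>y. F y $ k) x = A $ k $ j" for j k x
  proof -
    let ?f = "\<lambda>y. F y $ k"
    let ?P = "\<lambda>y. F y $ k - (A *v y) $ k"
    have sf: "smooth ?f" by (rule smooth_vec_nth[OF sF])
    have sl: "smooth (\<lambda>y. (A *v y) $ k)"
      by (intro smooth_vec_nth smooth_linear[OF matrix_vector_mul_bounded_linear] smooth_id)
    have sP: "smooth ?P" by (intro smooth_diff sf sl)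
    have "?P (x + axis i 1) = ?P x" for x i
    proof -
      have "(A *v axis i 1) $ k = F (axis i 1) $ k - F 0 $ k"
        by (simp add: matrix_vector_mult_basis column_def A_def)
      moreover have "F (x + axis i 1) $ k - F x $ k = F (axis i 1) $ k - F 0 $ k"
        using shift[of x i] by (simp flip: vector_minus_component)
      ultimately show ?thesis by (simp add: matrix_vector_right_distrib)
    qed
    then have pP: "periodic ?P" by (rule periodic_axesI)
    have d1: "pd i ?P = (\<lambda>x. pd i ?f x - A $ k $ i)" for i
    proof -
      have "((\<lambda>y. F y $ k - (A *v y) $ k) has_derivative (\<lambda>v. ddir v ?f x - ddir v (\<lambda>y. (A *v y) $ k) x)) (at x)" for x
        by (intro has_derivative_diff smooth_has_derivative sf sl)
      from ddir_eqI[OF this] show ?thesis by (simp add: lin)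
    qed
    have d2: "pd i (pd j ?P) = pd i (pd j ?f)" for i j
    proof -
      have "((\<lambda>x. pd j ?f x - A $ k $ j) has_derivative (\<lambda>v. ddir v (pd j ?f) x - 0)) (at x)" for x
        by (intro has_derivative_diff has_derivative_const smooth_has_derivative smooth_ddir_any sf)
      from ddir_eqI[OF this] show ?thesis unfolding d1 by simp
    qed
    note k = smooth_k[OF s, of lam] and kp = k_periodic[OF s, of lam]
    have "pd j ?P x = 0"
    proof (rule periodic_harmonic_constant[OF sP pP, of "k22 lam s" "\<lambda>t. - k12 lam s t" "k11 lam s" "(kappa lam)\<^sup>2"])
      show "k22 lam s t * k11 lam s t - (- k12 lam s t)\<^sup>2 = 1" for t
        using k_det[OF lam, of s t] by (simp add: mult.commute)
      show "k22 lam s t > 0" for t unfolding k22_def by (rule h22_pos[OF lam])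
      show "0 < (kappa lam)\<^sup>2" using kappa_pos[OF lam] by simp
      show "k22 lam s (x $ 3) * pd 1 (pd 1 ?P) x + - k12 lam s (x $ 3) * pd 1 (pd 2 ?P) x + - k12 lam s (x $ 3) * pd 2 (pd 1 ?P) x
        + k11 lam s (x $ 3) * pd 2 (pd 2 ?P) x + (kappa lam)\<^sup>2 * pd 3 (pd 3 ?P) x = 0" for x
        unfolding d2 by (rule isometry_component_harmonic[OF lam s s' sF F(2)])
    qed (use k kp in \<open>auto intro: smooth_minus\<close>)
    then show ?thesis unfolding d1 by simp
  qed
  then have pdF: "pd j (\<lambda>y. F y $ k) x = A $ k $ j" for j k x .
  have "ddir u F x = A *v u" for x u
  proof -
    have "ddir u F x $ k = ddir u (\<lambda>y. F y $ k) x" for k by (simp add: ddir_vec_nth[OF sF])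
    then have "ddir u F x $ k = (A *v u) $ k" for k
      unfolding ddir_sum_pd[OF smooth_vec_nth[OF sF], of u] pdF
      by (simp add: matrix_vector_mult_def sum_3 mult.commute)
    then show ?thesis by (simp add: vec_eq_iff)
  qed
  then show ?thesis using that by blast
qed

text \<open>Expressed through the inverse metric \<open>M\<close>, this is the trace of \<open>(K M)\<^sup>2\<close> with \<open>K\<close> the derivative of the
metric; the value no longer depends on the angle.\<close>

lemma trace_arc_metric_diff:
  assumes "lam > 1" "frame (arc_metric lam s y) E"
  shows "trace ((transpose E ** arc_metric_diff lam s y ** E) ** (transpose E ** arc_metric_diff lam s y ** E)) = 2 * (twist lam s (y$3))\<^sup>2"
proof -
  let ?a = "k11 lam s (y$3)" and ?b = "k12 lam s (y$3)" and ?c = "k22 lam s (y$3)"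
  let ?K = "arc_metric_diff lam s y" and ?M = "block ?c (- ?b) ?a ((kappa lam)\<^sup>2)"
  note EE = arc_metric_frame_inverse[OF assms]
  have "trace ((transpose E ** ?K ** E) ** (transpose E ** ?K ** E)) = trace (transpose E ** (?K ** (E ** transpose E) ** ?K ** E))"
    by (simp add: matrix_mul_assoc)
  also have "\<dots> = trace ((?K ** (E ** transpose E) ** ?K ** E) ** transpose E)"
    by (rule trace_mul_sym)
  also have "\<dots> = trace ((?K ** ?M) ** (?K ** ?M))"
    unfolding EE[symmetric] by (simp add: matrix_mul_assoc)
  also have "\<dots> = 2 * (twist lam s (y$3))\<^sup>2"
  proof -
    \<comment> \<open>The remaining identity is polynomial once the trigonometric functions and the eigenvalue data are
      abstracted to variables constrained by \<open>C\<^sup>2 + S\<^sup>2 = 1\<close> and \<open>m\<^sup>2 - e\<^sup>2 = 1\<close>.\<close>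
    define u C S m e where "u = twist lam s (y$3)" "C = cos_arc s (y$3)" "S = sin_arc s (y$3)" "m = mean lam" "e = ecc lam"
    have cs: "C\<^sup>2 + S\<^sup>2 = 1" unfolding u_C_S_m_e_def by (rule cos_sin_arc)
    have me: "m\<^sup>2 - e\<^sup>2 = 1" unfolding u_C_S_m_e_def by (rule mean_ecc[OF assms(1)])
    have "trace ((?K ** ?M) ** (?K ** ?M)) =
      (- u * S * (m - e * C) + (- u * C) * (e * S)) * (- u * S * (m - e * C) + (- u * C) * (e * S))
      + 2 * ((- u * S * (e * S) + (- u * C) * (m + e * C)) * ((- u * C) * (m - e * C) + u * S * (e * S)))
      + ((- u * C) * (e * S) + u * S * (m + e * C)) * ((- u * C) * (e * S) + u * S * (m + e * C))"
      unfolding arc_metric_diff_def k_eq block_mult u_C_S_m_e_def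
      by (simp add: trace_def sum_3 matrix_matrix_mult_def vector_3)
    also have "\<dots> = 2 * u\<^sup>2" using cs me by algebra
    finally show ?thesis unfolding u_C_S_m_e_def .
  qed
  finally show ?thesis .
qed

text \<open>For an affine isometry with linear part \<open>A\<close> the second derivatives vanish, and the isometry equation
differentiated in direction 3 identifies the derivatives of the two metrics up to the factor
\<open>\<alpha> = A $ 3 $ 3\<close>. The trace invariant then gives
\<open>1 + s' sin (2 pi psi') = \<bar>\<alpha>\<bar> (1 + s sin (2 pi psi))\<close> at corresponding points. Both sides attain their
extreme values, so \<open>1 + s' = \<bar>\<alpha>\<bar> (1 + s)\<close> and \<open>1 - s' = \<bar>\<alpha>\<bar> (1 - s)\<close>, and addition gives \<open>\<bar>\<alpha>\<bar> = 1\<close>.\<close>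

lemma arc_metric_isometric_eq:
  assumes lam: "lam > 1" and s: "0 \<le> s" "s < 1" and s': "0 \<le> s'" "s' < 1"
    and F: "torus_map F" "pullback_metric F (arc_metric lam s') = arc_metric lam s"
  shows "s = s'"
proof -
  have sF: "smooth F" using F(1) by (simp add: torus_map_def)
  obtain A where A: "\<And>x u. ddir u F x = A *v u" using isometry_affine[OF assms] by blast
  have dd: "ddir w (ddir u F) x = 0" for w u x
  proof -
    have "ddir u F = (\<lambda>_. A *v u)" using A by auto
    then show ?thesis using fun_cong[OF ddir_eqI[OF has_derivative_const], of w "A *v u" x] by simp
  qed
  have J: "matrix (frechet_derivative F (at x)) = A" for x
    using matrix_frechet[OF sF, of x] unfolding A by (simp add: matrix_eq)
  define \<alpha> where "\<alpha> = A $ 3 $ 3"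
  have K: "arc_metric_diff lam s x = \<alpha> *\<^sub>R (transpose A ** arc_metric_diff lam s' (F x) ** A)" for x
  proof (rule mat_eq_quad)
    fix u v
    have "(axis 3 1 :: real^3) $ 3 * (u \<bullet> (arc_metric_diff lam s x *v v)) = (A *v axis 3 1) $ 3 * ((A *v u) \<bullet> (arc_metric_diff lam s' (F x) *v (A *v v)))"
      using isometry_deriv[OF s s' sF F(2), of "axis 3 1" u x v] unfolding dd by (simp add: A)
    also have "(A *v u) \<bullet> (arc_metric_diff lam s' (F x) *v (A *v v)) = u \<bullet> ((transpose A ** arc_metric_diff lam s' (F x) ** A) *v v)"
      by (simp flip: matrix_vector_mul_assoc) (metis dot_lmul_matrix inner_commute transpose_matrix_vector)
    finally show "u \<bullet> (arc_metric_diff lam s x *v v) = u \<bullet> ((\<alpha> *\<^sub>R (transpose A ** arc_metric_diff lam s' (F x) ** A)) *v v)"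
      by (simp add: matrix_vector_mult_basis column_def \<alpha>_def scaleR_matrix_vector_assoc[symmetric])
  qed
  have om: "(twist lam s (x$3))\<^sup>2 = \<alpha>\<^sup>2 * (twist lam s' (F x $ 3))\<^sup>2" for x
  proof -
    obtain E where E: "frame (arc_metric lam s x) E" using arc_metric_frame_exists[OF lam] by blast
    have fr: "frame (arc_metric lam s' (F x)) (A ** E)"
      using frame_push[OF sF, of "arc_metric lam s'" x E] E unfolding F(2) J .
    have "transpose E ** arc_metric_diff lam s x ** E = \<alpha> *\<^sub>R (transpose (A ** E) ** arc_metric_diff lam s' (F x) ** (A ** E))"
      unfolding K[of x] by (simp add: matrix_transpose_mul matrix_mul_assoc matrix_scaleR scalar_matrix_assoc matrix_scalar_ac)
    then have "2 * (twist lam s (x$3))\<^sup>2 = trace ((\<alpha> *\<^sub>R (transpose (A ** E) ** arc_metric_diff lam s' (F x) ** (A ** E))) ** (\<alpha> *\<^sub>R (transpose (A ** E) ** arc_metric_diff lam s' (F x) ** (A ** E))))"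
      using trace_arc_metric_diff[OF lam E] by simp
    also have "\<dots> = \<alpha>\<^sup>2 * (2 * (twist lam s' (F x $ 3))\<^sup>2)"
      unfolding trace_arc_metric_diff[OF lam fr, symmetric]
      by (simp add: trace_def matrix_matrix_mult_def sum_distrib_left power2_eq_square mult_ac)
    finally show ?thesis by simp
  qed
  let ?v = "\<lambda>s t. 1 + s * sin (2 * pi * psi s t)"
  have rel: "?v s' (F x $ 3) = \<bar>\<alpha>\<bar> * ?v s (x $ 3)" for x
  proof -
    have p: "?v s (x$3) > 0" "?v s' (F x $ 3) > 0" using speed_pos s s' by auto
    have "4 * pi * ecc lam \<noteq> 0" using ecc_pos[OF lam] by simp
    moreover have "(4 * pi * ecc lam)\<^sup>2 * (inverse (?v s (x$3)))\<^sup>2 = (4 * pi * ecc lam)\<^sup>2 * (\<alpha>\<^sup>2 * (inverse (?v s' (F x $ 3)))\<^sup>2)"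
      using om[of x] unfolding twist_def psi(5)[OF s] psi(5)[OF s'] power_mult_distrib by (simp only: mult_ac)
    ultimately have "(inverse (?v s (x$3)))\<^sup>2 = \<alpha>\<^sup>2 * (inverse (?v s' (F x $ 3)))\<^sup>2" by simp
    then have "(inverse (?v s (x$3)))\<^sup>2 = (\<bar>\<alpha>\<bar> * inverse (?v s' (F x $ 3)))\<^sup>2"
      by (simp add: power_mult_distrib)
    then have "inverse (?v s (x$3)) = \<bar>\<alpha>\<bar> * inverse (?v s' (F x $ 3))"
      by (rule power2_eq_imp_eq) (use p in auto)
    then show ?thesis using p by (simp add: field_simps)
  qed
  have \<alpha>: "\<bar>\<alpha>\<bar> > 0"
  proof (rule ccontr)
    assume "\<not> \<bar>\<alpha>\<bar> > 0"
    then have "?v s' (F 0 $ 3) = 0" using rel[of 0] by simp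
    then show False using speed_pos[OF s', of "2 * pi * psi s' (F 0 $ 3)"] by simp
  qed
  have line: "F (t *\<^sub>R axis 3 1) $ 3 = F 0 $ 3 + \<alpha> * t" for t
  proof -
    have "((\<lambda>t. F (0 + t *\<^sub>R axis 3 1) $ 3 - \<alpha> * t) has_real_derivative 0) (at t)" for t
      using bounded_linear.has_vector_derivative[OF bounded_linear_vec_nth line_has_vector_derivative[OF sF, of 0 "axis 3 1" t UNIV], of 3]
      unfolding A has_real_derivative_iff_has_vector_derivative
      by (auto intro!: derivative_eq_intros simp: matrix_vector_mult_basis column_def \<alpha>_def)
    then have "F (0 + t *\<^sub>R axis 3 1) $ 3 - \<alpha> * t = F (0 + 0 *\<^sub>R axis 3 1) $ 3 - \<alpha> * 0"
      by (intro DERIV_isconst_all) blast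
    then show ?thesis by simp
  qed
  have rel1: "?v s' (F 0 $ 3 + \<alpha> * t) = \<bar>\<alpha>\<bar> * ?v s t" for t
    using rel[of "t *\<^sub>R axis 3 1"] unfolding line by simp
  have sin14: "sin (2 * pi * (1/4)) = 1" "sin (2 * pi * (3/4)) = -1"
    using sin_3over2_pi by (simp_all add: mult.commute)
  have le: "\<bar>s * sin u\<bar> \<le> s" "\<bar>s' * sin u\<bar> \<le> s'" for u :: real
    using s s' abs_sin_le_one[of u] by (simp_all add: abs_mult mult_left_le)
  have "\<bar>\<alpha>\<bar> * (1 + s) \<le> 1 + s'" "1 - s' \<le> \<bar>\<alpha>\<bar> * (1 - s)"
    using rel1[of "arc_len s (1/4)"] rel1[of "arc_len s (3/4)"] le(2)[of "2 * pi * psi s' (F 0 $ 3 + \<alpha> * arc_len s (1/4))"]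
      le(2)[of "2 * pi * psi s' (F 0 $ 3 + \<alpha> * arc_len s (3/4))"]
    unfolding psi(3)[OF s] sin14 mult_1_right mult_minus1_right add_uminus_conv_diff by linarith+
  moreover have "1 + s' \<le> \<bar>\<alpha>\<bar> * (1 + s)" "\<bar>\<alpha>\<bar> * (1 - s) \<le> 1 - s'"
  proof -
    let ?t = "\<lambda>y. (arc_len s' y - F 0 $ 3) / \<alpha>"
    have r: "1 + s' * sin (2 * pi * y) = \<bar>\<alpha>\<bar> * ?v s (?t y)" for y
      using rel1[of "?t y"] \<alpha> by (simp add: psi(3)[OF s'])
    have "?v s (?t (1/4)) \<le> 1 + s" "1 - s \<le> ?v s (?t (3/4))"
      using le(1)[of "2 * pi * psi s (?t (1/4))"] le(1)[of "2 * pi * psi s (?t (3/4))"] by linarith+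
    then have "\<bar>\<alpha>\<bar> * ?v s (?t (1/4)) \<le> \<bar>\<alpha>\<bar> * (1 + s)" "\<bar>\<alpha>\<bar> * (1 - s) \<le> \<bar>\<alpha>\<bar> * ?v s (?t (3/4))"
      using \<alpha> by (auto intro!: mult_left_mono)
    then show "1 + s' \<le> \<bar>\<alpha>\<bar> * (1 + s)" "\<bar>\<alpha>\<bar> * (1 - s) \<le> 1 - s'"
      using r[of "1/4"] r[of "3/4"] unfolding sin14 by linarith+
  qed
  ultimately have e: "\<bar>\<alpha>\<bar> * (1 + s) = 1 + s'" "\<bar>\<alpha>\<bar> * (1 - s) = 1 - s'" by linarith+
  then have "\<bar>\<alpha>\<bar> = 1" by (simp add: algebra_simps)
  then show ?thesis using e by simp
qed

theorem corollary4p3: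
  "(\<forall>lam>1. \<forall>s\<in>{0..<1}.
      riemannian_metric (g_metric lam s) \<and> \<not> flat_metric (g_metric lam s) \<and>
      (\<forall>a b c. stable_norm (g_metric lam s) (r_class a b c) = ereal (sqrt (a^2 + b^2 + c^2)))) \<and>
   (\<forall>lam>1.
      (\<forall>s\<in>{0..<1}. torus_volume (g_metric lam s) = inverse (kappa lam)) \<and>
      (\<forall>s\<in>{0..<1}. \<forall>s'\<in>{0..<1}. s \<noteq> s' \<longrightarrow>
        \<not> isometric_metrics (g_metric lam s) (g_metric lam s'))) \<and>
   (\<forall>s\<in>{0..<1}. \<exists>\<phi> :: real \<Rightarrow> real^3 \<Rightarrow> real^3.
      (\<forall>lam>1. torus_diffeo (\<phi> lam) \<and> isotopic_to_id (\<phi> lam)) \<and>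
      Cinf_tendsto (\<lambda>lam. pullback_metric (\<phi> lam) (g_metric lam s)) euclidean_metric (at_right 1))"
proof (intro conjI allI impI ballI)
  fix lam s :: real assume lam: "lam > 1" and "s \<in> {0..<1}"
  then have s: "0 \<le> s" "s < 1" by auto
  show "riemannian_metric (g_metric lam s)" by (rule riemannian_g[OF lam s])
  show "\<not> flat_metric (g_metric lam s)" by (rule not_flat_g[OF lam s])
  show "stable_norm (g_metric lam s) (r_class a b c) = ereal (sqrt (a^2 + b^2 + c^2))" for a b c
    by (rule stable_norm_g[OF lam s])
  show "torus_volume (g_metric lam s) = inverse (kappa lam)" by (rule volume_g[OF lam s])
  show "\<not> isometric_metrics (g_metric lam s) (g_metric lam s')" if "s' \<in> {0..<1}" "s \<noteq> s'" for s'
  proof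
    have s': "0 \<le> s'" "s' < 1" using that by auto
    assume "isometric_metrics (g_metric lam s) (g_metric lam s')"
    then obtain F where "torus_map F" "pullback_metric F (arc_metric lam s') = arc_metric lam s"
      by (rule isometric_arc_metric[OF s s'])
    then have "s = s'" by (rule arc_metric_isometric_eq[OF lam s s'])
    then show False using that by simp
  qed
next
  fix s :: real assume "s \<in> {0..<1}"
  then have s: "0 \<le> s" "s < 1" by auto
  note p = psi[OF s]
  show "\<exists>\<phi> :: real \<Rightarrow> real^3 \<Rightarrow> real^3.
      (\<forall>lam>1. torus_diffeo (\<phi> lam) \<and> isotopic_to_id (\<phi> lam)) \<and>
      Cinf_tendsto (\<lambda>lam. pullback_metric (\<phi> lam) (g_metric lam s)) euclidean_metric (at_right 1)"
    using torus_diffeo_base_map[OF p(1,6,4)] isotopic_base_map[OF p(1,6,4)] arc_metric_converges[OF s]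
    by (intro exI[of _ "\<lambda>_. base_map (psi s)"]) (simp add: pullback_psi[OF s])
qed

end
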